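(* Let $l,m\ge 1$ be integers and $n=l+m+2$. Let $H:\mathbb{R}\to\mathbb{R}$ be a continuous function, and fix $s_0\in\mathbb{R}$. Then, for any positive numbers $c>0$, $d>0$ and any real numbers $c',d'$ with $c'^2+d'^2=1$, there exists a global solution curve $(x(s),y(s))$, $s\in\mathbb{R}$, of the system $$l\frac{y'(s)}{x(s)}-m\frac{x'(s)}{y(s)}-\bigl(x''(s)y'(s)-x'(s)y''(s)\bigr)+(n-1)H(s)=0,\qquad x'(s)^2+y'(s)^2=1,$$ with the initial conditions $x(s_0)=c$, $y(s_0)=d$, $x'(s_0)=c'$, $y'(s_0)=d'$.
   Context: The system describes generating curves, parametrized by arc length, of generalized rotational hypersurfaces $\{(x(s)\omega_1,y(s)\omega_2): s\in\mathbb{R},\ \omega_1\in S^l,\ \omega_2\in S^m\}\subset\mathbb{R}^{l+1}\times\mathbb{R}^{m+1}=\mathbb{R}^n$ with mean curvature $H(s)$. Global solution curve: a pair of functions $x,y\in C^1(\mathbb{R})$ with $x'^2+y'^2=1$ on all of $\mathbb{R}$, such that $x,y$ are of class $C^2$ on the open set $\{s: x(s)y(s)\neq 0\}$ and the first equation of the system holds at every $s$ with $x(s)y(s)\ne 0$. When the curve, starting in the quadrant $x>0,y>0$, reaches the $x$-axis, the $y$-axis or the origin, it is continued as a $C^1$ curve beyond that point (possibly into regions where $x<0$ or $y<0$; the generating curve of the hypersurface is then obtained by reflection). *)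

theory Defs
  imports "HOL-Analysis.Analysis"
begin

definition C2_differentiable_on :: "(real \<Rightarrow> real) \<Rightarrow> real set \<Rightarrow> bool"
    (infix \<open>C2'_differentiable'_on\<close> 50) where
  "f C2_differentiable_on S \<longleftrightarrow>
     f C1_differentiable_on S \<and> deriv f C1_differentiable_on S"

(* l and m are the dimensions of the spheres swept out by the generating curve, so the
   hypersurface lies in R^(l+1) x R^(m+1) and has dimension n - 1 = l + m + 1.
   The curve may enter the regions x < 0 or y < 0; there the equation is required in the
   same form, with x and y signed. *)
definition mean_curvature_equation_at ::
    "nat \<Rightarrow> nat \<Rightarrow> nat \<Rightarrow> (real \<Rightarrow> real) \<Rightarrow> (real \<Rightarrow> real) \<Rightarrow> (real \<Rightarrow> real) \<Rightarrow> real \<Rightarrow> bool" where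
  "mean_curvature_equation_at l m n H x y s \<longleftrightarrow>
     real l * (deriv y s / x s) - real m * (deriv x s / y s)
       - (deriv (deriv x) s * deriv y s - deriv x s * deriv (deriv y) s)
       + (real n - 1) * H s = 0"

definition global_solution_curve ::
    "nat \<Rightarrow> nat \<Rightarrow> nat \<Rightarrow> (real \<Rightarrow> real) \<Rightarrow> (real \<Rightarrow> real) \<Rightarrow> (real \<Rightarrow> real) \<Rightarrow> bool" where
  "global_solution_curve l m n H x y \<longleftrightarrow>
     x C1_differentiable_on UNIV \<and> y C1_differentiable_on UNIV \<and>
     (\<forall>s. (deriv x s)\<^sup>2 + (deriv y s)\<^sup>2 = 1) \<and>
     x C2_differentiable_on {s. x s * y s \<noteq> 0} \<and>
     y C2_differentiable_on {s. x s * y s \<noteq> 0} \<and>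
     (\<forall>s. x s * y s \<noteq> 0 \<longrightarrow> mean_curvature_equation_at l m n H x y s)"

end

theory Submission
  imports Defs "HOL-Complex_Analysis.Great_Picard"
begin

text \<open>Write \<open>x' = cos t\<close>, \<open>y' = sin t\<close>; the curvature equation then prescribes \<open>t'\<close>, with a
  right-hand side that is singular on the axes. A local solution exists from every position on an axis
  with orthogonal direction, and from the origin with a direction on the minimal cone; it is a limit
  of solutions starting next to the singular point. Conversely, a solution on \<open>[a, T)\<close> converges to
  such a state (or to a regular one). For an axis this follows from the convexity of the squared
  distance to the axis and the boundedness of the derivative of \<open>\<bar>x\<bar> ^ l * sin t\<close> relative to
  \<open>\<bar>x\<bar> ^ l\<close>. At the origin one uses, with \<open>\<psi>\<close> the angle between position and tangent, the
  scale-invariant energy \<open>E = weight * cos \<psi>\<close>: it increases along solutions up to an error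
  quadratic in the distance to the origin, it is extremal (with opposite signs for outgoing and incoming
  rays) exactly on the cone, and it is positive only while the curve recedes. Hence every curve reaching
  the origin arrives along the cone. States and limits fit together to a solution on the whole line.\<close>

section \<open>Differential equations and derivatives on an interval\<close>

text \<open>The direction is carried as a lifted angle \<open>t\<close>, so unit speed is automatic.
  Existence is by compactness throughout; uniqueness is never invoked. Near the origin, with
  \<open>r = rad x y\<close>, the equation for \<open>H = 0\<close> is autonomous in the time
  \<open>ds / r\<close>. Its outgoing cone ray is an attracting rest point, spiralling when
  \<open>l + m \<le> 5\<close>, and the incoming one is repelling; hence no angle can be expected to
  behave monotonically, and the analysis rests on a Lyapunov function. Since
  \<open>r' = cosp\<close>, the energy has the sign of \<open>r'\<close> wherever it is nonzero. The
  curvature term is smaller than the singular terms by a factor \<open>r\<close>, which is why it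
  costs only a quadratic error. The growth of the energy degenerates where \<open>sinp\<close> or
  \<open>weight\<close> vanishes, that is for radial tangents off the cone and on the axes. Adding a
  multiple of \<open>offset * sinp\<close> removes this degeneracy, so a curve tending to the origin
  must come close to the cone at some times; the near-monotonicity of the energy then upgrades this
  to all late times.\<close>

lemma ode_limit:
  fixes u :: "real \<Rightarrow> 'a::euclidean_space"
  assumes int: "\<And>k t. t \<in> {a..b} \<Longrightarrow> (g k has_integral (uk k t - uk k a)) {a..t}"
    and bd: "\<And>k s. s \<in> {a..b} \<Longrightarrow> norm (g k s) \<le> B"
    and convg: "\<And>s. s \<in> {a..b} \<Longrightarrow> (\<lambda>k. g k s) \<longlonglongrightarrow> G s"
    and convu: "\<And>s. s \<in> {a..b} \<Longrightarrow> (\<lambda>k. uk k s) \<longlonglongrightarrow> u s"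
    and cont: "continuous_on {a..b} G"
    and s: "s \<in> {a..b}"
  shows "(u has_vector_derivative G s) (at s within {a..b})"
proof -
  \<comment> \<open>Dominated convergence passes the integral form of the equation to the limit, so
    pointwise convergence with a common bound is enough; differentiability of \<open>u\<close> is
    recovered from the continuity of \<open>G\<close>.\<close>
  have eq: "u t = u a + integral {a..t} G" if t: "t \<in> {a..b}" for t
  proof -
    have lim: "(\<lambda>k. uk k t - uk k a) \<longlonglongrightarrow> u t - u a"
      using t by (intro tendsto_diff convu) auto
    have "(G has_integral (u t - u a)) {a..t}"
      by (rule has_integral_dominated_convergence[where h="\<lambda>_. B", OF int[OF t] _ _ _ lim])
        (use t in \<open>auto intro!: bd convg\<close>)
    then show ?thesis by (simp add: integral_unique)
  qed
  have "((\<lambda>t. u a + integral {a..t} G) has_vector_derivative (0 + G s)) (at s within {a..b})"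
    by (rule has_vector_derivative_add[OF has_vector_derivative_const
        integral_has_vector_derivative[OF cont s]])
  then have "((\<lambda>t. u a + integral {a..t} G) has_vector_derivative G s) (at s within {a..b})"
    by simp
  from has_vector_derivative_transform[OF s eq this] show ?thesis .
qed

lemma integral_lipschitz:
  fixes g :: "real \<Rightarrow> 'a::euclidean_space"
  assumes "continuous_on {a..} g" "\<And>s. norm (g s) \<le> B" "a \<le> s" "s \<le> t"
  shows "norm (integral {a..t} g - integral {a..s} g) \<le> B * (t - s)"
proof -
  have "g integrable_on {a..t}"
    using assms by (intro integrable_continuous_real continuous_on_subset[OF assms(1)]) auto
  then have "integral {a..s} g + integral {s..t} g = integral {a..t} g"
    using assms by (intro Henstock_Kurzweil_Integration.integral_combine) auto
  then have "integral {a..t} g - integral {a..s} g = integral {s..t} g"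
    by (metis add_diff_cancel_left')
  then show ?thesis
    using assms integral_bound[of s t g B] continuous_on_subset[OF assms(1), of "{s..t}"]
    by auto
qed

lemma lipschitz_Arzela_Ascoli:
  fixes u :: "nat \<Rightarrow> real \<Rightarrow> 'a::euclidean_space"
  assumes ab: "a \<le> b" and B0: "0 \<le> B"
    and lip: "\<And>k s t. s \<in> {a..b} \<Longrightarrow> t \<in> {a..b} \<Longrightarrow> norm (u k t - u k s) \<le> B * \<bar>t - s\<bar>"
    and bd: "\<And>k. norm (u k a) \<le> M"
  obtains g r where "continuous_on {a..b} g" "strict_mono (r :: nat \<Rightarrow> nat)"
    "\<And>s. s \<in> {a..b} \<Longrightarrow> (\<lambda>n. u (r n) s) \<longlonglongrightarrow> g s"
proof -
  have bu: "norm (u k s) \<le> M + B * (b - a)" if "s \<in> {a..b}" for k s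
  proof -
    have "norm (u k s - u k a) \<le> B * \<bar>s - a\<bar>" using lip[of a s k] that ab by simp
    also have "\<dots> \<le> B * (b - a)" using that B0 by (intro mult_left_mono) auto
    finally show ?thesis using norm_triangle_ineq2[of "u k s" "u k a"] bd[of k] by linarith
  qed
  have equi: "\<exists>d>0. \<forall>n t. t \<in> {a..b} \<and> norm (s - t) < d \<longrightarrow> norm (u n s - u n t) < e"
    if "s \<in> {a..b}" "0 < e" for s e
  proof (intro exI conjI allI impI)
    \<comment> \<open>\<open>B + 1\<close> instead of \<open>B\<close>, since \<open>B = 0\<close>
      is allowed.\<close>
    show "0 < e / (B + 1)" using that B0 by simp
    fix n t assume t: "t \<in> {a..b} \<and> norm (s - t) < e / (B + 1)"
    have "norm (u n s - u n t) \<le> B * \<bar>s - t\<bar>" using lip t that by auto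
    also have "\<dots> \<le> (B + 1) * \<bar>s - t\<bar>" by (intro mult_right_mono) auto
    also have "\<dots> < e" using t B0 by (simp add: field_simps)
    finally show "norm (u n s - u n t) < e" .
  qed
  obtain g r where g: "continuous_on {a..b} g" "strict_mono (r :: nat \<Rightarrow> nat)"
    and unif: "\<And>e. 0 < e \<Longrightarrow> \<exists>N. \<forall>n x. n \<ge> N \<and> x \<in> {a..b} \<longrightarrow> norm (u (r n) x - g x) < e"
    by (rule Arzela_Ascoli[of "{a..b}" u "M + B * (b - a)", OF compact_Icc bu equi]) (assumption | rule that)+
  have "(\<lambda>n. u (r n) s) \<longlonglongrightarrow> g s" if "s \<in> {a..b}" for s
    unfolding LIMSEQ_iff using unif that by meson
  with g show thesis by (rule that)
qed

text \<open>Solutions of the delayed equation are obtained by stepping over intervals of the length of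
  the delay; letting the delay tend to zero gives a solution of the equation itself (Tonelli).\<close>

lemma Peano_bounded:
  fixes f :: "real \<Rightarrow> 'a::euclidean_space \<Rightarrow> 'a"
  assumes cont: "continuous_on UNIV (\<lambda>(s, u). f s u)"
    and bd: "\<And>s u. norm (f s u) \<le> B" and "a < b"
  shows "\<exists>u. u a = u0 \<and> (\<forall>s\<in>{a..b}. (u has_vector_derivative f s (u s)) (at s within {a..b}))"
proof -
  have B0: "0 \<le> B" using order_trans[OF norm_ge_zero bd] .
  \<comment> \<open>Iterates of the integral equation with delay \<open>h\<close>;
    \<open>max a\<close> replaces arguments before \<open>a\<close> by \<open>a\<close>, where every
    iterate has the value \<open>u0\<close>.\<close>
  define v where "v h = rec_nat (\<lambda>_. u0) (\<lambda>_ w s. u0 + integral {a..s} (\<lambda>t. f t (w (max a (t - h)))))"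
    for h :: real
  have v0: "v h 0 = (\<lambda>_. u0)" for h by (simp add: v_def)
  have vS: "v h (Suc j) = (\<lambda>s. u0 + integral {a..s} (\<lambda>t. f t (v h j (max a (t - h)))))" for h j
    by (simp add: v_def)
  have contf: "continuous_on S (\<lambda>t. f t (w t))" if "continuous_on S w" for S w
    using continuous_on_compose2[OF cont continuous_on_Pair[OF continuous_on_id that]] by simp
  have contv: "continuous_on {a..} (v h j)" for h j
  proof (induction j)
    case 0 then show ?case by (simp add: v0)
  next
    case (Suc j)
    have "continuous_on {a..} (\<lambda>t. v h j (max a (t - h)))"
      by (rule continuous_on_compose2[OF Suc]) (auto intro!: continuous_intros)
    then have c: "continuous_on {a..} (\<lambda>t. f t (v h j (max a (t - h))))"
      by (rule contf)
    have lip: "norm (v h (Suc j) t - v h (Suc j) s) \<le> B * (t - s)" if "a \<le> s" "s \<le> t" for s t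
      using integral_lipschitz[OF c bd that] by (simp add: vS)
    have "B-lipschitz_on {a..} (v h (Suc j))"
    proof (rule lipschitz_onI)
      fix s t assume "s \<in> {a..}" "t \<in> {a..}"
      then show "dist (v h (Suc j) s) (v h (Suc j) t) \<le> B * dist s t"
        using lip[of s t] lip[of t s] by (cases "s \<le> t") (auto simp: dist_norm norm_minus_commute)
    qed (rule B0)
    then show ?case by (rule lipschitz_on_continuous_on)
  qed
  have cdel: "continuous_on {a..} (\<lambda>t. f t (v h j (max a (t - h))))" for h j
    by (rule contf, rule continuous_on_compose2[OF contv]) (auto intro!: continuous_intros)
  \<comment> \<open>The value at \<open>s\<close> uses the previous iterate only up to
    \<open>s - h\<close>, so iterate \<open>j\<close> already solves the delayed equation on
    \<open>[a, a + j * h]\<close>.\<close>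
  have stab: "v h (Suc j) s = v h j s" if "h > 0" "a \<le> s" "s \<le> a + real j * h" for h j s
    using that
  proof (induction j arbitrary: s)
    case 0 then show ?case by (simp add: vS v0)
  next
    case (Suc j)
    have "integral {a..s} (\<lambda>t. f t (v h (Suc j) (max a (t - h)))) =
          integral {a..s} (\<lambda>t. f t (v h j (max a (t - h))))"
    proof (rule integral_cong)
      fix t assume t: "t \<in> {a..s}"
      have "v h (Suc j) (max a (t - h)) = v h j (max a (t - h))"
        using t Suc.prems by (intro Suc.IH) (auto simp: algebra_simps max_def)
      then show "f t (v h (Suc j) (max a (t - h))) = f t (v h j (max a (t - h)))" by simp
    qed
    then show ?case by (subst (1 2) vS) simp
  qed
  define h where "h k = inverse (real (Suc k))" for k
  have h: "h k > 0" for k by (simp add: h_def)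
  \<comment> \<open>\<open>J k\<close> steps of length \<open>h k\<close> cover
    \<open>[a, b]\<close>, so \<open>w k\<close> satisfies the delayed equation on all of
    it.\<close>
  have "\<exists>J. b - a \<le> real J * h k" for k
    using reals_Archimedean3[OF h[of k]] by (metis less_imp_le)
  then obtain J where J: "\<And>k. b - a \<le> real (J k) * h k" by metis
  define w where "w k = v (h k) (J k)" for k
  define g where "g k t = f t (w k (max a (t - h k)))" for k t
  have weq: "w k s = u0 + integral {a..s} (g k)" if "s \<in> {a..b}" for k s
  proof -
    have "w k s = v (h k) (Suc (J k)) s"
      unfolding w_def using that J[of k] h[of k] by (intro stab[symmetric]) auto
    also have "\<dots> = u0 + integral {a..s} (g k)" by (simp add: vS g_def[abs_def] w_def)
    finally show ?thesis .
  qed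
  have cg: "continuous_on {a..} (g k)" for k
    unfolding g_def w_def by (rule cdel)
  have lip: "norm (w k t - w k s) \<le> B * \<bar>t - s\<bar>" if "s \<in> {a..b}" "t \<in> {a..b}" for k s t
  proof -
    have "norm (w k t - w k s) \<le> B * (t - s)" if "s \<in> {a..b}" "t \<in> {a..b}" "s \<le> t" for s t
      using integral_lipschitz[OF cg, where B=B and s=s and t=t and k1=k] that bd by (simp add: weq g_def)
    from this[of s t] this[of t s] that show ?thesis
      by (cases "s \<le> t") (auto simp: norm_minus_commute)
  qed
  have wa: "w k a = u0" for k using weq[of a k] \<open>a < b\<close> by simp
  obtain u r where cu: "continuous_on {a..b} u" and r: "strict_mono (r :: nat \<Rightarrow> nat)"
    and conv: "\<And>s. s \<in> {a..b} \<Longrightarrow> (\<lambda>n. w (r n) s) \<longlonglongrightarrow> u s"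
    using lipschitz_Arzela_Ascoli[of a b B w "norm u0"] lip wa B0 \<open>a < b\<close> by (auto simp: less_imp_le)
  have hr: "(\<lambda>n. h (r n)) \<longlonglongrightarrow> 0"
    using LIMSEQ_subseq_LIMSEQ[OF LIMSEQ_inverse_real_of_nat r] by (simp add: h_def[abs_def] o_def)
  \<comment> \<open>All \<open>w k\<close> share the Lipschitz constant \<open>B\<close> on
    \<open>[a, b]\<close>, so removing the delay changes values by at most
    \<open>B * h (r n)\<close>.\<close>
  have convd: "(\<lambda>n. w (r n) (max a (s - h (r n)))) \<longlonglongrightarrow> u s" if s: "s \<in> {a..b}" for s
  proof -
    have "(\<lambda>n. w (r n) (max a (s - h (r n))) - w (r n) s) \<longlonglongrightarrow> 0"
    proof (rule Lim_null_comparison)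
      show "\<forall>\<^sub>F n in sequentially. norm (w (r n) (max a (s - h (r n))) - w (r n) s) \<le> B * h (r n)"
      proof (intro always_eventually allI)
        fix n
        have "norm (w (r n) (max a (s - h (r n))) - w (r n) s) \<le> B * \<bar>max a (s - h (r n)) - s\<bar>"
          using s h[of "r n"] by (intro lip) auto
        also have "\<dots> \<le> B * h (r n)" using s h[of "r n"] B0 by (intro mult_left_mono) auto
        finally show "norm (w (r n) (max a (s - h (r n))) - w (r n) s) \<le> B * h (r n)" .
      qed
      show "(\<lambda>n. B * h (r n)) \<longlonglongrightarrow> 0" using tendsto_mult_left[OF hr, of B] by simp
    qed
    from tendsto_add[OF this conv[OF s]] show ?thesis by simp
  qed
  have "(u has_vector_derivative f s (u s)) (at s within {a..b})" if s: "s \<in> {a..b}" for s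
  proof (rule ode_limit[where g="\<lambda>n. g (r n)" and uk="\<lambda>n. w (r n)" and G="\<lambda>s. f s (u s)" and B=B])
    fix k t assume t: "t \<in> {a..b}"
    have "g (r k) integrable_on {a..t}"
      by (intro integrable_continuous_real continuous_on_subset[OF cg]) auto
    then show "(g (r k) has_integral w (r k) t - w (r k) a) {a..t}"
      using t \<open>a < b\<close> by (simp add: weq wa integrable_integral)
  next
    fix t assume t: "t \<in> {a..b}"
    have "isCont (\<lambda>(s, u). f s u) (t, u t)"
      using cont by (simp add: continuous_on_eq_continuous_at)
    from isCont_tendsto_compose[OF this tendsto_Pair[OF tendsto_const convd[OF t]]]
    show "(\<lambda>k. g (r k) t) \<longlonglongrightarrow> f t (u t)" by (simp add: g_def)
    show "norm (g (r k) t) \<le> B" for k by (simp add: g_def bd)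
  qed (use s conv contf[OF cu] in auto)
  moreover have "u a = u0"
    using conv[of a] \<open>a < b\<close> by (auto simp: wa LIMSEQ_const_iff)
  ultimately show ?thesis by blast
qed

text \<open>Fundamental theorem of calculus with finitely many exceptional points. It carries
  monotonicity across the zeros of \<open>x * y\<close>, where no equation for the angle is
  assumed.\<close>

lemma mono_except_finite:
  fixes f :: "real \<Rightarrow> real"
  assumes "finite F" "a \<le> b" "continuous_on {a..b} f"
    and der: "\<And>s. a < s \<Longrightarrow> s < b \<Longrightarrow> s \<notin> F \<Longrightarrow> \<exists>d\<ge>0. (f has_real_derivative d) (at s)"
  shows "f a \<le> f b"
proof -
  from der obtain d where d: "\<And>s. a < s \<Longrightarrow> s < b \<Longrightarrow> s \<notin> F \<Longrightarrow> d s \<ge> 0 \<and> (f has_real_derivative d s) (at s)"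
    by metis
  define d' where "d' s = (if a < s \<and> s < b \<and> s \<notin> F then d s else 0)" for s
  have "(d' has_integral (f b - f a)) {a..b}"
    by (rule fundamental_theorem_of_calculus_interior_strong[OF assms(1,2) _ assms(3)])
      (use d in \<open>auto simp: d'_def has_real_derivative_iff_has_vector_derivative\<close>)
  then have "0 \<le> f b - f a"
    by (rule has_integral_nonneg) (use d in \<open>auto simp: d'_def\<close>)
  then show ?thesis by simp
qed

text \<open>Continuity argument at the first point where \<open>g\<close> is no longer positive:
  \<open>g\<close> is nonnegative up to there, and \<open>step\<close> makes it positive there. It
  serves for estimates that hold only as long as a regularized equation is known to be the true
  one.\<close>

lemma bootstrap_pos:
  fixes g :: "real \<Rightarrow> real"
  assumes "continuous_on {a..b} g" "g a > 0"
    and step: "\<And>t. a \<le> t \<Longrightarrow> t \<le> b \<Longrightarrow> (\<And>s. a \<le> s \<Longrightarrow> s \<le> t \<Longrightarrow> g s \<ge> 0) \<Longrightarrow> g t > 0"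
    and t: "a \<le> t" "t \<le> b"
  shows "g t > 0"
proof (rule ccontr)
  assume "\<not> g t > 0"
  define S where "S = {s \<in> {a..t}. g s \<in> {..0}}"
  have "continuous_on {a..t} g" using assms by (auto intro: continuous_on_subset)
  then have "closed ({a..t} \<inter> g -` {..0})"
    by (intro continuous_closed_preimage) auto
  also have "{a..t} \<inter> g -` {..0} = S" by (auto simp: S_def)
  finally have "closed S" .
  have "t \<in> S" using \<open>\<not> g t > 0\<close> t by (auto simp: S_def)
  have bS: "bdd_below S" by (auto simp: S_def intro: bdd_belowI[of _ a])
  define s0 where "s0 = Inf S"
  have s0: "s0 \<in> S" unfolding s0_def using \<open>closed S\<close> \<open>t \<in> S\<close> bS
    by (intro closed_contains_Inf) auto
  have pos: "g s > 0" if "a \<le> s" "s < s0" for s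
  proof (rule ccontr)
    assume "\<not> g s > 0"
    then have "s \<in> S" using that s0 by (auto simp: S_def)
    then have "s0 \<le> s" unfolding s0_def using bS by (rule cInf_lower)
    with that show False by simp
  qed
  have as0: "a < s0" using s0 \<open>g a > 0\<close> by (cases "s0 = a") (auto simp: S_def)
  have "g s0 \<ge> 0"
  proof (rule tendsto_lowerbound)
    have "continuous_on {a..s0} g" using assms(1) s0 t by (auto simp: S_def intro: continuous_on_subset)
    then show "(g \<longlongrightarrow> g s0) (at_left s0)"
      using as0 by (simp add: continuous_on_Icc_at_leftD)
    show "\<forall>\<^sub>F s in at_left s0. 0 \<le> g s"
      unfolding eventually_at_left_field using as0 pos by (intro exI[of _ a]) (auto intro: less_imp_le)
  qed simp
  then have "g s0 > 0" using s0 t pos by (intro step) (auto simp: S_def le_less)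
  with s0 show False by (auto simp: S_def)
qed

section \<open>Limits and one-sided derivatives at a right endpoint\<close>

lemma tendsto_at_left_of_bounded_derivative:
  fixes f :: "real \<Rightarrow> real"
  assumes "c < T" and der: "\<And>s. c < s \<Longrightarrow> s < T \<Longrightarrow> \<exists>d. (f has_real_derivative d) (at s) \<and> \<bar>d\<bar> \<le> L"
  shows "\<exists>l. (f \<longlongrightarrow> l) (at_left T)"
proof -
  obtain d where d: "\<And>s. c < s \<Longrightarrow> s < T \<Longrightarrow> (f has_real_derivative d s) (at s) \<and> \<bar>d s\<bar> \<le> L"
    using der by metis
  have "L \<ge> 0" using d[of "(c + T)/2"] \<open>c < T\<close> by auto
  have "L-lipschitz_on {c<..<T} f"
  proof (rule lipschitz_onI)
    fix s t assume "s \<in> {c<..<T}" "t \<in> {c<..<T}"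
    then show "dist (f s) (f t) \<le> L * dist s t"
      using field_differentiable_bound[of "{c<..<T}" f d L t s] d
      by (auto simp: dist_norm abs_minus_commute intro: has_field_derivative_at_within)
  qed fact
  then have "uniformly_continuous_on {c<..<T} f" by (rule lipschitz_on_uniformly_continuous)
  then obtain l where "(f \<longlongrightarrow> l) (at T within {c<..<T})"
    using uniformly_continuous_on_extension_at_closure[of "{c<..<T}" f T] \<open>c < T\<close> by auto
  moreover have "at T within {c<..<T} = at_left T"
    using \<open>c < T\<close> by (intro at_within_nhd[where S="{c<..}"]) auto
  ultimately show ?thesis by metis
qed

text \<open>L'Hospital's rule: the limit of the derivatives is the one-sided derivative at
  \<open>T\<close>. This extends the equations to an added end point.\<close>

lemma has_real_derivative_left_endpoint:
  fixes f :: "real \<Rightarrow> real"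
  assumes "c < T" and lim: "(f \<longlongrightarrow> f T) (at_left T)"
    and der: "\<And>s. c < s \<Longrightarrow> s < T \<Longrightarrow> (f has_real_derivative g s) (at s)"
    and limg: "(g \<longlongrightarrow> G) (at_left T)" and "a < T"
  shows "(f has_real_derivative G) (at T within {a..T})"
proof -
  have ev: "\<forall>\<^sub>F s in at_left T. c < s \<and> s < T"
    unfolding eventually_at_left_field using \<open>c < T\<close> by blast
  have "((\<lambda>s. (f s - f T) / (s - T)) \<longlongrightarrow> G) (at_left T)"
  proof (rule lhopital_left[where f'=g and g'="\<lambda>_. 1"])
    show "((\<lambda>s. f s - f T) \<longlongrightarrow> 0) (at_left T)" using tendsto_diff[OF lim tendsto_const[of "f T"]] by simp
    show "((\<lambda>s. s - T) \<longlongrightarrow> 0) (at_left T)" by (auto intro!: tendsto_eq_intros)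
    show "\<forall>\<^sub>F s in at_left T. s - T \<noteq> 0" using ev by eventually_elim auto
    show "\<forall>\<^sub>F s in at_left T. ((\<lambda>s. f s - f T) has_real_derivative g s) (at s)"
      using ev by eventually_elim (auto intro!: derivative_eq_intros der)
    show "\<forall>\<^sub>F s in at_left T. ((\<lambda>s. s - T) has_real_derivative 1) (at s)"
      by (intro always_eventually allI) (auto intro!: derivative_eq_intros)
  qed (use limg in auto)
  then show ?thesis
    using \<open>a < T\<close> by (simp add: has_field_derivative_iff at_within_Icc_at_left)
qed

section \<open>Radius, angle and energy along a solution\<close>

text \<open>\<open>cosp\<close> and \<open>sinp\<close> are the cosine and sine of the angle from the position vector to the tangent;
  \<open>share\<close> is the squared cosine of the polar angle, and \<open>cshare\<close> its value on the cone over
  \<open>S\<^sup>l \<times> S\<^sup>m\<close> that solves the equation for \<open>H = 0\<close>.\<close>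

definition rad :: "real \<Rightarrow> real \<Rightarrow> real" where
  "rad x y = sqrt (x\<^sup>2 + y\<^sup>2)"

definition cosp :: "real \<Rightarrow> real \<Rightarrow> real \<Rightarrow> real" where
  "cosp x y t = (x * cos t + y * sin t) / rad x y"

definition sinp :: "real \<Rightarrow> real \<Rightarrow> real \<Rightarrow> real" where
  "sinp x y t = (x * sin t - y * cos t) / rad x y"

text \<open>Up to a constant factor, the volume of the orbit \<open>S^l x S^m\<close> through the
  point, after scaling to distance 1 from the origin; homogeneous of degree 0.\<close>

definition weight :: "nat \<Rightarrow> nat \<Rightarrow> real \<Rightarrow> real \<Rightarrow> real" where
  "weight l m x y = \<bar>x\<bar> ^ l * \<bar>y\<bar> ^ m / rad x y ^ (l + m)"

definition share :: "real \<Rightarrow> real \<Rightarrow> real" where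
  "share x y = x\<^sup>2 / (x\<^sup>2 + y\<^sup>2)"

definition cshare :: "nat \<Rightarrow> nat \<Rightarrow> real" where
  "cshare l m = real l / real (l + m)"

text \<open>The factor \<open>x * y\<close> cancels the poles of
  \<open>m * x / y - l * y / x\<close>, the logarithmic derivative of \<open>weight\<close> in the
  polar angle; the product of the two is \<open>l + m\<close> times the square of
  \<open>share - cshare\<close>.\<close>

definition offset :: "nat \<Rightarrow> nat \<Rightarrow> real \<Rightarrow> real \<Rightarrow> real" where
  "offset l m x y = x * y / (x\<^sup>2 + y\<^sup>2) * (share x y - cshare l m)"

text \<open>With \<open>x' = cos t\<close> and \<open>y' = sin t\<close> the bracket
  \<open>x'' y' - x' y''\<close> is \<open>- t'\<close>; this is the equation solved for
  \<open>t'\<close>.\<close>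

definition turning :: "nat \<Rightarrow> nat \<Rightarrow> real \<Rightarrow> real \<Rightarrow> real \<Rightarrow> real \<Rightarrow> real" where
  "turning l m h x y t = real m * cos t / y - real l * sin t / x - real (l + m + 1) * h"

lemma rad_sq: "rad x y ^ 2 = x\<^sup>2 + y\<^sup>2"
  by (simp add: rad_def)

lemma rad_pos_iff: "rad x y > 0 \<longleftrightarrow> x \<noteq> 0 \<or> y \<noteq> 0"
  by (simp add: rad_def sum_power2_gt_zero_iff)

lemma rad_nonneg [simp]: "rad x y \<ge> 0"
  by (simp add: rad_def)

lemma rad_eq_0_iff: "rad x y = 0 \<longleftrightarrow> x = 0 \<and> y = 0"
  by (simp add: rad_def)

lemma abs_le_rad: "\<bar>x\<bar> \<le> rad x y" "\<bar>y\<bar> \<le> rad x y"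
  by (auto simp: rad_def intro: real_le_rsqrt)

lemma polar_back:
  assumes "x \<noteq> 0 \<or> y \<noteq> 0"
  shows "rad x y * cos t = x * cosp x y t - y * sinp x y t"
    and "rad x y * sin t = y * cosp x y t + x * sinp x y t"
    and "(cosp x y t)\<^sup>2 + (sinp x y t)\<^sup>2 = 1"
    and "x * cos t + y * sin t = rad x y * cosp x y t"
    and "x * sin t - y * cos t = rad x y * sinp x y t"
proof -
  have r: "rad x y > 0" using assms by (simp add: rad_pos_iff)
  have rr: "rad x y * rad x y = x * x + y * y" using rad_sq[of x y] by (simp add: power2_eq_square)
  show 4: "x * cos t + y * sin t = rad x y * cosp x y t"
    and 5: "x * sin t - y * cos t = rad x y * sinp x y t"
    using r by (simp_all add: cosp_def sinp_def)
  have "rad x y * (rad x y * cos t) = rad x y * (x * cosp x y t - y * sinp x y t)"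
    using rr 4 5 by algebra
  then show "rad x y * cos t = x * cosp x y t - y * sinp x y t"
    using r by simp
  have "rad x y * (rad x y * sin t) = rad x y * (y * cosp x y t + x * sinp x y t)"
    using rr 4 5 by algebra
  then show "rad x y * sin t = y * cosp x y t + x * sinp x y t"
    using r by simp
  have "(x * cos t + y * sin t)\<^sup>2 + (x * sin t - y * cos t)\<^sup>2 = (x\<^sup>2 + y\<^sup>2) * ((sin t)\<^sup>2 + (cos t)\<^sup>2)"
    by algebra
  then show "(cosp x y t)\<^sup>2 + (sinp x y t)\<^sup>2 = 1"
    using assms by (auto simp: cosp_def sinp_def power_divide rad_sq add_divide_distrib[symmetric])
qed

lemma abs_cosp_le_1: "\<bar>cosp x y t\<bar> \<le> 1" and abs_sinp_le_1: "\<bar>sinp x y t\<bar> \<le> 1"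
proof -
  have "(cosp x y t)\<^sup>2 \<le> 1 \<and> (sinp x y t)\<^sup>2 \<le> 1"
  proof (cases "x \<noteq> 0 \<or> y \<noteq> 0")
    case True
    from polar_back(3)[OF True, of t] show ?thesis
      using zero_le_power2[of "cosp x y t"] zero_le_power2[of "sinp x y t"] by linarith
  qed (simp add: cosp_def sinp_def)
  then show "\<bar>cosp x y t\<bar> \<le> 1" "\<bar>sinp x y t\<bar> \<le> 1" by (auto simp: abs_square_le_1)
qed

lemma weight_nonneg: "weight l m x y \<ge> 0"
  by (simp add: weight_def)

lemma share_bounds: "0 \<le> share x y" "share x y \<le> 1"
proof -
  show "0 \<le> share x y" by (simp add: share_def)
  have "x\<^sup>2 / (x\<^sup>2 + y\<^sup>2) \<le> 1"
    by (cases "x\<^sup>2 + y\<^sup>2 = 0") (simp_all add: divide_le_eq_1 sum_power2_gt_zero_iff)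
  then show "share x y \<le> 1" by (simp add: share_def)
qed

text \<open>Squaring removes the absolute values and leaves a polynomial in the single variable
  \<open>share\<close> on \<open>[0, 1]\<close>, in which the weight can be compared with its
  maximum.\<close>

lemma weight_sq:
  assumes "x \<noteq> 0 \<or> y \<noteq> 0"
  shows "(weight l m x y)\<^sup>2 = share x y ^ l * (1 - share x y) ^ m"
proof -
  have r: "x\<^sup>2 + y\<^sup>2 > 0" using assms by (simp add: sum_power2_gt_zero_iff)
  have s: "1 - share x y = y\<^sup>2 / (x\<^sup>2 + y\<^sup>2)" using r assms by (simp add: share_def field_simps)
  have "(rad x y ^ (l + m))\<^sup>2 = (x\<^sup>2 + y\<^sup>2) ^ l * (x\<^sup>2 + y\<^sup>2) ^ m"
    by (metis power_add power_commutes power_mult rad_sq mult.commute)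
  moreover have "(\<bar>x\<bar> ^ l)\<^sup>2 = (x\<^sup>2) ^ l" "(\<bar>y\<bar> ^ m)\<^sup>2 = (y\<^sup>2) ^ m"
    by (metis power_mult mult.commute power2_abs)+
  ultimately show ?thesis
    unfolding s by (simp add: weight_def share_def power_divide power_mult_distrib)
qed

text \<open>Turns a lower bound on the weight into a distance from both axes: each factor on the
  right is at most 1, so each is at least the weight.\<close>

lemma weight_le_abs:
  assumes "l \<ge> 1" "m \<ge> 1" "x \<noteq> 0 \<or> y \<noteq> 0"
  shows "weight l m x y \<le> \<bar>x\<bar> / rad x y * (\<bar>y\<bar> / rad x y)"
proof -
  have r: "rad x y > 0" using assms by (simp add: rad_pos_iff)
  have "weight l m x y = (\<bar>x\<bar> / rad x y) ^ l * (\<bar>y\<bar> / rad x y) ^ m"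
    by (simp add: weight_def power_divide power_add)
  also have "\<dots> \<le> (\<bar>x\<bar> / rad x y) ^ 1 * (\<bar>y\<bar> / rad x y) ^ 1"
    using assms r abs_le_rad(1)[of x y] abs_le_rad(2)[of y x]
    by (intro mult_mono power_decreasing) auto
  finally show ?thesis by simp
qed

lemma weight_le_1: "weight l m x y \<le> 1"
proof (cases "x \<noteq> 0 \<or> y \<noteq> 0")
  case True
  have "(weight l m x y)\<^sup>2 \<le> 1"
    unfolding weight_sq[OF True] using share_bounds[of x y] by (intro mult_le_one power_le_one) auto
  then show ?thesis using abs_square_le_1[of "weight l m x y"] by auto
qed (auto simp: weight_def rad_def power_0_left)

lemma abs_offset_le_1: "\<bar>offset l m x y\<bar> \<le> 1"
proof -
  have "\<bar>x * y / (x\<^sup>2 + y\<^sup>2)\<bar> \<le> 1"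
  proof (cases "x \<noteq> 0 \<or> y \<noteq> 0")
    case True
    then have "x\<^sup>2 + y\<^sup>2 > 0" by (simp add: sum_power2_gt_zero_iff)
    moreover have "\<bar>x * y\<bar> \<le> x\<^sup>2 + y\<^sup>2"
    proof -
      have "0 \<le> \<bar>x\<bar> * \<bar>y\<bar>" by simp
      then show ?thesis using sum_squares_bound[of "\<bar>x\<bar>" "\<bar>y\<bar>"]
        unfolding abs_mult power2_abs by linarith
    qed
    ultimately show ?thesis by (simp add: abs_mult)
  qed simp
  moreover have "\<bar>share x y - cshare l m\<bar> \<le> 1"
  proof -
    have "0 \<le> cshare l m \<and> cshare l m \<le> 1" by (auto simp: cshare_def divide_le_eq_1)
    then show ?thesis using share_bounds[of x y] by linarith
  qed
  ultimately show ?thesis unfolding offset_def abs_mult by (intro mult_le_one) auto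
qed

lemma offset_sq:
  assumes "x \<noteq> 0 \<or> y \<noteq> 0"
  shows "(offset l m x y)\<^sup>2 = share x y * (1 - share x y) * (share x y - cshare l m)\<^sup>2"
proof -
  have r: "x\<^sup>2 + y\<^sup>2 > 0" using assms by (simp add: sum_power2_gt_zero_iff)
  have s: "1 - share x y = y\<^sup>2 / (x\<^sup>2 + y\<^sup>2)" using r assms by (simp add: share_def field_simps)
  have "(x * y / (x\<^sup>2 + y\<^sup>2))\<^sup>2 = share x y * (1 - share x y)"
    unfolding s by (simp add: share_def power_divide power_mult_distrib power2_eq_square)
  then show ?thesis unfolding offset_def power_mult_distrib by simp
qed

section \<open>Derivatives along a unit-speed curve\<close>

lemma abs_power_has_derivative:
  fixes x :: "real \<Rightarrow> real"
  assumes "(x has_real_derivative d) (at s within A)" "x s \<noteq> 0"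
  shows "((\<lambda>s. \<bar>x s\<bar> ^ l) has_real_derivative \<bar>x s\<bar> ^ l * (real l * d / x s)) (at s within A)"
proof -
  have "((\<lambda>s. sqrt ((x s)\<^sup>2)) has_real_derivative inverse (sqrt ((x s)\<^sup>2)) / 2 * (2 * x s * d)) (at s within A)"
    using assms by (intro DERIV_chain2[OF DERIV_real_sqrt]) (auto intro!: derivative_eq_intros)
  moreover have "inverse (sqrt ((x s)\<^sup>2)) / 2 * (2 * x s * d) = \<bar>x s\<bar> * d / x s"
    using assms(2) by (cases "x s > 0") (simp_all add: field_simps)
  ultimately have "((\<lambda>s. sqrt ((x s)\<^sup>2)) has_real_derivative (\<bar>x s\<bar> * d / x s)) (at s within A)" by simp
  then have 1: "((\<lambda>s. \<bar>x s\<bar>) has_real_derivative (\<bar>x s\<bar> * d / x s)) (at s within A)" by simp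
  have "\<bar>x s\<bar> ^ l * (real l * d / x s) = real l * (\<bar>x s\<bar> * d / x s) * \<bar>x s\<bar> ^ (l - Suc 0)"
    by (cases l) simp_all
  then show ?thesis using 1
    by (auto intro!: derivative_eq_intros)
qed

context
  fixes x y t :: "real \<Rightarrow> real" and s k :: real and A :: "real set"
  assumes dx: "(x has_real_derivative cos (t s)) (at s within A)"
    and dy: "(y has_real_derivative sin (t s)) (at s within A)"
begin

lemma rad_has_derivative:
  assumes "x s \<noteq> 0 \<or> y s \<noteq> 0"
  shows "((\<lambda>s. rad (x s) (y s)) has_real_derivative cosp (x s) (y s) (t s)) (at s within A)"
proof -
  have R: "(x s)\<^sup>2 + (y s)\<^sup>2 > 0" using assms by (simp add: sum_power2_gt_zero_iff)
  define q where "q = sqrt ((x s)\<^sup>2 + (y s)\<^sup>2)"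
  have q: "q > 0" using R by (simp add: q_def)
  have "((\<lambda>s. sqrt ((x s)\<^sup>2 + (y s)\<^sup>2)) has_real_derivative
      inverse q / 2 * (2 * x s * cos (t s) + 2 * y s * sin (t s))) (at s within A)"
    unfolding q_def
    by (intro DERIV_chain2[OF DERIV_real_sqrt] R) (auto intro!: derivative_eq_intros dx dy)
  moreover have "inverse q / 2 * (2 * x s * cos (t s) + 2 * y s * sin (t s)) = (x s * cos (t s) + y s * sin (t s)) / q"
    using q by (simp add: field_simps)
  ultimately show ?thesis unfolding rad_def cosp_def q_def by metis
qed

text \<open>By homogeneity of degree 0 only the polar angle matters: it moves at speed
  \<open>sinp / rad\<close>, and the bracket is the logarithmic derivative of
  \<open>|cos|^l * |sin|^m\<close> in that angle.\<close>

lemma weight_has_derivative: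
  assumes "x s \<noteq> 0" "y s \<noteq> 0"
  shows "((\<lambda>s. weight l m (x s) (y s)) has_real_derivative
    weight l m (x s) (y s) * sinp (x s) (y s) (t s) * (real m * x s / y s - real l * y s / x s)
      / rad (x s) (y s)) (at s within A)"
proof -
  let ?r = "rad (x s) (y s)"
  let ?C = "cosp (x s) (y s) (t s)" and ?S = "sinp (x s) (y s) (t s)"
  let ?A = "\<bar>x s\<bar> ^ l" and ?B = "\<bar>y s\<bar> ^ m"
  have r: "?r > 0" using assms by (simp add: rad_pos_iff)
  have c: "cos (t s) = (x s * ?C - y s * ?S) / ?r" and si: "sin (t s) = (y s * ?C + x s * ?S) / ?r"
    using polar_back(1,2)[of "x s" "y s" "t s"] assms r by (auto simp: field_simps)
  have "((\<lambda>s. rad (x s) (y s) ^ (l + m)) has_real_derivative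
      ?r ^ (l + m) * (real (l + m) * ?C / ?r)) (at s within A)"
    using abs_power_has_derivative[OF rad_has_derivative, of "l + m"] assms r by simp
  from DERIV_divide[OF DERIV_mult[OF abs_power_has_derivative[OF dx, of l]
    abs_power_has_derivative[OF dy, of m]] this]
  have "((\<lambda>s. weight l m (x s) (y s)) has_real_derivative
    ((?A * (real l * cos (t s) / x s) * ?B + ?B * (real m * sin (t s) / y s) * ?A) * ?r ^ (l + m) -
        ?A * ?B * (?r ^ (l + m) * (real (l + m) * ?C / ?r))) / (?r ^ (l + m) * ?r ^ (l + m))) (at s within A)"
    using assms r by (simp add: weight_def)
  moreover have "((?A * (real l * cos (t s) / x s) * ?B + ?B * (real m * sin (t s) / y s) * ?A) * ?r ^ (l + m) -
        ?A * ?B * (?r ^ (l + m) * (real (l + m) * ?C / ?r))) / (?r ^ (l + m) * ?r ^ (l + m))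
      = ?A * ?B / ?r ^ (l + m) * (real l * cos (t s) / x s + real m * sin (t s) / y s - real (l + m) * ?C / ?r)"
    using r by (simp add: field_simps)
  moreover have "real l * cos (t s) / x s + real m * sin (t s) / y s - real (l + m) * ?C / ?r
      = ?S * (real m * x s / y s - real l * y s / x s) / ?r"
    unfolding c si using assms r by (simp add: field_simps)
  ultimately show ?thesis unfolding weight_def by (metis (no_types, lifting) mult.assoc times_divide_eq_right)
qed

text \<open>The quadratic in \<open>share\<close> is arranged as a convex combination of
  \<open>cshare\<close> and \<open>1 - cshare\<close>, which for \<open>l, m \<ge> 1\<close> has a
  positive lower bound, minus a term that vanishes on the axes. There the corrector has to replace
  the vanishing weight.\<close>

lemma offset_has_derivative:
  assumes "x s \<noteq> 0 \<or> y s \<noteq> 0"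
  shows "((\<lambda>s. offset l m (x s) (y s)) has_real_derivative
    sinp (x s) (y s) (t s) / rad (x s) (y s) *
      (cshare l m * (1 - share (x s) (y s)) + (1 - cshare l m) * share (x s) (y s)
       - 4 * share (x s) (y s) * (1 - share (x s) (y s)))) (at s within A)"
proof -
  let ?r = "rad (x s) (y s)" and ?X = "x s" and ?Y = "y s"
  let ?C = "cosp (x s) (y s) (t s)" and ?S = "sinp (x s) (y s) (t s)"
  define R where "R = ?X\<^sup>2 + ?Y\<^sup>2"
  have R: "R > 0" unfolding R_def using assms by (simp add: sum_power2_gt_zero_iff)
  have r: "?r > 0" using assms by (simp add: rad_pos_iff)
  have rR: "?r * ?r = R" using rad_sq[of ?X ?Y] by (simp add: R_def power2_eq_square)
  have S: "?S / ?r = (?X * sin (t s) - ?Y * cos (t s)) / R"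
    using r by (simp add: sinp_def rR[symmetric])
  have "((\<lambda>s. offset l m (x s) (y s)) has_real_derivative
     ((cos (t s) * ?Y + ?X * sin (t s)) * R - ?X * ?Y * (2 * ?X * cos (t s) + 2 * ?Y * sin (t s))) / (R * R)
        * (?X\<^sup>2 / R - cshare l m) +
     ?X * ?Y / R * ((2 * ?X * cos (t s) * R - ?X\<^sup>2 * (2 * ?X * cos (t s) + 2 * ?Y * sin (t s))) / (R * R))) (at s within A)"
  proof -
    have dR: "((\<lambda>s. (x s)\<^sup>2 + (y s)\<^sup>2) has_real_derivative 2 * ?X * cos (t s) + 2 * ?Y * sin (t s)) (at s within A)"
      by (auto intro!: derivative_eq_intros dx dy)
    have d1: "((\<lambda>s. x s * y s) has_real_derivative cos (t s) * ?Y + ?X * sin (t s)) (at s within A)"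
      by (auto intro!: derivative_eq_intros dx dy)
    have d2: "((\<lambda>s. (x s)\<^sup>2) has_real_derivative 2 * ?X * cos (t s)) (at s within A)"
      by (auto intro!: derivative_eq_intros dx)
    have R0: "?X\<^sup>2 + ?Y\<^sup>2 \<noteq> 0" using assms by simp
    show ?thesis
      using DERIV_mult[OF DERIV_divide[OF d1 dR R0] DERIV_diff[OF DERIV_divide[OF d2 dR R0] DERIV_const[of "cshare l m"]]]
      unfolding offset_def share_def R_def by (simp add: algebra_simps)
  qed
  moreover have "((cos (t s) * ?Y + ?X * sin (t s)) * R - ?X * ?Y * (2 * ?X * cos (t s) + 2 * ?Y * sin (t s))) / (R * R)
        * (?X\<^sup>2 / R - cshare l m) +
     ?X * ?Y / R * ((2 * ?X * cos (t s) * R - ?X\<^sup>2 * (2 * ?X * cos (t s) + 2 * ?Y * sin (t s))) / (R * R))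
    = ?S / ?r * (cshare l m * (1 - share ?X ?Y) + (1 - cshare l m) * share ?X ?Y
       - 4 * share ?X ?Y * (1 - share ?X ?Y))"
  proof -
    have sh: "share ?X ?Y = ?X\<^sup>2 / R" by (simp add: share_def R_def)
    have e1: "(cos (t s) * ?Y + ?X * sin (t s)) * R - ?X * ?Y * (2 * ?X * cos (t s) + 2 * ?Y * sin (t s))
       = (?X * sin (t s) - ?Y * cos (t s)) * (?X\<^sup>2 - ?Y\<^sup>2)"
      unfolding R_def by algebra
    have e2: "2 * ?X * cos (t s) * R - ?X\<^sup>2 * (2 * ?X * cos (t s) + 2 * ?Y * sin (t s))
       = - 2 * ?X * ?Y * (?X * sin (t s) - ?Y * cos (t s))"
      unfolding R_def by algebra
    have Y2: "?Y\<^sup>2 = R - ?X\<^sup>2" by (simp add: R_def)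
    define w where "w = ?X * sin (t s) - ?Y * cos (t s)"
    define X2 where "X2 = ?X\<^sup>2"
    define ca where "ca = cshare l m"
    have "?X * ?Y / R * (- 2 * ?X * ?Y * w / (R * R)) = - 2 * (X2 * (R - X2)) * w / (R * R * R)"
      unfolding Y2[symmetric] X2_def by (simp add: power2_eq_square mult_ac)
    moreover have "w * (X2 - (R - X2)) / (R * R) * (X2 / R - ca) + (- 2 * (X2 * (R - X2)) * w / (R * R * R))
      = w / R * (ca * (1 - X2 / R) + (1 - ca) * (X2 / R) - 4 * (X2 / R) * (1 - X2 / R))"
      using R by (simp add: field_simps)
    ultimately show ?thesis
      unfolding e1 e2 unfolding S sh Y2 w_def[symmetric] X2_def[symmetric] ca_def[symmetric] by simp
  qed
  ultimately show ?thesis by simp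
qed

context
  assumes dt: "(t has_real_derivative k) (at s within A)"
begin

text \<open>The angle between position and tangent changes at rate \<open>k - sinp / rad\<close>,
  the rotation of the tangent minus that of the position; the same rate governs
  \<open>sinp\<close>.\<close>

lemma cosp_has_derivative:
  assumes "x s \<noteq> 0 \<or> y s \<noteq> 0"
  shows "((\<lambda>s. cosp (x s) (y s) (t s)) has_real_derivative
    sinp (x s) (y s) (t s) * (sinp (x s) (y s) (t s) / rad (x s) (y s) - k)) (at s within A)"
proof -
  let ?r = "rad (x s) (y s)" and ?X = "x s" and ?Y = "y s"
  let ?C = "cosp (x s) (y s) (t s)" and ?S = "sinp (x s) (y s) (t s)"
  have r: "?r > 0" using assms by (simp add: rad_pos_iff)
  have "((\<lambda>s. x s * cos (t s) + y s * sin (t s)) has_real_derivative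
     ((cos (t s))\<^sup>2 + (sin (t s))\<^sup>2 - (x s * sin (t s) - y s * cos (t s)) * k)) (at s within A)"
    by (auto intro!: derivative_eq_intros dx dy dt simp: algebra_simps power2_eq_square)
  then have "((\<lambda>s. x s * cos (t s) + y s * sin (t s)) has_real_derivative (1 - ?r * ?S * k)) (at s within A)"
    using polar_back(5)[OF assms, of "t s"] by simp
  from DERIV_divide[OF this rad_has_derivative[OF assms]] r
  have "((\<lambda>s. cosp (x s) (y s) (t s)) has_real_derivative
     ((1 - ?r * ?S * k) * ?r - (?X * cos (t s) + ?Y * sin (t s)) * ?C) / (?r * ?r)) (at s within A)"
    using assms by (simp add: cosp_def)
  moreover have "((1 - ?r * ?S * k) * ?r - (?X * cos (t s) + ?Y * sin (t s)) * ?C) / (?r * ?r) = ?S * (?S / ?r - k)"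
  proof -
    have "1 - ?C\<^sup>2 = ?S\<^sup>2" using polar_back(3)[OF assms, of "t s"] by simp
    then have "1 - ?C * ?C = ?S * ?S" by (simp add: power2_eq_square)
    then show ?thesis unfolding polar_back(4)[OF assms] using r by (simp add: field_simps) algebra
  qed
  ultimately show ?thesis by simp
qed

lemma sinp_has_derivative:
  assumes "x s \<noteq> 0 \<or> y s \<noteq> 0"
  shows "((\<lambda>s. sinp (x s) (y s) (t s)) has_real_derivative
    cosp (x s) (y s) (t s) * (k - sinp (x s) (y s) (t s) / rad (x s) (y s))) (at s within A)"
proof -
  let ?r = "rad (x s) (y s)" and ?X = "x s" and ?Y = "y s"
  let ?C = "cosp (x s) (y s) (t s)" and ?S = "sinp (x s) (y s) (t s)"
  have r: "?r > 0" using assms by (simp add: rad_pos_iff)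
  have "((\<lambda>s. x s * sin (t s) - y s * cos (t s)) has_real_derivative
     ((x s * cos (t s) + y s * sin (t s)) * k)) (at s within A)"
    by (auto intro!: derivative_eq_intros dx dy dt simp: algebra_simps power2_eq_square)
  then have "((\<lambda>s. x s * sin (t s) - y s * cos (t s)) has_real_derivative (?r * ?C * k)) (at s within A)"
    using polar_back(4)[OF assms, of "t s"] by simp
  from DERIV_divide[OF this rad_has_derivative[OF assms]] r
  have "((\<lambda>s. sinp (x s) (y s) (t s)) has_real_derivative
     ((?r * ?C * k) * ?r - (?X * sin (t s) - ?Y * cos (t s)) * ?C) / (?r * ?r)) (at s within A)"
    using assms by (simp add: sinp_def)
  moreover have "((?r * ?C * k) * ?r - (?X * sin (t s) - ?Y * cos (t s)) * ?C) / (?r * ?r) = ?C * (k - ?S / ?r)"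
    unfolding polar_back(5)[OF assms] using r by (simp add: field_simps)
  ultimately show ?thesis by simp
qed

end

end

section \<open>Energy and corrector along a solution\<close>

lemma turning_polar:
  assumes "x \<noteq> 0" "y \<noteq> 0"
  shows "turning l m h x y t = ((real m * x / y - real l * y / x) * cosp x y t - real (l + m) * sinp x y t) / rad x y
     - real (l + m + 1) * h"
proof -
  have r: "rad x y > 0" using assms by (simp add: rad_pos_iff)
  have c: "cos t = (x * cosp x y t - y * sinp x y t) / rad x y"
    and si: "sin t = (y * cosp x y t + x * sinp x y t) / rad x y"
    using polar_back(1,2)[of x y t] assms r by (auto simp: field_simps)
  show ?thesis unfolding turning_def
    by (subst c, subst si) (use assms r in \<open>simp add: field_simps\<close>)
qed

text \<open>Through the turning, \<open>cosp\<close> loses \<open>om * C * S / r\<close>, and this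
  is relatively what the weight gains; the cancellation dictates the choice of the weight. What
  remains is a multiple of \<open>S^2 / r\<close> and a curvature term.\<close>

lemma energy_has_derivative:
  assumes dx: "(x has_real_derivative cos (t s)) (at s within A)"
    and dy: "(y has_real_derivative sin (t s)) (at s within A)"
    and dt: "(t has_real_derivative turning l m h (x s) (y s) (t s)) (at s within A)"
    and nz: "x s \<noteq> 0" "y s \<noteq> 0"
  shows "((\<lambda>s. weight l m (x s) (y s) * cosp (x s) (y s) (t s)) has_real_derivative
    real (l + m + 1) * weight l m (x s) (y s) *
     ((sinp (x s) (y s) (t s))\<^sup>2 / rad (x s) (y s) + h * sinp (x s) (y s) (t s))) (at s within A)"
proof -
  let ?r = "rad (x s) (y s)"
  have r: "?r > 0" using nz by (simp add: rad_pos_iff)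
  define om where "om = real m * x s / y s - real l * y s / x s"
  define C where "C = cosp (x s) (y s) (t s)"
  define S where "S = sinp (x s) (y s) (t s)"
  define w where "w = weight l m (x s) (y s)"
  have k: "turning l m h (x s) (y s) (t s) = (om * C - real (l + m) * S) / ?r - real (l + m + 1) * h"
    using turning_polar[OF nz] by (simp add: om_def C_def S_def)
  have "((\<lambda>s. weight l m (x s) (y s) * cosp (x s) (y s) (t s)) has_real_derivative
     (w * S * om / ?r) * C + (S * (S / ?r - turning l m h (x s) (y s) (t s))) * w) (at s within A)"
    using DERIV_mult[OF weight_has_derivative[where x=x and y=y and t=t and s=s, OF dx dy nz, of l m]
      cosp_has_derivative[where x=x and y=y and t=t and s=s, OF dx dy dt disjI1[OF nz(1)]]]
    by (simp add: om_def C_def S_def w_def)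
  moreover have "(w * S * om / ?r) * C + (S * (S / ?r - turning l m h (x s) (y s) (t s))) * w
     = real (l + m + 1) * w * (S\<^sup>2 / ?r + h * S)"
    unfolding k using r by (simp add: field_simps power2_eq_square)
  ultimately show ?thesis by (simp add: C_def S_def w_def)
qed

text \<open>Complements the energy rate where that degenerates: for \<open>S = 0\<close> the square
  of \<open>a - c\<close> survives, and near the axes the coefficient of \<open>S^2\<close> is
  positive.\<close>

lemma corrector_has_derivative:
  assumes dx: "(x has_real_derivative cos (t s)) (at s within A)"
    and dy: "(y has_real_derivative sin (t s)) (at s within A)"
    and dt: "(t has_real_derivative turning l m h (x s) (y s) (t s)) (at s within A)"
    and nz: "x s \<noteq> 0" "y s \<noteq> 0" and lm: "l + m > 0"
    and a: "a = share (x s) (y s)" and C: "C = cosp (x s) (y s) (t s)"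
    and S: "S = sinp (x s) (y s) (t s)" and K: "K = offset l m (x s) (y s)" and c: "c = cshare l m"
  shows "((\<lambda>s. offset l m (x s) (y s) * sinp (x s) (y s) (t s)) has_real_derivative
    (S\<^sup>2 * (c * (1 - a) + (1 - c) * a - 4 * a * (1 - a)) + real (l + m) * (a - c)\<^sup>2 * C\<^sup>2
      - real (l + m + 1) * K * S * C) / rad (x s) (y s) - real (l + m + 1) * K * C * h) (at s within A)"
proof -
  let ?r = "rad (x s) (y s)" and ?R = "(x s)\<^sup>2 + (y s)\<^sup>2"
  have r: "?r > 0" using nz by (simp add: rad_pos_iff)
  have R: "?R > 0" using nz by (simp add: sum_power2_gt_zero_iff)
  define om where "om = real m * x s / y s - real l * y s / x s"
  have k: "turning l m h (x s) (y s) (t s) = (om * C - real (l + m) * S) / ?r - real (l + m + 1) * h"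
    using turning_polar[OF nz] by (simp add: om_def C S)
  \<comment> \<open>\<open>share - cshare\<close> vanishes exactly where \<open>om\<close> does, so
    \<open>K * om\<close> becomes a square without poles.\<close>
  have "x s * y s * om = real m * (x s)\<^sup>2 - real l * (y s)\<^sup>2"
    unfolding om_def using nz by (simp add: field_simps power2_eq_square)
  then have "x s * y s / ?R * om = (real m * (x s)\<^sup>2 - real l * (y s)\<^sup>2) / ?R" by simp
  also have "\<dots> = real (l + m) * (a - c)"
  proof -
    have "real (l + m) * c = real l" using lm by (simp add: c cshare_def)
    then have "real (l + m) * (a - c) = real (l + m) * a - real l" by (simp add: right_diff_distrib)
    also have "\<dots> = (real m * (x s)\<^sup>2 - real l * (y s)\<^sup>2) / ?R"
      unfolding a share_def using R nz by (simp add: field_simps)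
    finally show ?thesis by simp
  qed
  finally have "x s * y s / ?R * om * (a - c) = real (l + m) * (a - c)\<^sup>2"
    by (simp add: power2_eq_square)
  moreover have "x s * y s / ?R * om * (a - c) = K * om"
    unfolding K offset_def a c by simp
  ultimately have Kom: "K * om = real (l + m) * (a - c)\<^sup>2" by simp
  have "((\<lambda>s. offset l m (x s) (y s) * sinp (x s) (y s) (t s)) has_real_derivative
     S / ?r * (c * (1 - a) + (1 - c) * a - 4 * a * (1 - a)) * S
       + (C * (turning l m h (x s) (y s) (t s) - S / ?r)) * K) (at s within A)"
    using DERIV_mult[OF offset_has_derivative[where x=x and y=y and t=t and s=s, OF dx dy disjI1[OF nz(1)], of l m]
      sinp_has_derivative[where x=x and y=y and t=t and s=s, OF dx dy dt disjI1[OF nz(1)]]]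
    unfolding a[symmetric] C[symmetric] S[symmetric] c[symmetric] K[symmetric] .
  moreover have "S / ?r * (c * (1 - a) + (1 - c) * a - 4 * a * (1 - a)) * S
       + (C * (turning l m h (x s) (y s) (t s) - S / ?r)) * K
     = (S\<^sup>2 * (c * (1 - a) + (1 - c) * a - 4 * a * (1 - a)) + K * om * C\<^sup>2
      - real (l + m + 1) * K * S * C) / ?r - real (l + m + 1) * K * C * h"
    unfolding k using r by (simp add: field_simps power2_eq_square)
  ultimately show ?thesis by (simp add: Kom)
qed

lemma cshare_bounds:
  assumes "l \<ge> 1" "m \<ge> 1"
  shows "0 < cshare l m" "cshare l m < 1" "real (l + m) * cshare l m = real l"
    "real (l + m) * (1 - cshare l m) = real m"
  using assms by (auto simp: cshare_def field_simps)

lemma abs_le_of_sq_le: "x\<^sup>2 \<le> y\<^sup>2 \<Longrightarrow> 0 \<le> y \<Longrightarrow> \<bar>x\<bar> \<le> y" for x y :: real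
  by (metis abs_le_square_iff abs_of_nonneg)

text \<open>Stated for free numbers, tied by the algebraic relations that \<open>weight_sq\<close>,
  \<open>offset_sq\<close> and \<open>polar_back\<close> supply. Only half of the energy rate is
  spent, since the other half has to absorb the curvature term.\<close>

lemma coercive:
  assumes lm: "l \<ge> 1" "m \<ge> 1"
  obtains mu c where "mu > 0" "c > 0"
    "\<And>a w S C K. \<lbrakk>0 \<le> a; a \<le> 1; 0 \<le> w; w\<^sup>2 = a ^ l * (1 - a) ^ m; S\<^sup>2 + C\<^sup>2 = 1;
        K\<^sup>2 = a * (1 - a) * (a - cshare l m)\<^sup>2\<rbrakk> \<Longrightarrow>
      c * (S\<^sup>2 + (a - cshare l m)\<^sup>2 * C\<^sup>2) \<le> real (l + m + 1) / 2 * w * S\<^sup>2 +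
        mu * (S\<^sup>2 * (cshare l m * (1 - a) + (1 - cshare l m) * a - 4 * a * (1 - a))
          + real (l + m) * (a - cshare l m)\<^sup>2 * C\<^sup>2 - real (l + m + 1) * K * S * C)"
proof -
  define c0 where "c0 = cshare l m"
  define n where "n = real (l + m)"
  define N where "N = real (l + m + 1)"
  \<comment> \<open>\<open>M\<close> collects the negative part of the coefficient of
    \<open>S^2\<close>: 4 from the derivative of \<open>offset\<close>, \<open>N^2 / (2 * n)\<close>
    from splitting the mixed term.\<close>
  define M where "M = 4 + N\<^sup>2 / (2 * n)"
  define be where "be = min c0 (1 - c0)"
  \<comment> \<open>Lower bound for the weight where \<open>u = a * (1 - a)\<close> exceeds
    \<open>be / (2 * M)\<close>; \<open>mu\<close> is then fixed by
    \<open>mu * M = N / 2 * e\<close>.\<close>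
  define e where "e = (be / (2 * M)) ^ (l + m)"
  define mu where "mu = N * e / (2 * M)"
  define c where "c = min (mu * be / 2) (mu * n / 2)"
  have n: "n > 0" using lm by (simp add: n_def)
  have N: "N > 0" by (simp add: N_def)
  have M: "M > 0" unfolding M_def using n by (simp add: add_pos_nonneg)
  have be: "be > 0" using cshare_bounds[OF lm] by (simp add: be_def c0_def)
  have e: "e > 0" using be M by (simp add: e_def)
  have mu: "mu > 0" using N e M by (simp add: mu_def)
  have c: "c > 0" using mu be n by (simp add: c_def)
  have main: "c * (S\<^sup>2 + (a - c0)\<^sup>2 * C\<^sup>2) \<le> N / 2 * w * S\<^sup>2 +
        mu * (S\<^sup>2 * (c0 * (1 - a) + (1 - c0) * a - 4 * a * (1 - a)) + n * (a - c0)\<^sup>2 * C\<^sup>2 - N * K * S * C)"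
    if a: "0 \<le> a" "a \<le> 1" and w: "0 \<le> w" "w\<^sup>2 = a ^ l * (1 - a) ^ m"
      and K: "K\<^sup>2 = a * (1 - a) * (a - c0)\<^sup>2" for a w S C K
  proof -
    define u where "u = a * (1 - a)"
    define d where "d = a - c0"
    have u: "0 \<le> u" "u \<le> 1" using a by (auto simp: u_def intro: mult_le_one)
    have cross: "N * K * S * C \<le> n / 2 * d\<^sup>2 * C\<^sup>2 + N\<^sup>2 / (2 * n) * u * S\<^sup>2" (is "_ \<le> ?A + ?B")
    proof (rule power2_le_imp_le)
      have "(N * K * S * C)\<^sup>2 = N\<^sup>2 * (u * d\<^sup>2) * S\<^sup>2 * C\<^sup>2"
        using K by (simp add: power_mult_distrib u_def d_def)
      also have "\<dots> = 4 * ?A * ?B" using n by (simp add: field_simps)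
      also have "\<dots> \<le> (?A + ?B)\<^sup>2"
      proof -
        have "4 * p * q \<le> (p + q)\<^sup>2" for p q :: real
          using zero_le_power2[of "p - q"] by (simp add: power2_eq_square algebra_simps)
        then show ?thesis .
      qed
      finally show "(N * K * S * C)\<^sup>2 \<le> (?A + ?B)\<^sup>2" .
      show "0 \<le> ?A + ?B" using n u by simp
    qed
    have conv: "be \<le> c0 * (1 - a) + (1 - c0) * a"
    proof -
      have "be * (1 - a) + be * a \<le> c0 * (1 - a) + (1 - c0) * a"
        using a by (intro add_mono mult_right_mono) (auto simp: be_def)
      then show ?thesis by (simp add: algebra_simps)
    qed
    \<comment> \<open>Near the axes \<open>be\<close> beats \<open>M * u\<close>; elsewhere the
      weight is at least \<open>e\<close> and compensates \<open>mu * M * u\<close>.\<close>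
    have key: "mu * be / 2 \<le> N / 2 * w + mu * (be - M * u)"
    proof (cases "u \<le> be / (2 * M)")
      case True
      then have "M * u \<le> be / 2" using M by (simp add: field_simps)
      then have "mu * (be / 2) \<le> mu * (be - M * u)" using mu by (intro mult_left_mono) auto
      moreover have "0 \<le> N / 2 * w" using N w by simp
      ultimately show ?thesis by simp
    next
      case False
      have "e \<le> u ^ (l + m)" unfolding e_def using False be M by (intro power_mono) auto
      also have "\<dots> = a ^ (l + m) * (1 - a) ^ (l + m)" by (simp add: u_def power_mult_distrib)
      also have "\<dots> \<le> a ^ l * (1 - a) ^ m" using a by (intro mult_mono power_decreasing) auto
      also have "\<dots> = w\<^sup>2" using w by simp
      also have "\<dots> \<le> w"
      proof -
        have "w\<^sup>2 \<le> 1" unfolding w(2) using a by (intro mult_le_one power_le_one) auto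
        then have "w \<le> 1" using abs_square_le_1[of w] by auto
        then show ?thesis using w mult_left_le[of w w] by (simp add: power2_eq_square)
      qed
      finally have "N / 2 * e \<le> N / 2 * w" using N by (intro mult_left_mono) auto
      moreover have "mu * M * u \<le> mu * M * 1" using mu M u by (intro mult_left_mono) auto
      moreover have "mu * M = N / 2 * e" using M by (simp add: mu_def)
      moreover have "mu * be > 0" using mu be by simp
      ultimately show ?thesis by (simp add: algebra_simps)
    qed
    have "c * (S\<^sup>2 + d\<^sup>2 * C\<^sup>2) = c * S\<^sup>2 + c * (d\<^sup>2 * C\<^sup>2)" by (simp add: algebra_simps)
    also have "\<dots> \<le> (mu * be / 2) * S\<^sup>2 + (mu * n / 2) * (d\<^sup>2 * C\<^sup>2)"
      by (intro add_mono mult_right_mono) (auto simp: c_def)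
    also have "\<dots> \<le> (N / 2 * w + mu * (be - M * u)) * S\<^sup>2 + (mu * n / 2) * (d\<^sup>2 * C\<^sup>2)"
      using key by (intro add_mono mult_right_mono) auto
    also have "\<dots> = N / 2 * w * S\<^sup>2 + mu * (S\<^sup>2 * (be - 4 * u) + n * d\<^sup>2 * C\<^sup>2 -
        (n / 2 * d\<^sup>2 * C\<^sup>2 + N\<^sup>2 / (2 * n) * u * S\<^sup>2))"
      unfolding M_def by (simp add: algebra_simps)
    also have "\<dots> \<le> N / 2 * w * S\<^sup>2 + mu * (S\<^sup>2 * (c0 * (1 - a) + (1 - c0) * a - 4 * u) + n * d\<^sup>2 * C\<^sup>2 -
        N * K * S * C)"
      using mu cross conv by (intro add_left_mono mult_left_mono diff_mono add_right_mono) auto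
    finally show ?thesis by (simp add: d_def u_def mult.assoc)
  qed
  show thesis
    using that[of mu c] mu c main unfolding c0_def n_def N_def by blast
qed

section \<open>Distance to the cone measured by the energy\<close>

definition wmax :: "nat \<Rightarrow> nat \<Rightarrow> real" where
  "wmax l m = sqrt (cshare l m ^ l * (1 - cshare l m) ^ m)"

lemma wmax_pos: "l \<ge> 1 \<Longrightarrow> m \<ge> 1 \<Longrightarrow> wmax l m > 0"
  using cshare_bounds[of l m] by (simp add: wmax_def)

text \<open>The right side minus the left has derivative \<open>(v - 1) * (1 / v - 1 / Z^2)\<close>,
  whose second factor is nonnegative because \<open>v \<le> Z \<le> Z^2\<close>; so the difference
  is least at \<open>v = 1\<close>, where it vanishes.\<close>

lemma ln_quadratic_upper:
  fixes z Z :: real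
  assumes "0 < z" "z \<le> Z" "1 \<le> Z"
  shows "ln z \<le> (z - 1) - (z - 1)\<^sup>2 / (2 * Z\<^sup>2)"
proof -
  define f where "f v = (v - 1) - (v - 1)\<^sup>2 / (2 * Z\<^sup>2) - ln v" for v
  have df: "(f has_real_derivative (v - 1) * (1 / v - 1 / Z\<^sup>2)) (at v)" if "v > 0" for v
  proof -
    have "(f has_real_derivative 1 - 2 * (v - 1) / (2 * Z\<^sup>2) - 1 / v) (at v)"
      unfolding f_def[abs_def] using that assms(3)
      by (auto intro!: derivative_eq_intros simp: field_simps)
    moreover have "1 - 2 * (v - 1) / (2 * Z\<^sup>2) - 1 / v = (v - 1) * (1 / v - 1 / Z\<^sup>2)"
      using that assms(3) by (simp add: field_simps)
    ultimately show ?thesis by simp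
  qed
  have pos: "1 / v - 1 / Z\<^sup>2 \<ge> 0" if "0 < v" "v \<le> Z" for v
  proof -
    have "Z * 1 \<le> Z * Z" using assms(3) by (intro mult_left_mono) auto
    then have "v \<le> Z\<^sup>2" using that unfolding power2_eq_square by linarith
    then show ?thesis using that frac_le[of 1 1 v "Z\<^sup>2"] by simp
  qed
  have "f 1 \<le> f z"
  proof (cases "1 \<le> z")
    case True
    show ?thesis
    proof (rule DERIV_nonneg_imp_nondecreasing[OF True])
      fix v assume v: "1 \<le> v" "v \<le> z"
      have "0 \<le> (v - 1) * (1 / v - 1 / Z\<^sup>2)"
        using v assms pos[of v] by (intro mult_nonneg_nonneg) auto
      then show "\<exists>d. (f has_real_derivative d) (at v) \<and> 0 \<le> d"
        using df[of v] v by auto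
    qed
  next
    case False
    then show ?thesis
    proof (intro DERIV_nonpos_imp_nonincreasing[of z 1 f])
      fix v assume v: "z \<le> v" "v \<le> 1"
      have "(v - 1) * (1 / v - 1 / Z\<^sup>2) \<le> 0"
        using v assms pos[of v] by (intro mult_nonpos_nonneg) auto
      then show "\<exists>d. (f has_real_derivative d) (at v) \<and> d \<le> 0"
        using df[of v] v assms by auto
    qed simp
  qed
  then show ?thesis by (simp add: f_def)
qed

text \<open>In the logarithm of the squared ratio the linear terms cancel, as \<open>cshare\<close>
  is the critical point of \<open>a^l * (1 - a)^m\<close>; the quadratic gain in one of the two
  logarithms is enough.\<close>

lemma weight_gap:
  assumes lm: "l \<ge> 1" "m \<ge> 1" and nz: "x \<noteq> 0 \<or> y \<noteq> 0"
  shows "weight l m x y \<le> wmax l m * (1 - (share x y - cshare l m)\<^sup>2 / 8)"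
proof -
  define a c where "a = share x y" and "c = cshare l m"
  define n where "n = real (l + m)"
  have c: "0 < c" "c < 1" "n * c = l" "n * (1 - c) = m"
    using cshare_bounds[OF lm] by (auto simp: c_def n_def)
  have n: "n > 0" using lm by (simp add: n_def)
  have a: "0 \<le> a" "a \<le> 1" using share_bounds by (auto simp: a_def)
  have W: "(weight l m x y)\<^sup>2 = a ^ l * (1 - a) ^ m" using weight_sq[OF nz] by (simp add: a_def)
  have W2: "(wmax l m)\<^sup>2 = c ^ l * (1 - c) ^ m" using c by (simp add: wmax_def c_def)
  have wp: "wmax l m > 0" using wmax_pos lm by auto
  define d where "d = (a - c)\<^sup>2"
  have "\<bar>a - c\<bar> \<le> 1" using a c by linarith
  then have d: "0 \<le> d" "d \<le> 1" by (auto simp: d_def abs_square_le_1)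
  show ?thesis
  proof (cases "a = 0 \<or> a = 1")
    case True
    then have "weight l m x y = 0" using W lm by (auto simp: power_0_left)
    moreover have "0 \<le> wmax l m * (1 - d / 8)" using wp d by (intro mult_nonneg_nonneg) auto
    ultimately show ?thesis by (simp add: d_def a_def c_def)
  next
    case False
    then have a': "0 < a" "a < 1" using a by auto
    have l1: "l * ln (a / c) \<le> l * ((a / c - 1) - d / 2)"
    proof (intro mult_left_mono)
      \<comment> \<open>\<open>Z = 1 / c\<close> bounds \<open>a / c\<close> since
        \<open>a \<le> 1\<close>.\<close>
      have "(a / c - 1)\<^sup>2 / (2 * (1 / c)\<^sup>2) = d / 2"
        using c by (simp add: d_def field_simps power2_eq_square)
      then show "ln (a / c) \<le> (a / c - 1) - d / 2"
        using ln_quadratic_upper[of "a / c" "1 / c"] a' c by (simp add: divide_right_mono)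
    qed simp
    have l2: "m * ln ((1 - a) / (1 - c)) \<le> m * ((1 - a) / (1 - c) - 1)"
      using a' c ln_le_minus_one[of "(1 - a) / (1 - c)"] by (intro mult_left_mono) auto
    have z: "l * (a / c - 1) + m * ((1 - a) / (1 - c) - 1) = 0"
    proof -
      have "l * (a / c - 1) = n * (a - c)" using c(1) by (simp flip: c(3)) (simp add: field_simps)
      moreover have "m * ((1 - a) / (1 - c) - 1) = n * (c - a)"
        using c(2) by (simp flip: c(4)) (simp add: field_simps)
      ultimately show ?thesis by (simp add: algebra_simps)
    qed
    have "l * (d / 2) \<ge> d / 2" using lm d mult_right_mono[of 1 "real l" "d / 2"] by simp
    then have ln: "l * ln (a / c) + m * ln ((1 - a) / (1 - c)) \<le> - (d / 2)"
      using l1 l2 z by (simp add: right_diff_distrib)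
    have "(weight l m x y)\<^sup>2 / (wmax l m)\<^sup>2 = (a / c) ^ l * ((1 - a) / (1 - c)) ^ m"
      unfolding W W2 by (simp add: power_divide)
    also have "\<dots> = exp (l * ln (a / c) + m * ln ((1 - a) / (1 - c)))"
      using a' c by (simp add: exp_add exp_of_nat_mult)
    also have "\<dots> \<le> exp (- (d / 2))" using ln by simp
    \<comment> \<open>The constant 8 leaves room for a polynomial comparison on
      \<open>0 \<le> d \<le> 1\<close>, after \<open>1 + d / 2 \<le> exp (d / 2)\<close>.\<close>
    also have "\<dots> \<le> (1 - d / 8)\<^sup>2"
    proof -
      have "1 + d / 2 \<le> exp (d / 2)" by (rule exp_ge_add_one_self)
      moreover have "1 \<le> (1 - d / 8)\<^sup>2 * (1 + d / 2)"
      proof -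
        have "(1 - d / 8)\<^sup>2 * (1 + d / 2) - 1 = d * (16 - 7 * d) / 64 + d ^ 3 / 128"
          by (simp add: power2_eq_square power3_eq_cube field_simps)
        moreover have "0 \<le> d * (16 - 7 * d) / 64" using d by simp
        moreover have "0 \<le> d ^ 3 / 128" using d by simp
        ultimately show ?thesis by linarith
      qed
      ultimately have "1 \<le> (1 - d / 8)\<^sup>2 * exp (d / 2)"
        by (meson mult_left_mono order_trans zero_le_power2)
      then show ?thesis by (simp add: exp_minus field_simps)
    qed
    finally have "(weight l m x y)\<^sup>2 \<le> (wmax l m * (1 - d / 8))\<^sup>2"
      using wp by (simp add: pos_divide_le_eq power_mult_distrib mult.commute)
    then have "weight l m x y \<le> wmax l m * (1 - d / 8)"
      by (rule power2_le_imp_le) (use wp d in auto)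
    then show ?thesis by (simp add: d_def a_def c_def)
  qed
qed

lemma weight_le_wmax:
  assumes lm: "l \<ge> 1" "m \<ge> 1" and nz: "x \<noteq> 0 \<or> y \<noteq> 0"
  shows "weight l m x y \<le> wmax l m"
proof -
  have "wmax l m * (1 - (share x y - cshare l m)\<^sup>2 / 8) \<le> wmax l m * 1"
    using wmax_pos[OF lm] by (intro mult_left_mono) auto
  then show ?thesis using weight_gap[OF assms] by linarith
qed

text \<open>Both factors of the energy are bounded, by \<open>wmax\<close> and 1, so each must
  itself reach the fraction \<open>1 - \<eta>^2\<close> of its bound, and a quadratic loss bounds
  the deviations linearly. The constants 3 and 2 round up \<open>sqrt 8\<close> and
  \<open>sqrt 2\<close>.\<close>

lemma near_cone:
  assumes lm: "l \<ge> 1" "m \<ge> 1" and nz: "x \<noteq> 0 \<or> y \<noteq> 0"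
    and E: "wmax l m * (1 - \<eta>\<^sup>2) \<le> weight l m x y * \<bar>cosp x y t\<bar>" and \<eta>: "0 \<le> \<eta>" "\<eta>\<^sup>2 \<le> 1/2"
  shows "\<bar>share x y - cshare l m\<bar> \<le> 3 * \<eta>" "\<bar>sinp x y t\<bar> \<le> 2 * \<eta>" "1/2 \<le> \<bar>cosp x y t\<bar>"
    "wmax l m / 2 \<le> weight l m x y"
proof -
  define w C d where "w = weight l m x y" and "C = \<bar>cosp x y t\<bar>" and "d = share x y - cshare l m"
  have wp: "wmax l m > 0" using wmax_pos lm by auto
  have C: "0 \<le> C" "C \<le> 1" using abs_cosp_le_1 by (auto simp: C_def)
  have w: "0 \<le> w" "w \<le> wmax l m * (1 - d\<^sup>2 / 8)" "w \<le> wmax l m"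
    using weight_nonneg weight_gap[OF lm nz] weight_le_wmax[OF lm nz] by (auto simp: w_def d_def)
  have E': "wmax l m * (1 - \<eta>\<^sup>2) \<le> w * C" using E by (simp add: w_def C_def)
  have wC: "w * C \<le> w" "w * C \<le> wmax l m * C" using w C by (auto intro: mult_left_le mult_right_mono)
  have "wmax l m * (1 - \<eta>\<^sup>2) \<le> wmax l m * (1 - d\<^sup>2 / 8)" using E' wC w by linarith
  then have "d\<^sup>2 \<le> 8 * \<eta>\<^sup>2" using wp by simp
  also have "\<dots> \<le> (3 * \<eta>)\<^sup>2" by (simp add: power_mult_distrib)
  finally show "\<bar>d\<bar> \<le> 3 * \<eta>" using \<eta> by (intro abs_le_of_sq_le) auto
  have "wmax l m * (1 - \<eta>\<^sup>2) \<le> wmax l m * C" using E' wC by linarith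
  then have C1: "1 - \<eta>\<^sup>2 \<le> C" using wp by simp
  then show "1/2 \<le> C" using \<eta> by linarith
  have "(1 - \<eta>\<^sup>2)\<^sup>2 \<le> C\<^sup>2" using C1 \<eta> by (intro power_mono) auto
  moreover have "1 - 2 * \<eta>\<^sup>2 \<le> (1 - \<eta>\<^sup>2)\<^sup>2"
    using zero_le_power2[of "\<eta>\<^sup>2"] by (simp add: power2_diff)
  moreover have "(sinp x y t)\<^sup>2 = 1 - C\<^sup>2" using polar_back(3)[OF nz, of t] by (simp add: C_def)
  ultimately have "(sinp x y t)\<^sup>2 \<le> 2 * \<eta>\<^sup>2" by linarith
  also have "\<dots> \<le> (2 * \<eta>)\<^sup>2" by (simp add: power_mult_distrib)
  finally show "\<bar>sinp x y t\<bar> \<le> 2 * \<eta>" using \<eta> by (intro abs_le_of_sq_le) auto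
  have "wmax l m * (1/2) \<le> wmax l m * (1 - \<eta>\<^sup>2)" using wp \<eta> by (intro mult_left_mono) auto
  then show "wmax l m / 2 \<le> w" using E' wC by linarith
qed

text \<open>The 6 comes from \<open>3 * \<eta>\<close> divided by the lower bound
  \<open>wmax / 2\<close> for \<open>|x * y| / r^2\<close>, the 2 from the bound for
  \<open>sinp\<close>.\<close>

definition coneK :: "nat \<Rightarrow> nat \<Rightarrow> real" where
  "coneK l m = real (l + m) * (6 / wmax l m + 2)"

lemma coneK_nonneg: "l \<ge> 1 \<Longrightarrow> m \<ge> 1 \<Longrightarrow> 0 \<le> coneK l m"
  using wmax_pos[of l m] by (simp add: coneK_def)

text \<open>Both terms of order \<open>1 / rad\<close> vanish for a radial tangent on the cone. When
  \<open>\<eta>\<close> is at most a multiple of the radius, the bound stays finite down to the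
  origin.\<close>

lemma turning_near_cone:
  assumes lm: "l \<ge> 1" "m \<ge> 1" and nz: "x \<noteq> 0" "y \<noteq> 0"
    and E: "wmax l m * (1 - \<eta>\<^sup>2) \<le> weight l m x y * \<bar>cosp x y t\<bar>" and \<eta>: "0 \<le> \<eta>" "\<eta>\<^sup>2 \<le> 1/2"
  shows "\<bar>turning l m h x y t\<bar> \<le> coneK l m * \<eta> / rad x y + real (l + m + 1) * \<bar>h\<bar>"
proof -
  have wp: "wmax l m > 0" using wmax_pos lm by auto
  have r: "rad x y > 0" using nz by (simp add: rad_pos_iff)
  have R: "x\<^sup>2 + y\<^sup>2 > 0" using nz by (simp add: sum_power2_gt_zero_iff)
  note nc = near_cone[OF lm disjI1[OF nz(1)] E \<eta>]
  define om where "om = real m * x / y - real l * y / x"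
  define n where "n = real (l + m)"
  define q where "q = x * y / (x\<^sup>2 + y\<^sup>2)"
  define d where "d = share x y - cshare l m"
  have "x * y * om = real m * x\<^sup>2 - real l * y\<^sup>2"
    unfolding om_def using nz by (simp add: field_simps power2_eq_square)
  then have "q * om = (real m * x\<^sup>2 - real l * y\<^sup>2) / (x\<^sup>2 + y\<^sup>2)" by (simp add: q_def)
  also have "\<dots> = n * share x y - real l"
    unfolding n_def share_def using R nz by (simp add: field_simps)
  also have "\<dots> = n * d" using cshare_bounds(3)[OF lm] by (simp add: n_def d_def right_diff_distrib)
  finally have qo: "\<bar>q\<bar> * \<bar>om\<bar> = n * \<bar>d\<bar>" by (metis abs_mult abs_of_nat n_def)
  have "wmax l m / 2 \<le> \<bar>x\<bar> / rad x y * (\<bar>y\<bar> / rad x y)"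
    using nc(4) weight_le_abs[OF lm disjI1[OF nz(1)], of y] by linarith
  also have "\<dots> = \<bar>q\<bar>" using rad_sq[of x y] by (simp add: q_def abs_mult power2_eq_square)
  finally have "wmax l m / 2 * \<bar>om\<bar> \<le> n * \<bar>d\<bar>"
    using qo mult_right_mono[of "wmax l m / 2" "\<bar>q\<bar>" "\<bar>om\<bar>"] by simp
  also have "\<dots> \<le> n * (3 * \<eta>)" using nc(1) by (intro mult_left_mono) (auto simp: d_def n_def)
  finally have om: "\<bar>om\<bar> \<le> n * (6 / wmax l m) * \<eta>" using wp by (simp add: field_simps)
  have "\<bar>om * cosp x y t - n * sinp x y t\<bar> \<le> \<bar>om\<bar> * \<bar>cosp x y t\<bar> + n * \<bar>sinp x y t\<bar>"
    using abs_triangle_ineq4[of "om * cosp x y t" "n * sinp x y t"] by (simp add: abs_mult n_def)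
  also have "\<dots> \<le> \<bar>om\<bar> * 1 + n * (2 * \<eta>)"
    using abs_cosp_le_1[of x y t] nc(2) by (intro add_mono mult_left_mono) (auto simp: n_def)
  also have "\<dots> \<le> coneK l m * \<eta>" using om unfolding coneK_def n_def[symmetric] by (simp add: algebra_simps)
  finally have "\<bar>(om * cosp x y t - n * sinp x y t) / rad x y\<bar> \<le> coneK l m * \<eta> / rad x y"
    using r by (simp add: divide_right_mono)
  moreover have "turning l m h x y t = (om * cosp x y t - n * sinp x y t) / rad x y - real (l + m + 1) * h"
    using turning_polar[OF nz] by (simp add: om_def n_def)
  ultimately show ?thesis
    using abs_triangle_ineq4[of "(om * cosp x y t - n * sinp x y t) / rad x y" "real (l + m + 1) * h"]
    by (simp add: abs_mult)
qed

text \<open>For a radial tangent \<open>(cos t)^2\<close> equals \<open>share\<close>. The estimate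
  identifies the limit direction of a curve that arrives along the cone.\<close>

lemma cos_sq_near_share:
  assumes "x \<noteq> 0 \<or> y \<noteq> 0"
  shows "\<bar>(cos t)\<^sup>2 - share x y\<bar> \<le> 4 * \<bar>sinp x y t\<bar>"
proof -
  have r: "rad x y > 0" using assms by (simp add: rad_pos_iff)
  define u v where "u = x / rad x y" and "v = y / rad x y"
  define C S where "C = cosp x y t" and "S = sinp x y t"
  have uv: "\<bar>u\<bar> \<le> 1" "\<bar>v\<bar> \<le> 1"
    using abs_le_rad(1)[of x y] abs_le_rad(2)[of y x] r by (auto simp: u_def v_def)
  have S: "\<bar>S\<bar> \<le> 1" "\<bar>C\<bar> \<le> 1" using abs_sinp_le_1 abs_cosp_le_1 by (auto simp: S_def C_def)
  have "cos t = u * C - v * S"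
    using polar_back(1)[OF assms, of t] r by (simp add: u_def v_def C_def S_def field_simps)
  moreover have "share x y = u\<^sup>2" by (simp add: share_def u_def power_divide rad_sq)
  moreover have "C\<^sup>2 = 1 - S\<^sup>2" using polar_back(3)[OF assms, of t] by (simp add: C_def S_def)
  ultimately have eq: "(cos t)\<^sup>2 - share x y = S * (v * v * S - u * u * S - 2 * u * v * C)"
    by algebra
  have "\<bar>v\<bar> * \<bar>v\<bar> * \<bar>S\<bar> \<le> 1" "\<bar>u\<bar> * \<bar>u\<bar> * \<bar>S\<bar> \<le> 1" "\<bar>u\<bar> * \<bar>v\<bar> * \<bar>C\<bar> \<le> 1"
    by (intro mult_le_one abs_ge_zero mult_nonneg_nonneg uv S)+
  then have "\<bar>v * v * S\<bar> \<le> 1" "\<bar>u * u * S\<bar> \<le> 1" "\<bar>2 * u * v * C\<bar> \<le> 2"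
    by (simp_all only: abs_mult mult.assoc abs_numeral)
  then have "\<bar>v * v * S - u * u * S - 2 * u * v * C\<bar> \<le> 4" by linarith
  then show ?thesis unfolding eq abs_mult S_def[symmetric]
    by (subst mult.commute) (intro mult_right_mono, auto)
qed

text \<open>Completing the square in \<open>S + r * h\<close> bounds the curvature term by half of
  \<open>S^2 / r\<close> and an error of order \<open>r\<close>; the second inequality keeps the
  remaining half.\<close>

lemma energy_rate_lower:
  fixes r w S h M N :: real
  assumes "r > 0" "0 \<le> w" "w \<le> 1" "\<bar>h\<bar> \<le> M" "N \<ge> 0"
  shows "- (N * M\<^sup>2 * r) \<le> N * w * (S\<^sup>2 / r + h * S)"
    and "N / 2 * w * S\<^sup>2 / r - N * M\<^sup>2 * r \<le> N * w * (S\<^sup>2 / r + h * S)"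
proof -
  have hM: "h\<^sup>2 \<le> M\<^sup>2" using assms(4) by (simp add: abs_le_square_iff[symmetric])
  have "0 \<le> (S + r * h)\<^sup>2 / (2 * r)" using assms by simp
  also have "\<dots> = S\<^sup>2 / (2 * r) + h * S + r * h\<^sup>2 / 2"
    using assms(1) by (simp add: power2_eq_square field_simps)
  finally have "S\<^sup>2 / (2 * r) - r * h\<^sup>2 / 2 \<le> S\<^sup>2 / r + h * S" by (simp add: field_simps)
  then have "N * w * (S\<^sup>2 / (2 * r) - r * h\<^sup>2 / 2) \<le> N * w * (S\<^sup>2 / r + h * S)"
    using assms by (intro mult_left_mono) auto
  moreover have "N * w * (r * h\<^sup>2 / 2) \<le> N * 1 * (r * M\<^sup>2)"
  proof (intro mult_mono)
    have "h\<^sup>2 / 2 \<le> M\<^sup>2" using hM zero_le_power2[of h] by linarith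
    then show "r * h\<^sup>2 / 2 \<le> r * M\<^sup>2"
      using assms(1) mult_left_mono[of "h\<^sup>2 / 2" "M\<^sup>2" r] by simp
  qed (use assms in auto)
  moreover have "N * w * (S\<^sup>2 / (2 * r) - r * h\<^sup>2 / 2) = N / 2 * w * S\<^sup>2 / r - N * w * (r * h\<^sup>2 / 2)"
    by (simp add: algebra_simps)
  ultimately show A: "N / 2 * w * S\<^sup>2 / r - N * M\<^sup>2 * r \<le> N * w * (S\<^sup>2 / r + h * S)"
    by (simp add: mult_ac)
  have "0 \<le> N / 2 * w * S\<^sup>2 / r" using assms by simp
  then show "- (N * M\<^sup>2 * r) \<le> N * w * (S\<^sup>2 / r + h * S)" using A by linarith
qed

section \<open>Departure from an admissible state\<close>

text \<open>The last condition of \<open>solution_on\<close> rules out curves that run along an axis.\<close>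

definition admissible :: "nat \<Rightarrow> nat \<Rightarrow> real \<Rightarrow> real \<Rightarrow> real \<Rightarrow> bool" where
  "admissible l m x y t \<longleftrightarrow> (x = 0 \<longrightarrow> y \<noteq> 0 \<longrightarrow> sin t = 0) \<and> (y = 0 \<longrightarrow> x \<noteq> 0 \<longrightarrow> cos t = 0) \<and>
     (x = 0 \<longrightarrow> y = 0 \<longrightarrow> (cos t)\<^sup>2 = cshare l m)"

definition solution_on ::
    "nat \<Rightarrow> nat \<Rightarrow> (real \<Rightarrow> real) \<Rightarrow> real \<Rightarrow> real \<Rightarrow> (real \<Rightarrow> real) \<Rightarrow> (real \<Rightarrow> real) \<Rightarrow> (real \<Rightarrow> real) \<Rightarrow> bool" where
  "solution_on l m H a b x y t \<longleftrightarrow>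
     (\<forall>s\<in>{a..b}. (x has_real_derivative cos (t s)) (at s within {a..b}) \<and>
        (y has_real_derivative sin (t s)) (at s within {a..b}) \<and>
        (x s \<noteq> 0 \<longrightarrow> y s \<noteq> 0 \<longrightarrow>
           (t has_real_derivative turning l m (H s) (x s) (y s) (t s)) (at s within {a..b})) \<and>
        admissible l m (x s) (y s) (t s)) \<and>
     continuous_on {a..b} t \<and> finite {s \<in> {a..b}. x s * y s = 0}"

lemma solution_onD:
  assumes "solution_on l m H a b x y t" "s \<in> {a..b}"
  shows "(x has_real_derivative cos (t s)) (at s within {a..b})"
    "(y has_real_derivative sin (t s)) (at s within {a..b})"
    "x s \<noteq> 0 \<Longrightarrow> y s \<noteq> 0 \<Longrightarrow>
      (t has_real_derivative turning l m (H s) (x s) (y s) (t s)) (at s within {a..b})"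
    "admissible l m (x s) (y s) (t s)"
  using assms by (auto simp: solution_on_def)

text \<open>The swap of the two axes reverses the orientation of the plane.\<close>

lemma turning_swap: "turning m l (- h) y x (pi / 2 - t) = - turning l m h x y t"
  by (simp add: turning_def sin_diff cos_diff algebra_simps)

lemma admissible_swap:
  assumes "l \<ge> 1" "m \<ge> 1"
  shows "admissible m l y x (pi / 2 - t) \<longleftrightarrow> admissible l m x y t"
proof -
  have "(sin t)\<^sup>2 = cshare m l \<longleftrightarrow> (cos t)\<^sup>2 = cshare l m"
  proof -
    have "cshare m l = 1 - cshare l m" using assms by (simp add: cshare_def field_simps)
    then show ?thesis using sin_cos_squared_add[of t] by linarith
  qed
  then show ?thesis by (auto simp: admissible_def sin_diff cos_diff)
qed

lemma solution_on_swap: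
  assumes lm: "l \<ge> 1" "m \<ge> 1" and sol: "solution_on l m H a b x y t"
  shows "solution_on m l (\<lambda>s. - H s) a b y x (\<lambda>s. pi / 2 - t s)"
proof -
  have "((\<lambda>s. pi / 2 - t s) has_real_derivative turning m l (- H s) (y s) (x s) (pi / 2 - t s)) (at s within {a..b})"
    if "(t has_real_derivative turning l m (H s) (x s) (y s) (t s)) (at s within {a..b})" for s
    unfolding turning_swap using that by (auto intro!: derivative_eq_intros)
  then show ?thesis
    using sol unfolding solution_on_def admissible_swap[OF lm]
    by (auto simp: sin_diff cos_diff mult.commute intro!: continuous_intros)
qed

lemma solution_on_subset:
  assumes "solution_on l m H a b x y t" "a \<le> c" "d \<le> b"
  shows "solution_on l m H c d x y t"
proof -
  have sub: "{c..d} \<subseteq> {a..b}" using assms by auto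
  have "finite {s \<in> {c..d}. x s * y s = 0}"
    by (rule finite_subset[of _ "{s \<in> {a..b}. x s * y s = 0}"]) (use assms sub in \<open>auto simp: solution_on_def\<close>)
  moreover have "continuous_on {c..d} t"
    using assms sub by (auto simp: solution_on_def intro: continuous_on_subset)
  ultimately show ?thesis
    using assms(1) sub unfolding solution_on_def by (meson DERIV_subset subsetD)
qed

lemma solution_on_cong:
  assumes "solution_on l m H a b x y t"
    and "\<And>s. s \<in> {a..b} \<Longrightarrow> x' s = x s" "\<And>s. s \<in> {a..b} \<Longrightarrow> y' s = y s" "\<And>s. s \<in> {a..b} \<Longrightarrow> t' s = t s"
  shows "solution_on l m H a b x' y' t'"
proof -
  have "{s \<in> {a..b}. x' s * y' s = 0} = {s \<in> {a..b}. x s * y s = 0}" using assms by auto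
  moreover have "continuous_on {a..b} t' = continuous_on {a..b} t"
    using assms by (intro continuous_on_cong) auto
  moreover have "(f' has_real_derivative D) (at s within {a..b})"
    if "(f has_real_derivative D) (at s within {a..b})" "\<And>s. s \<in> {a..b} \<Longrightarrow> f' s = f s" "s \<in> {a..b}" for f f' D s
    using that unfolding has_field_derivative_def by (blast intro: has_derivative_transform)
  ultimately show ?thesis
    using assms unfolding solution_on_def by (metis (no_types, lifting))
qed

lemma solution_on_glue:
  assumes 1: "solution_on l m H a b x y t" and 2: "solution_on l m H b c x y t"
    and "a \<le> b" "b \<le> c"
  shows "solution_on l m H a c x y t"
proof -
  have un: "{a..c} = {a..b} \<union> {b..c}" using assms by auto
  have glue: "(f has_real_derivative D) (at s within {a..c})"
    if "s \<in> {a..b} \<Longrightarrow> (f has_real_derivative D) (at s within {a..b})"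
      "s \<in> {b..c} \<Longrightarrow> (f has_real_derivative D) (at s within {b..c})" "s \<in> {a..c}" for f D s
  proof (rule linorder_cases[of s b])
    assume "s < b"
    then have "at s within {a..c} = at s within {a..b}"
      using assms by (intro at_within_nhd[where S="{..<b}"]) auto
    then show ?thesis using that \<open>s < b\<close> by auto
  next
    assume "s > b"
    then have "at s within {a..c} = at s within {b..c}"
      using assms by (intro at_within_nhd[where S="{b<..}"]) auto
    then show ?thesis using that \<open>s > b\<close> by auto
  next
    assume "s = b"
    then show ?thesis using that assms(3,4) unfolding un has_field_derivative_iff
      by (intro Lim_Un) auto
  qed
  have "{s \<in> {a..c}. x s * y s = 0} = {s \<in> {a..b}. x s * y s = 0} \<union> {s \<in> {b..c}. x s * y s = 0}"
    using un by auto
  then have "finite {s \<in> {a..c}. x s * y s = 0}" using 1 2 by (simp add: solution_on_def)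
  moreover have "continuous_on {a..c} t"
    unfolding un using 1 2 by (intro continuous_on_closed_Un) (auto simp: solution_on_def)
  ultimately show ?thesis
    using 1 2 unfolding solution_on_def
    by (intro conjI ballI impI glue) (auto simp: un)
qed

section \<open>Regularized equation and passage to the limit\<close>

lemma bounded_on_interval:
  fixes H :: "real \<Rightarrow> real"
  assumes "continuous_on UNIV H"
  obtains M where "M \<ge> 0" "\<And>s. s \<in> {a..b} \<Longrightarrow> \<bar>H s\<bar> \<le> M"
proof -
  have "compact (H ` {a..b})"
    by (intro compact_continuous_image continuous_on_subset[OF assms]) auto
  then obtain M where "\<forall>v\<in>H ` {a..b}. norm v \<le> M"
    using compact_imp_bounded bounded_iff by metis
  then show ?thesis by (intro that[of "max M 0"]) (auto intro: max.coboundedI1)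
qed

text \<open>A bounded continuous substitute for \<open>1 / x\<close> when
  \<open>\<delta> > 0\<close>: unchanged for \<open>|x| \<ge> \<delta>\<close>, linear in
  between.\<close>

definition reginv :: "real \<Rightarrow> real \<Rightarrow> real" where
  "reginv \<delta> x = x / max (x\<^sup>2) (\<delta>\<^sup>2)"

lemma reginv_eq: "\<delta> > 0 \<Longrightarrow> \<delta> \<le> \<bar>x\<bar> \<Longrightarrow> reginv \<delta> x = 1 / x"
proof -
  assume "\<delta> > 0" "\<delta> \<le> \<bar>x\<bar>"
  then have "\<delta>\<^sup>2 \<le> x\<^sup>2" by (simp add: abs_le_square_iff[symmetric])
  then show ?thesis by (simp add: reginv_def max_absorb1 power2_eq_square)
qed

lemma reginv_bounded: "\<delta> > 0 \<Longrightarrow> \<bar>reginv \<delta> x\<bar> \<le> 1 / \<delta>"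
proof -
  assume d: "\<delta> > 0"
  have "\<bar>x\<bar> * \<delta> \<le> max (x\<^sup>2) (\<delta>\<^sup>2)"
  proof (cases "\<delta> \<le> \<bar>x\<bar>")
    case True
    then have "\<bar>x\<bar> * \<delta> \<le> \<bar>x\<bar> * \<bar>x\<bar>" by (intro mult_left_mono) auto
    then show ?thesis by (simp add: power2_eq_square)
  next
    case False
    then have "\<bar>x\<bar> * \<delta> \<le> \<delta> * \<delta>" using d by (intro mult_right_mono) auto
    then show ?thesis by (simp add: power2_eq_square)
  qed
  moreover have "max (x\<^sup>2) (\<delta>\<^sup>2) > 0" using d by (simp add: less_max_iff_disj)
  ultimately show ?thesis using d by (simp add: reginv_def field_simps)
qed

text \<open>Peano's theorem for the equation with both reciprocals truncated. The true equation is
  asserted only above the thresholds; that these are never crossed is shown separately for each kind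
  of departure.\<close>

lemma regularized_solution:
  assumes H: "continuous_on UNIV H" and \<delta>: "\<delta> > 0" "\<epsilon> > 0" and ab: "a < b"
  obtains x y t where "x a = x0" "y a = y0" "t a = t0"
    "\<And>s. s \<in> {a..b} \<Longrightarrow> (x has_real_derivative cos (t s)) (at s within {a..b})"
    "\<And>s. s \<in> {a..b} \<Longrightarrow> (y has_real_derivative sin (t s)) (at s within {a..b})"
    "\<And>s. s \<in> {a..b} \<Longrightarrow> \<delta> \<le> \<bar>x s\<bar> \<Longrightarrow> \<epsilon> \<le> \<bar>y s\<bar> \<Longrightarrow>
       (t has_real_derivative turning l m (H s) (x s) (y s) (t s)) (at s within {a..b})"
    "continuous_on {a..b} t"
proof -
  \<comment> \<open>Freezing \<open>H\<close> outside \<open>[a, b]\<close> makes the right-hand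
    side bounded for all times.\<close>
  define Hc where "Hc s = H (max a (min b s))" for s
  have cH: "continuous_on UNIV Hc"
    unfolding Hc_def by (intro continuous_on_compose2[OF H] continuous_intros) auto
  obtain M where "\<And>s. s \<in> {a..b} \<Longrightarrow> \<bar>H s\<bar> \<le> M"
    using bounded_on_interval[OF H] by blast
  then have M: "\<bar>Hc s\<bar> \<le> M" for s using ab by (auto simp: Hc_def)
  define f where "f s u = (case u of (x, y, t) \<Rightarrow>
     (cos t, sin t, real m * cos t * reginv \<epsilon> y - real l * sin t * reginv \<delta> x - real (l + m + 1) * Hc s))"
    for s :: real and u :: "real \<times> real \<times> real"
  have cr: "continuous_on UNIV (\<lambda>p. reginv d (g p))" if "d > 0" "continuous_on UNIV g"
    for d and g :: "real \<times> real \<times> real \<times> real \<Rightarrow> real"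
  proof -
    have "max z (d\<^sup>2) \<noteq> 0" for z :: real using that(1) by (smt (verit) zero_less_power)
    then show ?thesis unfolding reginv_def by (intro continuous_intros that(2)) auto
  qed
  have cHf: "continuous_on UNIV (\<lambda>p :: real \<times> real \<times> real \<times> real. Hc (fst p))"
    by (rule continuous_on_compose2[OF cH]) (auto intro!: continuous_intros)
  have cont: "continuous_on UNIV (\<lambda>(s, u). f s u)"
    unfolding f_def case_prod_beta
    by (intro continuous_intros cr cHf \<delta>)
  have bd: "norm (f s u) \<le> 1 + (1 + (real m / \<epsilon> + real l / \<delta> + real (l + m + 1) * M))" for s u
  proof -
    obtain x y t where u: "u = (x, y, t)" by (cases u)
    have "\<bar>real m * cos t * reginv \<epsilon> y\<bar> \<le> real m * 1 * (1 / \<epsilon>)"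
      unfolding abs_mult using reginv_bounded[OF \<delta>(2), of y] by (intro mult_mono) auto
    moreover have "\<bar>real l * sin t * reginv \<delta> x\<bar> \<le> real l * 1 * (1 / \<delta>)"
      unfolding abs_mult using reginv_bounded[OF \<delta>(1), of x] by (intro mult_mono) auto
    moreover have "\<bar>real (l + m + 1) * Hc s\<bar> \<le> real (l + m + 1) * M"
      unfolding abs_mult using M[of s] by (intro mult_mono) auto
    ultimately have "\<bar>real m * cos t * reginv \<epsilon> y - real l * sin t * reginv \<delta> x - real (l + m + 1) * Hc s\<bar>
      \<le> real m / \<epsilon> + real l / \<delta> + real (l + m + 1) * M" by simp
    moreover have "norm (f s u) \<le> \<bar>cos t\<bar> + (\<bar>sin t\<bar> + \<bar>real m * cos t * reginv \<epsilon> y - real l * sin t * reginv \<delta> x - real (l + m + 1) * Hc s\<bar>)"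
      unfolding u f_def prod.case
      by (intro order_trans[OF norm_Pair_le] add_mono order_refl order_trans[OF norm_Pair_le]) auto
    ultimately show ?thesis using abs_cos_le_one[of t] abs_sin_le_one[of t] by linarith
  qed
  obtain u where u0: "u a = (x0, y0, t0)"
    and u: "\<And>s. s \<in> {a..b} \<Longrightarrow> (u has_vector_derivative f s (u s)) (at s within {a..b})"
    using Peano_bounded[OF cont bd ab, of "(x0, y0, t0)"] by blast
  have comp: "((\<lambda>s. fst (u s)) has_real_derivative fst (f s (u s))) (at s within {a..b})"
     "((\<lambda>s. fst (snd (u s))) has_real_derivative fst (snd (f s (u s)))) (at s within {a..b})"
     "((\<lambda>s. snd (snd (u s))) has_real_derivative snd (snd (f s (u s)))) (at s within {a..b})"
    if "s \<in> {a..b}" for s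
    unfolding has_real_derivative_iff_has_vector_derivative
    using bounded_linear.has_vector_derivative[OF bounded_linear_fst u[OF that]]
      bounded_linear.has_vector_derivative[OF bounded_linear_compose[OF bounded_linear_fst bounded_linear_snd] u[OF that]]
      bounded_linear.has_vector_derivative[OF bounded_linear_compose[OF bounded_linear_snd bounded_linear_snd] u[OF that]]
    by auto
  show thesis
  proof (rule that[of "\<lambda>s. fst (u s)" "\<lambda>s. fst (snd (u s))" "\<lambda>s. snd (snd (u s))"])
    fix s assume s: "s \<in> {a..b}"
    show "((\<lambda>s. fst (u s)) has_real_derivative cos (snd (snd (u s)))) (at s within {a..b})"
      using comp(1)[OF s] by (simp add: f_def case_prod_beta)
    show "((\<lambda>s. fst (snd (u s))) has_real_derivative sin (snd (snd (u s)))) (at s within {a..b})"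
      using comp(2)[OF s] by (simp add: f_def case_prod_beta)
    assume "\<delta> \<le> \<bar>fst (u s)\<bar>" "\<epsilon> \<le> \<bar>fst (snd (u s))\<bar>"
    moreover have "Hc s = H s" using s by (simp add: Hc_def)
    ultimately show "((\<lambda>s. snd (snd (u s))) has_real_derivative turning l m (H s) (fst (u s)) (fst (snd (u s))) (snd (snd (u s))))
        (at s within {a..b})"
      using comp(3)[OF s] by (simp add: f_def case_prod_beta turning_def reginv_eq \<delta>)
  next
    show "continuous_on {a..b} (\<lambda>s. snd (snd (u s)))" by (rule DERIV_continuous_on[OF comp(3)])
  qed (use u0 in auto)
qed

lemma lipschitz_of_derivative_bound:
  fixes f :: "real \<Rightarrow> real"
  assumes "\<And>s. s \<in> {a..b} \<Longrightarrow> (f has_real_derivative d s) (at s within {a..b})"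
    and "\<And>s. s \<in> {a..b} \<Longrightarrow> \<bar>d s\<bar> \<le> B" and "s \<in> {a..b}" "t \<in> {a..b}"
  shows "\<bar>f t - f s\<bar> \<le> B * \<bar>t - s\<bar>"
  using field_differentiable_bound[of "{a..b}" f d B t s] assms by auto

lemma has_integral_of_derivative:
  fixes f :: "real \<Rightarrow> real"
  assumes "\<And>s. s \<in> {a..b} \<Longrightarrow> (f has_real_derivative d s) (at s within {a..b})"
    and "c \<in> {a..b}" "e \<in> {a..b}" "c \<le> e"
  shows "(d has_integral (f e - f c)) {c..e}"
proof (rule fundamental_theorem_of_calculus)
  fix s assume "s \<in> {c..e}"
  then show "(f has_vector_derivative d s) (at s within {c..e})"
    unfolding has_real_derivative_iff_has_vector_derivative[symmetric]
    using assms by (intro DERIV_subset[OF assms(1)]) auto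
qed fact

text \<open>The estimates that have to be uniform in the distance of the starting point from the
  singular state: \<open>L\<close> gives equicontinuity, and the linear lower bound with
  \<open>al > 0\<close> keeps the limit off the axes for \<open>s > a\<close>.\<close>

definition controlled_on ::
    "nat \<Rightarrow> nat \<Rightarrow> (real \<Rightarrow> real) \<Rightarrow> real \<Rightarrow> real \<Rightarrow> real \<Rightarrow> real \<Rightarrow>
      (real \<Rightarrow> real) \<Rightarrow> (real \<Rightarrow> real) \<Rightarrow> (real \<Rightarrow> real) \<Rightarrow> bool" where
  "controlled_on l m H a b L al x y t \<longleftrightarrow> (\<forall>s\<in>{a..b}.
     (x has_real_derivative cos (t s)) (at s within {a..b}) \<and>
     (y has_real_derivative sin (t s)) (at s within {a..b}) \<and>
     (t has_real_derivative turning l m (H s) (x s) (y s) (t s)) (at s within {a..b}) \<and>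
     \<bar>turning l m (H s) (x s) (y s) (t s)\<bar> \<le> L \<and>
     al * (s - a) \<le> \<bar>x s\<bar> \<and> al * (s - a) \<le> \<bar>y s\<bar>)"

text \<open>The starting points approach the singular state along the fixed direction
  \<open>(p, q)\<close>, with the angle already equal to \<open>t0\<close>. At \<open>a\<close> one
  coordinate of the limit vanishes, so \<open>solution_on\<close> asks for no equation of the angle
  there.\<close>

lemma solution_of_approximations:
  assumes H: "continuous_on UNIV H" and ab: "a < b" and al0: "al > 0" and e0: "e0 > 0"
    and ex: "\<And>e. 0 < e \<Longrightarrow> e \<le> e0 \<Longrightarrow> \<exists>x y t. controlled_on l m H a b L al x y t \<and>
       x a = x0 + e * p \<and> y a = y0 + e * q \<and> t a = t0"
    and adm: "admissible l m x0 y0 t0" "x0 = 0 \<or> y0 = 0"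
  shows "\<exists>x y t. solution_on l m H a b x y t \<and> x a = x0 \<and> y a = y0 \<and> t a = t0"
proof -
  define e where "e k = e0 * inverse (real (Suc k))" for k
  have "inverse (real (Suc k)) \<le> 1" for k by (simp add: field_simps)
  then have e: "0 < e k" "e k \<le> e0" for k
    unfolding e_def using e0 by (simp, intro mult_left_le) auto
  have lim_e: "(\<lambda>k. v + e k * c) \<longlonglongrightarrow> v" for v c
    using tendsto_add[OF tendsto_const tendsto_mult_right[OF tendsto_mult_left[OF LIMSEQ_inverse_real_of_nat, of e0], of c], of v]
    by (simp add: e_def)
  obtain xk yk tk where k: "\<And>k. controlled_on l m H a b L al (xk k) (yk k) (tk k) \<and>
       xk k a = x0 + e k * p \<and> yk k a = y0 + e k * q \<and> tk k a = t0"
    using ex[OF e] by metis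
  then have dx: "\<And>k s. s \<in> {a..b} \<Longrightarrow> (xk k has_real_derivative cos (tk k s)) (at s within {a..b})"
    and dy: "\<And>k s. s \<in> {a..b} \<Longrightarrow> (yk k has_real_derivative sin (tk k s)) (at s within {a..b})"
    and dt: "\<And>k s. s \<in> {a..b} \<Longrightarrow>
       (tk k has_real_derivative turning l m (H s) (xk k s) (yk k s) (tk k s)) (at s within {a..b})"
    and L: "\<And>k s. s \<in> {a..b} \<Longrightarrow> \<bar>turning l m (H s) (xk k s) (yk k s) (tk k s)\<bar> \<le> L"
    and al: "\<And>k s. s \<in> {a..b} \<Longrightarrow> al * (s - a) \<le> \<bar>xk k s\<bar>" "\<And>k s. s \<in> {a..b} \<Longrightarrow> al * (s - a) \<le> \<bar>yk k s\<bar>"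
    unfolding controlled_on_def by blast+
  have init: "(\<lambda>k. xk k a) \<longlonglongrightarrow> x0" "(\<lambda>k. yk k a) \<longlonglongrightarrow> y0" "(\<lambda>k. tk k a) \<longlonglongrightarrow> t0"
    using k lim_e by simp_all
  define u where "u k s = (xk k s, yk k s, tk k s)" for k s
  have L0: "0 \<le> L" using L[of a 0] ab by auto
  have "(\<lambda>k. u k a) \<longlonglongrightarrow> (x0, y0, t0)"
    unfolding u_def by (intro tendsto_Pair init)
  then have "Bseq (\<lambda>k. u k a)" by (intro convergent_imp_Bseq) (auto simp: convergent_def)
  then obtain M where M: "\<And>k. norm (u k a) \<le> M" by (auto simp: Bseq_def)
  have lip: "norm (u k t - u k s) \<le> (2 + L) * \<bar>t - s\<bar>" if "s \<in> {a..b}" "t \<in> {a..b}" for k s t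
  proof -
    have "\<bar>xk k t - xk k s\<bar> \<le> 1 * \<bar>t - s\<bar>" "\<bar>yk k t - yk k s\<bar> \<le> 1 * \<bar>t - s\<bar>" "\<bar>tk k t - tk k s\<bar> \<le> L * \<bar>t - s\<bar>"
      using lipschitz_of_derivative_bound[OF dx _ that, where B=1] lipschitz_of_derivative_bound[OF dy _ that, where B=1]
        lipschitz_of_derivative_bound[OF dt L that] by auto
    moreover have "norm (u k t - u k s) \<le> \<bar>xk k t - xk k s\<bar> + (\<bar>yk k t - yk k s\<bar> + \<bar>tk k t - tk k s\<bar>)"
      unfolding u_def by (auto intro!: order_trans[OF norm_Pair_le] add_mono)
    ultimately show ?thesis by (simp add: algebra_simps)
  qed
  obtain g r where cg: "continuous_on {a..b} g" and r: "strict_mono (r :: nat \<Rightarrow> nat)"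
    and conv: "\<And>s. s \<in> {a..b} \<Longrightarrow> (\<lambda>n. u (r n) s) \<longlonglongrightarrow> g s"
    using lipschitz_Arzela_Ascoli[of a b "2 + L" u M] lip M L0 ab by (auto simp: less_imp_le)
  define x y t where "x s = fst (g s)" and "y s = fst (snd (g s))" and "t s = snd (snd (g s))" for s
  have cx: "(\<lambda>n. xk (r n) s) \<longlonglongrightarrow> x s" and cy: "(\<lambda>n. yk (r n) s) \<longlonglongrightarrow> y s" and ct: "(\<lambda>n. tk (r n) s) \<longlonglongrightarrow> t s"
    if "s \<in> {a..b}" for s
    using tendsto_fst[OF conv[OF that]] tendsto_fst[OF tendsto_snd[OF conv[OF that]]] tendsto_snd[OF tendsto_snd[OF conv[OF that]]]
    by (simp_all add: u_def x_def y_def t_def)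
  have cont: "continuous_on {a..b} x" "continuous_on {a..b} y" "continuous_on {a..b} t"
    unfolding x_def y_def t_def by (intro continuous_intros cg)+
  have Dx: "(x has_real_derivative cos (t s)) (at s within {a..b})" if "s \<in> {a..b}" for s
    unfolding has_real_derivative_iff_has_vector_derivative
    by (rule ode_limit[where g="\<lambda>n s. cos (tk (r n) s)" and uk="\<lambda>n. xk (r n)" and G="\<lambda>s. cos (t s)" and B=1])
      (use that ab in \<open>auto intro!: has_integral_of_derivative[OF dx] cx tendsto_intros ct continuous_intros cont\<close>)
  have Dy: "(y has_real_derivative sin (t s)) (at s within {a..b})" if "s \<in> {a..b}" for s
    unfolding has_real_derivative_iff_has_vector_derivative
    by (rule ode_limit[where g="\<lambda>n s. sin (tk (r n) s)" and uk="\<lambda>n. yk (r n)" and G="\<lambda>s. sin (t s)" and B=1])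
      (use that ab in \<open>auto intro!: has_integral_of_derivative[OF dy] cy tendsto_intros ct continuous_intros cont\<close>)
  have low: "al * (s - a) \<le> \<bar>x s\<bar>" "al * (s - a) \<le> \<bar>y s\<bar>" if "s \<in> {a..b}" for s
    using al that by (auto intro!: tendsto_lowerbound[OF tendsto_rabs[OF cx]] tendsto_lowerbound[OF tendsto_rabs[OF cy]] always_eventually)
  have nz: "x s \<noteq> 0" "y s \<noteq> 0" if "s \<in> {a<..b}" for s
  proof -
    have "0 < al * (s - a)" using that al0 by simp
    then show "x s \<noteq> 0" "y s \<noteq> 0" using low[of s] that by auto
  qed
  have Dt: "(t has_real_derivative turning l m (H s) (x s) (y s) (t s)) (at s within {a..b})" if s: "s \<in> {a<..b}" for s
  proof -
    \<comment> \<open>The limit is taken on \<open>[c, b]\<close>, since the limiting right-hand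
      side is singular at \<open>a\<close>.\<close>
    define c where "c = (a + s) / 2"
    have c: "a < c" "c < s" using s by (auto simp: c_def)
    have sub: "{c..b} \<subseteq> {a..b}" using c by auto
    have "(t has_vector_derivative turning l m (H s) (x s) (y s) (t s)) (at s within {c..b})"
    proof (rule ode_limit[where g="\<lambda>n s. turning l m (H s) (xk (r n) s) (yk (r n) s) (tk (r n) s)" and uk="\<lambda>n. tk (r n)"
          and G="\<lambda>s. turning l m (H s) (x s) (y s) (t s)" and B=L])
      show "continuous_on {c..b} (\<lambda>s. turning l m (H s) (x s) (y s) (t s))"
        unfolding turning_def using nz c
        by (intro continuous_intros continuous_on_subset[OF cont(1) sub] continuous_on_subset[OF cont(2) sub]
            continuous_on_subset[OF cont(3) sub] continuous_on_subset[OF H]) auto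
    next
      fix v assume "v \<in> {c..b}"
      then show "(\<lambda>n. turning l m (H v) (xk (r n) v) (yk (r n) v) (tk (r n) v)) \<longlonglongrightarrow> turning l m (H v) (x v) (y v) (t v)"
        unfolding turning_def using nz c by (intro tendsto_intros cx cy ct) auto
    qed (use s c in \<open>auto intro!: has_integral_of_derivative[OF dt] ct L\<close>)
    moreover have "at s within {c..b} = at s within {a..b}"
      using c s by (intro at_within_nhd[where S="{c<..}"]) auto
    ultimately show ?thesis by (simp add: has_real_derivative_iff_has_vector_derivative)
  qed
  have a: "x a = x0" "y a = y0" "t a = t0"
    using LIMSEQ_unique[OF cx] LIMSEQ_unique[OF cy] LIMSEQ_unique[OF ct] ab
      LIMSEQ_subseq_LIMSEQ[OF init(1) r] LIMSEQ_subseq_LIMSEQ[OF init(2) r] LIMSEQ_subseq_LIMSEQ[OF init(3) r]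
    by (auto simp: o_def)
  have "solution_on l m H a b x y t"
    unfolding solution_on_def
  proof (intro conjI ballI impI)
    fix s assume s: "s \<in> {a..b}"
    show "admissible l m (x s) (y s) (t s)"
      using nz[of s] s a adm(1) by (cases "s = a") (auto simp: admissible_def)
    show "(t has_real_derivative turning l m (H s) (x s) (y s) (t s)) (at s within {a..b})"
      if "x s \<noteq> 0" "y s \<noteq> 0"
      using that s a adm(2) by (intro Dt) (auto simp: le_less)
  next
    show "finite {s \<in> {a..b}. x s * y s = 0}"
      by (rule finite_subset[of _ "{a}"]) (use nz in \<open>force simp: le_less\<close>, simp)
  qed (use Dx Dy cont in auto)
  with a show ?thesis by blast
qed

section \<open>Departure from regular points and from an axis\<close>

lemma quotient_bound:
  fixes u v B :: real
  assumes "0 < B" "B \<le> \<bar>v\<bar>" "\<bar>u\<bar> \<le> 1"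
  shows "\<bar>real k * u / v\<bar> \<le> real k * (1 / B)"
proof -
  have "\<bar>u\<bar> / \<bar>v\<bar> \<le> 1 / B" using assms by (intro frac_le) auto
  then have "real k * (\<bar>u\<bar> / \<bar>v\<bar>) \<le> real k * (1 / B)" by (intro mult_left_mono) auto
  then show ?thesis by (simp add: abs_mult)
qed

lemma depart_regular:
  assumes H: "continuous_on UNIV H" and nz: "x0 \<noteq> 0" "y0 \<noteq> 0"
  shows "\<exists>b>a. \<exists>x y t. solution_on l m H a b x y t \<and> x a = x0 \<and> y a = y0 \<and> t a = t0"
proof -
  \<comment> \<open>At unit speed neither coordinate can fall below half of its initial size before
    \<open>b\<close>.\<close>
  define \<delta> \<epsilon> b where "\<delta> = \<bar>x0\<bar> / 2" and "\<epsilon> = \<bar>y0\<bar> / 2" and "b = a + min \<delta> \<epsilon>"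
  have pos: "\<delta> > 0" "\<epsilon> > 0" "a < b" using nz by (auto simp: \<delta>_def \<epsilon>_def b_def)
  obtain x y t where i: "x a = x0" "y a = y0" "t a = t0"
    and dx: "\<And>s. s \<in> {a..b} \<Longrightarrow> (x has_real_derivative cos (t s)) (at s within {a..b})"
    and dy: "\<And>s. s \<in> {a..b} \<Longrightarrow> (y has_real_derivative sin (t s)) (at s within {a..b})"
    and dt: "\<And>s. s \<in> {a..b} \<Longrightarrow> \<delta> \<le> \<bar>x s\<bar> \<Longrightarrow> \<epsilon> \<le> \<bar>y s\<bar> \<Longrightarrow>
       (t has_real_derivative turning l m (H s) (x s) (y s) (t s)) (at s within {a..b})"
    and ct: "continuous_on {a..b} t"
    by (rule regularized_solution[OF H pos, of x0 y0 t0 l m]) (assumption | rule that)+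
  have low: "\<delta> \<le> \<bar>x s\<bar>" "\<epsilon> \<le> \<bar>y s\<bar>" if s: "s \<in> {a..b}" for s
  proof -
    have "\<bar>x s - x a\<bar> \<le> 1 * \<bar>s - a\<bar>" "\<bar>y s - y a\<bar> \<le> 1 * \<bar>s - a\<bar>"
      using s pos lipschitz_of_derivative_bound[OF dx, where B=1 and s=a and t=s]
        lipschitz_of_derivative_bound[OF dy, where B=1 and s=a and t=s] by auto
    then show "\<delta> \<le> \<bar>x s\<bar>" "\<epsilon> \<le> \<bar>y s\<bar>" using s i by (auto simp: \<delta>_def \<epsilon>_def b_def min_def split: if_splits)
  qed
  then have nz': "x s \<noteq> 0 \<and> y s \<noteq> 0" if "s \<in> {a..b}" for s using that pos by force
  have emp: "{s \<in> {a..b}. x s * y s = 0} = {}" using nz' by auto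
  have "solution_on l m H a b x y t"
    unfolding solution_on_def emp using dx dy dt low nz' ct by (simp add: admissible_def)
  then show ?thesis using pos i by blast
qed

lemma increase_of_derivative:
  fixes f :: "real \<Rightarrow> real"
  assumes der: "\<And>s. s \<in> {a..b} \<Longrightarrow> (f has_real_derivative d s) (at s within {a..b})"
    and k: "\<And>s. a < s \<Longrightarrow> s < b \<Longrightarrow> k \<le> d s" and ab: "a \<le> b"
  shows "k * (b - a) \<le> f b - f a"
proof -
  have "f a - k * a \<le> f b - k * b"
  proof (rule mono_except_finite[where f="\<lambda>s. f s - k * s" and a=a and b=b and F="{}"])
    show "continuous_on {a..b} (\<lambda>s. f s - k * s)"
      by (intro continuous_intros DERIV_continuous_on[OF der])
    fix s assume s: "a < s" "s < b"
    then have "(f has_real_derivative d s) (at s)" using der[of s] by (simp add: at_within_Icc_at)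
    then have "((\<lambda>s. f s - k * s) has_real_derivative d s - k) (at s)"
      by (auto intro!: derivative_eq_intros)
    then show "\<exists>e\<ge>0. ((\<lambda>s. f s - k * s) has_real_derivative e) (at s)"
      using k[OF s] by (intro exI[of _ "d s - k"]) auto
  qed (use ab in auto)
  then show ?thesis by (simp add: algebra_simps)
qed

text \<open>\<open>|x|^l\<close> is an integrating factor: its derivative cancels the contribution
  of the singular term \<open>- l * sin t / x\<close> of the turning.\<close>

lemma axis_rate:
  assumes dx: "(x has_real_derivative cos (t s)) (at s within A)"
    and dt: "(t has_real_derivative turning l m h (x s) (y s) (t s)) (at s within A)"
    and nz: "x s \<noteq> 0"
  shows "((\<lambda>s. \<bar>x s\<bar> ^ l * sin (t s)) has_real_derivative
    \<bar>x s\<bar> ^ l * (cos (t s) * (real m * cos (t s) / y s - real (l + m + 1) * h))) (at s within A)"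
proof -
  have ds: "((\<lambda>s. sin (t s)) has_real_derivative turning l m h (x s) (y s) (t s) * cos (t s)) (at s within A)"
    by (auto intro!: derivative_eq_intros dt)
  have "((\<lambda>s. \<bar>x s\<bar> ^ l * sin (t s)) has_real_derivative
     \<bar>x s\<bar> ^ l * (real l * cos (t s) / x s) * sin (t s) +
     turning l m h (x s) (y s) (t s) * cos (t s) * \<bar>x s\<bar> ^ l) (at s within A)"
    by (rule DERIV_mult[OF abs_power_has_derivative[OF dx nz] ds])
  moreover have "\<bar>x s\<bar> ^ l * (real l * cos (t s) / x s) * sin (t s) +
     turning l m h (x s) (y s) (t s) * cos (t s) * \<bar>x s\<bar> ^ l =
     \<bar>x s\<bar> ^ l * (cos (t s) * (real m * cos (t s) / y s - real (l + m + 1) * h))"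
    unfolding turning_def by (simp add: algebra_simps)
  ultimately show ?thesis by simp
qed

text \<open>Close to the axis \<open>x = 0\<close> the singular term disappears from the derivative of
  \<open>\<bar>x\<bar> ^ l * sin t\<close>, which therefore bounds \<open>sin t / x\<close>.\<close>

lemma depart_axis:
  assumes H: "continuous_on UNIV H" and y0: "y0 \<noteq> 0" and t0: "sin t0 = 0" and l: "l \<ge> 1"
  shows "\<exists>b>a. \<exists>x y t. solution_on l m H a b x y t \<and> x a = 0 \<and> y a = y0 \<and> t a = t0"
proof -
  obtain M where M0: "M \<ge> 0" and M: "\<And>s. s \<in> {a..a+1} \<Longrightarrow> \<bar>H s\<bar> \<le> M"
    using bounded_on_interval[OF H] by blast
  \<comment> \<open>Bound for the nonsingular part of the turning while
    \<open>|y| \<ge> |y0| / 2\<close>; the summand 1 makes it positive.\<close>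
  define K where "K = real m * (1 / (\<bar>y0\<bar> / 2)) + real (l + m + 1) * M + 1"
  define c0 where "c0 = cos t0"
  have c0: "c0 * c0 = 1" using sin_cos_squared_add[of t0] t0 by (simp add: c0_def power2_eq_square)
  have K: "K > 0" unfolding K_def using M0 by (intro add_nonneg_pos) auto
  \<comment> \<open>Within this length \<open>y\<close> keeps half of its size and
    \<open>|sin t| \<le> K * (b - a) \<le> 1 / 2\<close>, which closes the bootstrap.\<close>
  define b where "b = a + min 1 (min (\<bar>y0\<bar> / 2) (1 / (2 * K)))"
  have b: "a < b" "b \<le> a + 1" "b - a \<le> \<bar>y0\<bar> / 2" "K * (b - a) \<le> 1 / 2"
  proof -
    show "a < b" using K y0 by (simp add: b_def)
    show "b \<le> a + 1" "b - a \<le> \<bar>y0\<bar> / 2" by (auto simp: b_def)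
    have "b - a \<le> 1 / (2 * K)" by (auto simp: b_def)
    then show "K * (b - a) \<le> 1 / 2" using K by (simp add: field_simps)
  qed
  \<comment> \<open>The start is moved off the axis in the direction of motion
    \<open>c0 = cos t0\<close>, which is 1 or -1, so that \<open>|x|\<close> grows from the
    beginning.\<close>
  have ex: "\<exists>x y t. controlled_on l m H a b (K + 2 * real l * K) (1 / 2) x y t \<and>
      x a = 0 + \<epsilon> * c0 \<and> y a = y0 + \<epsilon> * 0 \<and> t a = t0" if eps: "\<epsilon> > 0" for \<epsilon>
  proof -
    have y2: "\<bar>y0\<bar> / 2 > 0" using y0 by simp
    obtain x y t where i: "x a = \<epsilon> * c0" "y a = y0" "t a = t0"
      and dx: "\<And>s. s \<in> {a..b} \<Longrightarrow> (x has_real_derivative cos (t s)) (at s within {a..b})"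
      and dy: "\<And>s. s \<in> {a..b} \<Longrightarrow> (y has_real_derivative sin (t s)) (at s within {a..b})"
      and dt: "\<And>s. s \<in> {a..b} \<Longrightarrow> \<epsilon> \<le> \<bar>x s\<bar> \<Longrightarrow> \<bar>y0\<bar> / 2 \<le> \<bar>y s\<bar> \<Longrightarrow>
         (t has_real_derivative turning l m (H s) (x s) (y s) (t s)) (at s within {a..b})"
      and ct: "continuous_on {a..b} t"
      by (rule regularized_solution[OF H eps y2 b(1), of "\<epsilon> * c0" y0 t0 l m]) (assumption | rule that)+
    have ylow: "\<bar>y0\<bar> / 2 \<le> \<bar>y s\<bar>" if s: "s \<in> {a..b}" for s
    proof -
      have "\<bar>y s - y a\<bar> \<le> 1 * \<bar>s - a\<bar>"
        using s b lipschitz_of_derivative_bound[OF dy, where B=1 and s=a and t=s] by auto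
      then show ?thesis using s i b by auto
    qed
    \<comment> \<open>As long as \<open>c0 * cos t \<ge> 1 / 2\<close>, \<open>|x|\<close> increases
      and stays above the threshold \<open>\<epsilon>\<close>, so the regularized equation is the
      true one.\<close>
    have good: "\<bar>sin (t v)\<bar> \<le> K * (v - a) \<and> \<epsilon> + (v - a) / 2 \<le> \<bar>x v\<bar>"
      if v: "v \<in> {a..b}" and pos: "\<And>s. a \<le> s \<Longrightarrow> s \<le> v \<Longrightarrow> 1 / 2 \<le> c0 * cos (t s)" for v
    proof -
      define X where "X s = c0 * x s" for s
      have dX: "(X has_real_derivative c0 * cos (t s)) (at s within {a..v})" if "s \<in> {a..v}" for s
        unfolding X_def using that v by (intro DERIV_cmult DERIV_subset[OF dx]) auto
      have Xa: "X a = \<epsilon>" using c0 i by (simp add: X_def)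
      have incr: "1 / 2 * (w - s) \<le> X w - X s" if "a \<le> s" "s \<le> w" "w \<le> v" for s w
      proof (rule increase_of_derivative[where d="\<lambda>s. c0 * cos (t s)"])
        fix u assume "u \<in> {s..w}"
        then show "(X has_real_derivative c0 * cos (t u)) (at u within {s..w})"
          using that by (intro DERIV_subset[OF dX]) auto
      qed (use that pos in auto)
      have absX: "\<bar>x s\<bar> = \<bar>X s\<bar>" for s
      proof -
        have "c0 = 1 \<or> c0 = - 1" using c0 by (simp add: square_eq_1_iff)
        then show ?thesis by (auto simp: X_def)
      qed
      have Xpos: "\<epsilon> + (s - a) / 2 \<le> X s" if "s \<in> {a..v}" for s
      proof -
        have "1 / 2 * (s - a) \<le> X s - X a" using that by (intro incr) auto
        then show ?thesis using Xa by linarith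
      qed
      have xlow: "\<epsilon> \<le> \<bar>x s\<bar>" if "s \<in> {a..v}" for s
      proof -
        have "a \<le> s" using that by simp
        then have "\<epsilon> \<le> X s" using Xpos[OF that] by argo
        then show ?thesis unfolding absX by simp
      qed
      have dF: "((\<lambda>s. \<bar>x s\<bar> ^ l * sin (t s)) has_real_derivative
          \<bar>x s\<bar> ^ l * (cos (t s) * (real m * cos (t s) / y s - real (l + m + 1) * H s))) (at s within {a..v})"
        if s: "s \<in> {a..v}" for s
      proof -
        have "x s \<noteq> 0" using xlow[OF s] eps by auto
        then show ?thesis
          using s v ylow xlow by (intro axis_rate DERIV_subset[OF dx] DERIV_subset[OF dt]) auto
      qed
      \<comment> \<open>\<open>|x|\<close> being increasing, its final power dominates the rate on
        the whole interval and then cancels from both sides.\<close>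
      have "\<bar>(\<bar>x v\<bar> ^ l * sin (t v)) - (\<bar>x a\<bar> ^ l * sin (t a))\<bar> \<le> (\<bar>x v\<bar> ^ l * K) * \<bar>v - a\<bar>"
      proof (rule lipschitz_of_derivative_bound[OF dF])
        fix s assume s: "s \<in> {a..v}"
        have "0 \<le> X s" using Xpos[OF s] s eps by (simp, argo)
        moreover have "X s \<le> X v"
        proof -
          have "s \<le> v" using s by simp
          moreover have "1 / 2 * (v - s) \<le> X v - X s" by (rule incr) (use s in auto)
          ultimately show ?thesis by argo
        qed
        ultimately have "\<bar>x s\<bar> \<le> \<bar>x v\<bar>" unfolding absX by simp
        then have p: "\<bar>x s\<bar> ^ l \<le> \<bar>x v\<bar> ^ l" by (intro power_mono) auto
        have "\<bar>real m * cos (t s) / y s\<bar> \<le> real m * (1 / (\<bar>y0\<bar> / 2))"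
          by (rule quotient_bound) (use ylow[of s] s v y2 in auto)
        moreover have "\<bar>real (l + m + 1) * H s\<bar> \<le> real (l + m + 1) * M"
          unfolding abs_mult using M[of s] s v b by (intro mult_mono) auto
        ultimately have "\<bar>real m * cos (t s) / y s - real (l + m + 1) * H s\<bar> \<le> K"
          unfolding K_def by linarith
        then have "\<bar>cos (t s)\<bar> * \<bar>real m * cos (t s) / y s - real (l + m + 1) * H s\<bar> \<le> 1 * K"
          by (intro mult_mono) auto
        with p show "\<bar>\<bar>x s\<bar> ^ l * (cos (t s) * (real m * cos (t s) / y s - real (l + m + 1) * H s))\<bar> \<le> \<bar>x v\<bar> ^ l * K"
          unfolding abs_mult[of "\<bar>x s\<bar> ^ l"] abs_mult[of "cos (t s)"] using K by (intro mult_mono) auto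
      qed (use v in auto)
      then have "\<bar>x v\<bar> ^ l * \<bar>sin (t v)\<bar> \<le> \<bar>x v\<bar> ^ l * (K * (v - a))"
        using t0 i v by (simp add: abs_mult mult.assoc)
      moreover have "\<bar>x v\<bar> ^ l > 0" using xlow[of v] v eps by auto
      ultimately have "\<bar>sin (t v)\<bar> \<le> K * (v - a)" by simp
      moreover have "\<epsilon> + (v - a) / 2 \<le> \<bar>x v\<bar>" unfolding absX using Xpos[of v] v by auto
      ultimately show ?thesis by simp
    qed
    have boot: "c0 * cos (t v) - 1 / 2 > 0" if v: "a \<le> v" "v \<le> b" for v
    proof (rule bootstrap_pos[of a b "\<lambda>s. c0 * cos (t s) - 1 / 2"])
      show "continuous_on {a..b} (\<lambda>s. c0 * cos (t s) - 1 / 2)" by (intro continuous_intros ct)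
      show "0 < c0 * cos (t a) - 1 / 2" using c0 i by (simp add: c0_def)
      fix v assume v: "a \<le> v" "v \<le> b" and pos: "\<And>s. a \<le> s \<Longrightarrow> s \<le> v \<Longrightarrow> 0 \<le> c0 * cos (t s) - 1 / 2"
      have "\<bar>sin (t v)\<bar> \<le> K * (v - a)" using good[of v] v pos by auto
      also have "\<dots> \<le> K * (b - a)" using v K by (intro mult_left_mono) auto
      also have "\<dots> \<le> 1 / 2" by (rule b)
      finally have "(sin (t v))\<^sup>2 \<le> (1 / 2)\<^sup>2" by (simp add: abs_le_square_iff[symmetric])
      then have "(cos (t v))\<^sup>2 \<ge> 3 / 4" using sin_cos_squared_add[of "t v"] by (simp add: power2_eq_square)
      moreover have "(c0 * cos (t v))\<^sup>2 = (cos (t v))\<^sup>2" using c0 by (simp add: power_mult_distrib power2_eq_square)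
      moreover have "(1 / 2)\<^sup>2 = (1 / 4 :: real)" by (simp add: power2_eq_square)
      ultimately have "(1 / 2)\<^sup>2 < (c0 * cos (t v))\<^sup>2" by linarith
      moreover have "0 \<le> c0 * cos (t v)" using pos[of v] v by auto
      ultimately have "1 / 2 < c0 * cos (t v)" by (rule power2_less_imp_less)
      then show "0 < c0 * cos (t v) - 1 / 2" by simp
    qed (use v in auto)
    have fin: "\<bar>sin (t s)\<bar> \<le> K * (s - a) \<and> \<epsilon> + (s - a) / 2 \<le> \<bar>x s\<bar>" if "s \<in> {a..b}" for s
      using boot that by (intro good) (auto intro: less_imp_le)
    have tb: "\<bar>turning l m (H s) (x s) (y s) (t s)\<bar> \<le> K + 2 * real l * K" if s: "s \<in> {a..b}" for s
    proof -
      have 1: "\<bar>real m * cos (t s) / y s\<bar> \<le> real m * (1 / (\<bar>y0\<bar> / 2))"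
        by (rule quotient_bound) (use ylow[of s] s y2 in auto)
      have "0 \<le> (s - a) / 2" using s by simp
      then have xl: "\<epsilon> \<le> \<bar>x s\<bar>" "(s - a) / 2 \<le> \<bar>x s\<bar>" using fin[OF s] eps by linarith+
      then have "\<bar>x s\<bar> > 0" using eps by linarith
      moreover have "\<bar>sin (t s)\<bar> \<le> K * (2 * \<bar>x s\<bar>)"
      proof -
        have "K * (s - a) \<le> K * (2 * \<bar>x s\<bar>)" using xl K by (intro mult_left_mono) auto
        then show ?thesis using fin[OF s] by linarith
      qed
      ultimately have "\<bar>sin (t s)\<bar> / \<bar>x s\<bar> \<le> 2 * K" by (simp add: field_simps)
      then have "real l * (\<bar>sin (t s)\<bar> / \<bar>x s\<bar>) \<le> real l * (2 * K)"
        by (intro mult_left_mono) auto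
      then have 2: "\<bar>real l * sin (t s) / x s\<bar> \<le> real l * (2 * K)" by (simp add: abs_mult)
      have 3: "\<bar>real (l + m + 1) * H s\<bar> \<le> real (l + m + 1) * M"
        unfolding abs_mult using M[of s] s b by (intro mult_mono) auto
      have "real m * (1 / (\<bar>y0\<bar> / 2)) + real (l + m + 1) * M \<le> K" "real l * (2 * K) = 2 * real l * K"
        by (simp_all add: K_def)
      then show ?thesis unfolding turning_def using 1 2 3 by linarith
    qed
    have "controlled_on l m H a b (K + 2 * real l * K) (1 / 2) x y t"
      unfolding controlled_on_def
    proof (intro conjI ballI)
      fix s assume s: "s \<in> {a..b}"
      show "1 / 2 * (s - a) \<le> \<bar>y s\<bar>" using ylow[OF s] s b by auto
      show "1 / 2 * (s - a) \<le> \<bar>x s\<bar>" using conjunct2[OF fin[OF s]] eps by argo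
      show "(t has_real_derivative turning l m (H s) (x s) (y s) (t s)) (at s within {a..b})"
      proof (rule dt[OF s _ ylow[OF s]])
        show "\<epsilon> \<le> \<bar>x s\<bar>" using conjunct2[OF fin[OF s]] s by (simp, argo)
      qed
    qed (use dx dy tb in auto)
    then show ?thesis using i by (intro exI[of _ x] exI[of _ y] exI[of _ t]) simp
  qed
  have "\<exists>x y t. solution_on l m H a b x y t \<and> x a = 0 \<and> y a = y0 \<and> t a = t0"
  proof (rule solution_of_approximations[where al="1 / 2" and ?e0.0=1, OF H b(1) _ _ ex])
    show "admissible l m 0 y0 t0" using y0 t0 by (simp add: admissible_def)
  qed simp_all
  with b show ?thesis by blast
qed

section \<open>Departure from the origin\<close>

lemma on_cone:
  assumes e: "e > 0" and t: "(cos t)\<^sup>2 = cshare l m"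
  shows "rad (e * cos t) (e * sin t) = e" "cosp (e * cos t) (e * sin t) t = 1"
    "weight l m (e * cos t) (e * sin t) = wmax l m"
proof -
  have "(e * cos t)\<^sup>2 + (e * sin t)\<^sup>2 = e\<^sup>2 * ((cos t)\<^sup>2 + (sin t)\<^sup>2)" by (simp only: power_mult_distrib distrib_left)
  then have e2: "(e * cos t)\<^sup>2 + (e * sin t)\<^sup>2 = e\<^sup>2" by simp
  then show r: "rad (e * cos t) (e * sin t) = e" using e by (simp add: rad_def)
  have "e * cos t * cos t + e * sin t * sin t = e * ((cos t)\<^sup>2 + (sin t)\<^sup>2)"
    by (simp only: distrib_left power2_eq_square mult.assoc)
  then show "cosp (e * cos t) (e * sin t) t = 1" using e unfolding cosp_def r by simp
  have nz: "e * cos t \<noteq> 0 \<or> e * sin t \<noteq> 0" using e2 e by auto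
  have "share (e * cos t) (e * sin t) = cshare l m"
    unfolding share_def e2 using e t by (simp add: power_mult_distrib)
  then have "(weight l m (e * cos t) (e * sin t))\<^sup>2 = cshare l m ^ l * (1 - cshare l m) ^ m"
    using weight_sq[OF nz, of l m] by simp
  then show "weight l m (e * cos t) (e * sin t) = wmax l m"
    unfolding wmax_def by (metis real_sqrt_unique weight_nonneg)
qed

text \<open>On a solution started at distance \<open>\<epsilon>\<close> from the origin on the cone, where the energy is maximal,
  the energy can only decrease by an amount of order \<open>(\<epsilon> + s)\<^sup>2\<close>; hence the curve stays within
  distance of that order from the cone.\<close>

lemma depart_origin:
  assumes H: "continuous_on UNIV H" and lm: "l \<ge> 1" "m \<ge> 1" and t0: "(cos t0)\<^sup>2 = cshare l m"
  shows "\<exists>b>a. \<exists>x y t. solution_on l m H a b x y t \<and> x a = 0 \<and> y a = 0 \<and> t a = t0"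
proof -
  define N where "N = real (l + m + 1)"
  define w0 where "w0 = wmax l m"
  have w0: "w0 > 0" using wmax_pos[OF lm] by (simp add: w0_def)
  have N: "N > 0" by (simp add: N_def)
  obtain M where M0: "M \<ge> 0" and M: "\<And>s. s \<in> {a..a+1} \<Longrightarrow> \<bar>H s\<bar> \<le> M"
    using bounded_on_interval[OF H] by blast
  \<comment> \<open>Chosen so that an energy loss of \<open>N * M^2\<close> times a squared length
    \<open>d^2\<close> is at most \<open>w0 * (k1 * d)^2\<close>, which makes \<open>k1 * d\<close>
    the \<open>\<eta>\<close> of \<open>near_cone\<close>.\<close>
  define k1 where "k1 = sqrt (N / w0) * M + 1"
  have k1: "k1 > 0" unfolding k1_def using M0 w0 N by (intro add_nonneg_pos) auto
  have k1w: "N * M\<^sup>2 \<le> w0 * k1\<^sup>2"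
  proof -
    have "(sqrt (N / w0) * M)\<^sup>2 \<le> k1\<^sup>2" unfolding k1_def using M0 w0 N by (intro power_mono) auto
    then have "w0 * (N / w0 * M\<^sup>2) \<le> w0 * k1\<^sup>2"
      using w0 N by (intro mult_left_mono) (auto simp: power_mult_distrib)
    then show ?thesis using w0 by simp
  qed
  \<comment> \<open>Both \<open>\<epsilon>\<close> and the elapsed time are at most
    \<open>e0\<close>, hence \<open>\<eta> \<le> 2 * k1 * e0 = 1 / 2\<close>.\<close>
  define e0 where "e0 = 1 / (4 * k1)"
  define b where "b = a + min 1 e0"
  have e0: "e0 > 0" "k1 * e0 = 1 / 4" using k1 by (auto simp: e0_def)
  have b: "a < b" "b \<le> a + 1" "b - a \<le> e0" using e0 by (auto simp: b_def)
  define L where "L = coneK l m * (2 * k1) + N * M"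
  have ex: "\<exists>x y t. controlled_on l m H a b L (w0 / 4) x y t \<and>
      x a = 0 + \<epsilon> * cos t0 \<and> y a = 0 + \<epsilon> * sin t0 \<and> t a = t0" if eps: "0 < \<epsilon>" "\<epsilon> \<le> e0" for \<epsilon>
  proof -
    \<comment> \<open>Energy at least \<open>w0 / 2\<close> will give
      \<open>|x|, |y| \<ge> w0 / 2 * r\<close> with \<open>r \<ge> \<epsilon>\<close>, so the
      truncation never acts.\<close>
    define \<delta> where "\<delta> = w0 * \<epsilon> / 2"
    have \<delta>: "\<delta> > 0" using w0 eps by (simp add: \<delta>_def)
    obtain x y t where i: "x a = \<epsilon> * cos t0" "y a = \<epsilon> * sin t0" "t a = t0"
      and dx: "\<And>s. s \<in> {a..b} \<Longrightarrow> (x has_real_derivative cos (t s)) (at s within {a..b})"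
      and dy: "\<And>s. s \<in> {a..b} \<Longrightarrow> (y has_real_derivative sin (t s)) (at s within {a..b})"
      and dt: "\<And>s. s \<in> {a..b} \<Longrightarrow> \<delta> \<le> \<bar>x s\<bar> \<Longrightarrow> \<delta> \<le> \<bar>y s\<bar> \<Longrightarrow>
         (t has_real_derivative turning l m (H s) (x s) (y s) (t s)) (at s within {a..b})"
      and ct: "continuous_on {a..b} t"
      by (rule regularized_solution[OF H \<delta> \<delta> b(1), of "\<epsilon> * cos t0" "\<epsilon> * sin t0" t0 l m]) (assumption | rule that)+
    have cx: "continuous_on {a..b} x" and cy: "continuous_on {a..b} y"
      by (rule DERIV_continuous_on[OF dx] DERIV_continuous_on[OF dy], assumption)+
    define r where "r s = rad (x s) (y s)" for s
    define w where "w s = weight l m (x s) (y s)" for s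
    define C where "C s = cosp (x s) (y s) (t s)" for s
    have start: "r a = \<epsilon>" "C a = 1" "w a = w0"
      using on_cone[OF eps(1) t0] by (simp_all add: r_def C_def w_def i w0_def)
    \<comment> \<open>The condition that the energy is at least \<open>w0 / 2\<close>, multiplied by
      \<open>r^(l + m + 1)\<close> so that it is continuous even where the radius vanishes; the
      second entry keeps the radius positive.\<close>
    define g where "g s = min (\<bar>x s\<bar> ^ l * \<bar>y s\<bar> ^ m * (x s * cos (t s) + y s * sin (t s)) - w0 / 2 * r s ^ (l + m + 1))
      (r s - \<epsilon> / 2)" for s
    have wC: "\<bar>x s\<bar> ^ l * \<bar>y s\<bar> ^ m * (x s * cos (t s) + y s * sin (t s)) = w s * C s * r s ^ (l + m + 1)"
      if "r s > 0" for s
      using that by (simp add: w_def C_def weight_def cosp_def r_def)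
    have good: "\<epsilon> \<le> r v" "r v \<le> \<epsilon> + (v - a)" "w0 * (1 - (k1 * (\<epsilon> + (v - a)))\<^sup>2) \<le> w v * C v" "0 < C v"
       "w0 / 2 * r v \<le> \<bar>x v\<bar>" "w0 / 2 * r v \<le> \<bar>y v\<bar>"
      if v: "v \<in> {a..b}" and pos: "\<And>s. a \<le> s \<Longrightarrow> s \<le> v \<Longrightarrow> 0 \<le> g s" for v
    proof -
      have r0: "r s > 0" if "s \<in> {a..v}" for s
      proof -
        have "\<epsilon> / 2 \<le> r s" using pos[of s] that by (simp add: g_def)
        then show ?thesis using eps by linarith
      qed
      have E: "w0 / 2 \<le> w s * C s" if "s \<in> {a..v}" for s
      proof -
        have "w0 / 2 * r s ^ (l + m + 1) \<le> w s * C s * r s ^ (l + m + 1)"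
          using pos[of s] that wC[OF r0[OF that]] by (simp add: g_def)
        then show ?thesis using r0[OF that] by (simp add: mult_le_cancel_right)
      qed
      have C0: "0 < C s" and w: "w0 / 2 \<le> w s" if "s \<in> {a..v}" for s
      proof -
        have ws: "0 \<le> w s" by (simp add: w_def weight_nonneg)
        have "0 < w s * C s" using E[OF that] w0 by linarith
        then show "0 < C s" using ws by (auto simp: zero_less_mult_iff)
        have "w s * C s \<le> w s * 1" using ws abs_cosp_le_1[of "x s" "y s" "t s"] by (intro mult_left_mono) (auto simp: C_def)
        then show "w0 / 2 \<le> w s" using E[OF that] by linarith
      qed
      have n: "x s \<noteq> 0 \<or> y s \<noteq> 0" if "s \<in> {a..v}" for s
        using r0[OF that] by (simp add: r_def rad_pos_iff)
      have xy: "w0 / 2 * r s \<le> \<bar>x s\<bar>" "w0 / 2 * r s \<le> \<bar>y s\<bar>" if "s \<in> {a..v}" for s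
      proof -
        have "w s \<le> \<bar>x s\<bar> / r s * (\<bar>y s\<bar> / r s)" unfolding w_def r_def by (rule weight_le_abs[OF lm n[OF that]])
        moreover have "\<bar>x s\<bar> / r s * (\<bar>y s\<bar> / r s) \<le> \<bar>x s\<bar> / r s * 1" "\<bar>x s\<bar> / r s * (\<bar>y s\<bar> / r s) \<le> 1 * (\<bar>y s\<bar> / r s)"
          using abs_le_rad(1)[of "x s" "y s"] abs_le_rad(2)[of "y s" "x s"] r0[OF that]
          by (intro mult_left_mono mult_right_mono; simp add: r_def)+
        ultimately have "w0 / 2 \<le> \<bar>x s\<bar> / r s" "w0 / 2 \<le> \<bar>y s\<bar> / r s" using w[OF that] by linarith+
        then show "w0 / 2 * r s \<le> \<bar>x s\<bar>" "w0 / 2 * r s \<le> \<bar>y s\<bar>"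
          using r0[OF that] by (simp_all add: pos_le_divide_eq)
      qed
      have sub: "{a..v} \<subseteq> {a..b}" using v by auto
      have dr: "(r has_real_derivative C s) (at s within {a..u})" if "s \<in> {a..u}" "u \<le> v" for s u
        unfolding r_def[abs_def] C_def
        by (rule rad_has_derivative[OF DERIV_subset[OF dx] DERIV_subset[OF dy]]) (use that v n[of s] in auto)
      have rlow: "\<epsilon> \<le> r s" if "s \<in> {a..v}" for s
      proof -
        have "0 * (s - a) \<le> r s - r a"
          by (rule increase_of_derivative[OF dr[where u=s]]) (use that C0 in \<open>auto intro: less_imp_le\<close>)
        then show ?thesis using start by simp
      qed
      have rup: "r s \<le> \<epsilon> + (s - a)" if "s \<in> {a..v}" for s
      proof -
        have "\<bar>r s - r a\<bar> \<le> 1 * \<bar>s - a\<bar>"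
          by (rule lipschitz_of_derivative_bound[OF dr[where u=v]]) (use that abs_cosp_le_1 in \<open>auto simp: C_def\<close>)
        then show ?thesis using start that by simp
      qed
      have xyd: "\<delta> \<le> \<bar>x s\<bar>" "\<delta> \<le> \<bar>y s\<bar>" if "s \<in> {a..v}" for s
      proof -
        have "w0 / 2 * \<epsilon> \<le> w0 / 2 * r s" using rlow[OF that] w0 by (intro mult_left_mono) auto
        then show "\<delta> \<le> \<bar>x s\<bar>" "\<delta> \<le> \<bar>y s\<bar>" using xy[OF that] by (auto simp: \<delta>_def)
      qed
      have dE: "((\<lambda>s. w s * C s) has_real_derivative
           N * w s * ((sinp (x s) (y s) (t s))\<^sup>2 / r s + H s * sinp (x s) (y s) (t s))) (at s within {a..v})"
        if "s \<in> {a..v}" for s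
        unfolding w_def C_def r_def N_def
        by (rule energy_has_derivative[OF DERIV_subset[OF dx] DERIV_subset[OF dy] DERIV_subset[OF dt]])
          (use that sub xyd[OF that] \<delta> in auto)
      \<comment> \<open>The energy starts at its maximum \<open>w0\<close> and loses at most
        \<open>N * M^2 * r\<close> per unit length.\<close>
      have "- (N * M\<^sup>2 * (\<epsilon> + (v - a))) * (v - a) \<le> w v * C v - w a * C a"
      proof (rule increase_of_derivative[OF dE])
        fix s assume s: "a < s" "s < v"
        have "- (N * M\<^sup>2 * r s) \<le> N * w s * ((sinp (x s) (y s) (t s))\<^sup>2 / r s + H s * sinp (x s) (y s) (t s))"
          using s v b N r0[of s] M[of s] weight_nonneg weight_le_1
          by (intro energy_rate_lower) (auto simp: w_def)
        moreover have "N * M\<^sup>2 * r s \<le> N * M\<^sup>2 * (\<epsilon> + (v - a))"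
          using rup[of s] s N by (intro mult_left_mono) auto
        ultimately show "- (N * M\<^sup>2 * (\<epsilon> + (v - a))) \<le> N * w s * ((sinp (x s) (y s) (t s))\<^sup>2 / r s + H s * sinp (x s) (y s) (t s))"
          by linarith
      qed (use v in auto)
      moreover have "N * M\<^sup>2 * (\<epsilon> + (v - a)) * (v - a) \<le> w0 * (k1 * (\<epsilon> + (v - a)))\<^sup>2"
      proof -
        have "N * M\<^sup>2 * ((\<epsilon> + (v - a)) * (v - a)) \<le> w0 * k1\<^sup>2 * ((\<epsilon> + (v - a)) * (\<epsilon> + (v - a)))"
          using eps v w0 by (intro mult_mono[OF k1w]) auto
        then show ?thesis by (simp add: power_mult_distrib power2_eq_square mult_ac)
      qed
      ultimately have "w0 - w0 * (k1 * (\<epsilon> + (v - a)))\<^sup>2 \<le> w v * C v"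
        using start by simp
      then show "w0 * (1 - (k1 * (\<epsilon> + (v - a)))\<^sup>2) \<le> w v * C v" by (simp add: right_diff_distrib)
      show "\<epsilon> \<le> r v" "r v \<le> \<epsilon> + (v - a)" "0 < C v" "w0 / 2 * r v \<le> \<bar>x v\<bar>" "w0 / 2 * r v \<le> \<bar>y v\<bar>"
        using rlow rup C0 xy v by auto
    qed
    have eta: "0 \<le> k1 * (\<epsilon> + (v - a))" "(k1 * (\<epsilon> + (v - a)))\<^sup>2 \<le> 1 / 4" if "v \<in> {a..b}" for v
    proof -
      have "k1 * (\<epsilon> + (v - a)) \<le> k1 * (e0 + e0)" using that k1 eps b by (intro mult_left_mono) auto
      then have le: "k1 * (\<epsilon> + (v - a)) \<le> 1 / 2" using e0 by (simp add: distrib_left)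
      show ge: "0 \<le> k1 * (\<epsilon> + (v - a))" using k1 eps that by simp
      have "(k1 * (\<epsilon> + (v - a)))\<^sup>2 \<le> (1 / 2)\<^sup>2" using le ge by (intro power_mono)
      then show "(k1 * (\<epsilon> + (v - a)))\<^sup>2 \<le> 1 / 4" by (simp add: power2_eq_square)
    qed
    have boot: "g v > 0" if v: "a \<le> v" "v \<le> b" for v
    proof (rule bootstrap_pos[of a b g])
      show "continuous_on {a..b} g" unfolding g_def[abs_def] r_def rad_def
        by (intro continuous_intros cx cy ct)
      show "0 < g a" using wC[of a] start eps w0 by (simp add: g_def)
      fix v assume v: "a \<le> v" "v \<le> b" and pos: "\<And>s. a \<le> s \<Longrightarrow> s \<le> v \<Longrightarrow> 0 \<le> g s"
      have v': "v \<in> {a..b}" using v by simp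
      note gd = good[OF v' pos]
      have "w0 * (3 / 4) \<le> w0 * (1 - (k1 * (\<epsilon> + (v - a)))\<^sup>2)"
        using eta(2)[OF v'] w0 by (intro mult_left_mono) auto
      then have "w0 / 2 < w v * C v" using gd(3) w0 by linarith
      moreover have rv: "r v > 0" using gd(1) eps by simp
      ultimately have "w0 / 2 * r v ^ (l + m + 1) < w v * C v * r v ^ (l + m + 1)"
        by (intro mult_strict_right_mono) auto
      moreover have "\<epsilon> / 2 < r v" using gd(1) eps by linarith
      ultimately show "0 < g v" unfolding g_def wC[OF rv] by simp
    qed (use v in auto)
    have gd: "\<epsilon> \<le> r v" "r v \<le> \<epsilon> + (v - a)" "w0 * (1 - (k1 * (\<epsilon> + (v - a)))\<^sup>2) \<le> w v * C v" "0 < C v"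
       "w0 / 2 * r v \<le> \<bar>x v\<bar>" "w0 / 2 * r v \<le> \<bar>y v\<bar>" if v: "v \<in> {a..b}" for v
    proof -
      have p: "0 \<le> g s" if "a \<le> s" "s \<le> v" for s using boot[of s] that v by simp
      show "\<epsilon> \<le> r v" "r v \<le> \<epsilon> + (v - a)" "w0 * (1 - (k1 * (\<epsilon> + (v - a)))\<^sup>2) \<le> w v * C v" "0 < C v"
        "w0 / 2 * r v \<le> \<bar>x v\<bar>" "w0 / 2 * r v \<le> \<bar>y v\<bar>" by (rule good[OF v p], assumption+)+
    qed
    have fin: "0 < \<bar>x v\<bar>" "0 < \<bar>y v\<bar>" "\<delta> \<le> \<bar>x v\<bar>" "\<delta> \<le> \<bar>y v\<bar>" if "v \<in> {a..b}" for v
    proof -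
      have "w0 / 2 * \<epsilon> \<le> w0 / 2 * r v" using gd(1)[OF that] w0 by (intro mult_left_mono) auto
      then show "\<delta> \<le> \<bar>x v\<bar>" "\<delta> \<le> \<bar>y v\<bar>" using gd(5,6)[OF that] by (auto simp: \<delta>_def)
      then show "0 < \<bar>x v\<bar>" "0 < \<bar>y v\<bar>" using \<delta> by linarith+
    qed
    have C12: "1 / 2 \<le> C v" and tb: "\<bar>turning l m (H v) (x v) (y v) (t v)\<bar> \<le> coneK l m * (k1 * (\<epsilon> + (v - a))) / r v + N * \<bar>H v\<bar>"
      if v: "v \<in> {a..b}" for v
    proof -
      have E: "wmax l m * (1 - (k1 * (\<epsilon> + (v - a)))\<^sup>2) \<le> weight l m (x v) (y v) * \<bar>cosp (x v) (y v) (t v)\<bar>"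
        using gd(3,4)[OF v] by (simp add: w0_def w_def C_def)
      have n: "x v \<noteq> 0" "y v \<noteq> 0" using fin[OF v] by auto
      have e2: "(k1 * (\<epsilon> + (v - a)))\<^sup>2 \<le> 1 / 2" using eta(2)[OF v] by simp
      show "1 / 2 \<le> C v" using near_cone(3)[OF lm disjI1[OF n(1)] E eta(1)[OF v] e2] gd(4)[OF v] by (simp add: C_def)
      show "\<bar>turning l m (H v) (x v) (y v) (t v)\<bar> \<le> coneK l m * (k1 * (\<epsilon> + (v - a))) / r v + N * \<bar>H v\<bar>"
        unfolding N_def r_def by (rule turning_near_cone[OF lm n E eta(1)[OF v] e2])
    qed
    \<comment> \<open>\<open>r\<close> increases at rate at least \<open>1 / 2\<close>, so
      \<open>\<eta> / r \<le> 2 * k1\<close> and the turning is bounded uniformly in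
      \<open>\<epsilon>\<close>.\<close>
    have rhalf: "\<epsilon> + (v - a) \<le> 2 * r v" if v: "v \<in> {a..b}" for v
    proof -
      have dr: "(r has_real_derivative C s) (at s within {a..v})" if "s \<in> {a..v}" for s
        unfolding r_def[abs_def] C_def
        by (rule rad_has_derivative[OF DERIV_subset[OF dx] DERIV_subset[OF dy]]) (use that v fin[of s] in auto)
      have "1 / 2 * (v - a) \<le> r v - r a"
        by (rule increase_of_derivative[OF dr]) (use v C12 in auto)
      then show ?thesis using start eps by simp
    qed
    have "controlled_on l m H a b L (w0 / 4) x y t"
      unfolding controlled_on_def
    proof (intro conjI ballI)
      fix s assume s: "s \<in> {a..b}"
      show "(t has_real_derivative turning l m (H s) (x s) (y s) (t s)) (at s within {a..b})"
        by (intro dt s fin)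
      have r0: "r s > 0" using gd(1)[OF s] eps by linarith
      have "\<epsilon> + (s - a) \<le> 2 * r s" by (rule rhalf[OF s])
      then have "coneK l m * (k1 * (\<epsilon> + (s - a))) \<le> coneK l m * (k1 * (2 * r s))"
        using k1 coneK_nonneg[OF lm] by (intro mult_left_mono) auto
      then have "coneK l m * (k1 * (\<epsilon> + (s - a))) / r s \<le> coneK l m * (2 * k1)"
        using r0 by (simp add: pos_divide_le_eq mult_ac)
      moreover have "N * \<bar>H s\<bar> \<le> N * M" using M[of s] s b N by (intro mult_left_mono) auto
      ultimately show "\<bar>turning l m (H s) (x s) (y s) (t s)\<bar> \<le> L" using tb[OF s] unfolding L_def by linarith
      have "w0 / 4 * (s - a) \<le> w0 / 4 * (2 * r s)" using rhalf[OF s] eps w0 by (intro mult_left_mono) auto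
      also have "\<dots> = w0 / 2 * r s" by simp
      finally show "w0 / 4 * (s - a) \<le> \<bar>x s\<bar>" "w0 / 4 * (s - a) \<le> \<bar>y s\<bar>"
        using gd(5,6)[OF s] by linarith+
    qed (use dx dy in auto)
    then show ?thesis using i by (intro exI[of _ x] exI[of _ y] exI[of _ t]) simp
  qed
  have "\<exists>x y t. solution_on l m H a b x y t \<and> x a = 0 \<and> y a = 0 \<and> t a = t0"
  proof (rule solution_of_approximations[OF H b(1) _ e0(1) ex])
    show "admissible l m 0 0 t0" using t0 by (simp add: admissible_def)
  qed (use w0 in simp_all)
  with b show ?thesis by blast
qed

lemma depart:
  assumes H: "continuous_on UNIV H" and lm: "l \<ge> 1" "m \<ge> 1" and adm: "admissible l m x0 y0 t0"
  shows "\<exists>b>a. \<exists>x y t. solution_on l m H a b x y t \<and> x a = x0 \<and> y a = y0 \<and> t a = t0"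
proof (cases "x0 = 0"; cases "y0 = 0")
  assume "x0 \<noteq> 0" "y0 \<noteq> 0"
  then show ?thesis using depart_regular[OF H] by blast
next
  assume "x0 = 0" "y0 \<noteq> 0"
  then show ?thesis using depart_axis[OF H _ _ lm(1)] adm by (auto simp: admissible_def)
next
  assume "x0 = 0" "y0 = 0"
  then show ?thesis using depart_origin[OF H lm] adm by (auto simp: admissible_def)
next
  assume nz: "x0 \<noteq> 0" "y0 = 0"
  \<comment> \<open>A point with \<open>y0 = 0\<close> is reduced to the other axis by the swap,
    which changes the sign of \<open>H\<close>.\<close>
  have H': "continuous_on UNIV (\<lambda>s. - H s)" using H by (intro continuous_intros)
  have "sin (pi / 2 - t0) = 0" using nz adm by (simp add: admissible_def sin_diff)
  from depart_axis[OF H' nz(1) this lm(2), where a=a and m=l] obtain b x y t where b: "b > a"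
    and sol: "solution_on m l (\<lambda>s. - H s) a b x y t" and i: "x a = 0" "y a = x0" "t a = pi / 2 - t0"
    by blast
  have "solution_on l m H a b y x (\<lambda>s. pi / 2 - t s)"
    using solution_on_swap[OF lm(2,1) sol] by simp
  then show ?thesis using b i nz by (intro exI[of _ b] conjI exI[of _ y] exI[of _ x] exI[of _ "\<lambda>s. pi / 2 - t s"]) auto
qed

section \<open>Arrival at an admissible state\<close>

lemma limit_at_left_ge:
  fixes f :: "real \<Rightarrow> real"
  assumes "(f \<longlongrightarrow> v) (at_left T)" "s < T" "\<And>u. s < u \<Longrightarrow> u < T \<Longrightarrow> k \<le> f u"
  shows "k \<le> v"
  using assms(1)
proof (rule tendsto_lowerbound)
  show "\<forall>\<^sub>F u in at_left T. k \<le> f u"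
    unfolding eventually_at_left_field using assms by blast
qed simp

lemma limit_at_left_le:
  fixes f :: "real \<Rightarrow> real"
  assumes "(f \<longlongrightarrow> v) (at_left T)" "s < T" "\<And>u. s < u \<Longrightarrow> u < T \<Longrightarrow> f u \<le> k"
  shows "v \<le> k"
  using assms(1)
proof (rule tendsto_upperbound)
  show "\<forall>\<^sub>F u in at_left T. f u \<le> k"
    unfolding eventually_at_left_field using assms by blast
qed simp

section \<open>Solutions on a half-open interval and their limits away from the origin\<close>

locale half_open_solution =
  fixes l m :: nat and H :: "real \<Rightarrow> real" and a T :: real and x y t :: "real \<Rightarrow> real"
  assumes lm: "l \<ge> 1" "m \<ge> 1" and H: "continuous_on UNIV H" and aT: "a < T"
    and sol: "\<And>b. b < T \<Longrightarrow> solution_on l m H a b x y t"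
begin

lemma dx: "(x has_real_derivative cos (t s)) (at s)" and dy: "(y has_real_derivative sin (t s)) (at s)"
  and dt: "x s \<noteq> 0 \<Longrightarrow> y s \<noteq> 0 \<Longrightarrow> (t has_real_derivative turning l m (H s) (x s) (y s) (t s)) (at s)"
  if "a < s" "s < T"
proof -
  obtain b where b: "s < b" "b < T" using dense \<open>s < T\<close> by blast
  have eq: "at s within {a..b} = at s" and sb: "s \<in> {a..b}"
    using that b by (simp_all add: at_within_Icc_at)
  show "(x has_real_derivative cos (t s)) (at s)" "(y has_real_derivative sin (t s)) (at s)"
    "x s \<noteq> 0 \<Longrightarrow> y s \<noteq> 0 \<Longrightarrow> (t has_real_derivative turning l m (H s) (x s) (y s) (t s)) (at s)"
    using solution_onD[OF sol[OF b(2)] sb] unfolding eq by auto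
qed

lemma cont: assumes "a \<le> b" "c < T" shows "continuous_on {b..c} x" "continuous_on {b..c} y" "continuous_on {b..c} t"
proof -
  have s: "solution_on l m H b c x y t" using solution_on_subset[OF sol[OF assms(2)] assms(1) order_refl] .
  then show "continuous_on {b..c} t" by (simp add: solution_on_def)
  show "continuous_on {b..c} x" "continuous_on {b..c} y"
    using s unfolding solution_on_def by (auto intro: DERIV_continuous_on)
qed

lemma finite_zeros: "c < T \<Longrightarrow> finite {s \<in> {a..c}. x s * y s = 0}"
  using sol unfolding solution_on_def by blast

lemma bounded_H: obtains M where "M \<ge> 0" "\<And>s. a < s \<Longrightarrow> s < T \<Longrightarrow> \<bar>H s\<bar> \<le> M"
proof -
  obtain M where "M \<ge> 0" "\<And>s. s \<in> {a..T} \<Longrightarrow> \<bar>H s\<bar> \<le> M" using bounded_on_interval[OF H] by blast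
  then show thesis by (intro that[of M]) auto
qed

lemma swap: "half_open_solution m l (\<lambda>s. - H s) a T y x (\<lambda>s. pi / 2 - t s)"
  using lm aT H sol by unfold_locales (auto intro!: continuous_intros solution_on_swap)

lemma lipschitz: "\<bar>x u - x s\<bar> \<le> u - s" "\<bar>y u - y s\<bar> \<le> u - s" if "a \<le> s" "s \<le> u" "u < T"
proof -
  have s: "solution_on l m H s u x y t" using solution_on_subset[OF sol[OF that(3)] that(1) order_refl] .
  have "\<bar>x u - x s\<bar> \<le> 1 * \<bar>u - s\<bar>" "\<bar>y u - y s\<bar> \<le> 1 * \<bar>u - s\<bar>"
    using that lipschitz_of_derivative_bound[OF solution_onD(1)[OF s], of 1 s u]
      lipschitz_of_derivative_bound[OF solution_onD(2)[OF s], of 1 s u] by auto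
  then show "\<bar>x u - x s\<bar> \<le> u - s" "\<bar>y u - y s\<bar> \<le> u - s" using that by auto
qed

lemma x_limit: "\<exists>v. (x \<longlongrightarrow> v) (at_left T)" and y_limit: "\<exists>v. (y \<longlongrightarrow> v) (at_left T)"
  by (rule tendsto_at_left_of_bounded_derivative[OF aT, of _ 1], use dx dy in force)+

lemma t_limit:
  assumes "a \<le> c" "c < T"
    and "\<And>s. c < s \<Longrightarrow> s < T \<Longrightarrow> x s \<noteq> 0 \<and> y s \<noteq> 0 \<and> \<bar>turning l m (H s) (x s) (y s) (t s)\<bar> \<le> L"
  shows "\<exists>v. (t \<longlongrightarrow> v) (at_left T)"
proof (rule tendsto_at_left_of_bounded_derivative[OF assms(2)])
  fix s assume s: "c < s" "s < T"
  then show "\<exists>d. (t has_real_derivative d) (at s) \<and> \<bar>d\<bar> \<le> L"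
    using dt[of s] assms(3)[OF s] assms(1) by auto
qed

lemma limit_abs_le:
  assumes "(f \<longlongrightarrow> 0) (at_left T)" "\<And>u. s < u \<Longrightarrow> u < T \<Longrightarrow> \<bar>f u - f s\<bar> \<le> k" "s < T"
  shows "\<bar>f s :: real\<bar> \<le> k"
proof -
  have "((\<lambda>u. \<bar>f u - f s\<bar>) \<longlongrightarrow> \<bar>0 - f s\<bar>) (at_left T)" by (intro tendsto_intros assms)
  from limit_at_left_le[OF this assms(3,2)] show ?thesis by simp
qed

lemma distance_to_limit:
  assumes f: "(f \<longlongrightarrow> 0) (at_left T)" and s: "s < T"
    and lip: "\<And>u. s < u \<Longrightarrow> u < T \<Longrightarrow> \<bar>f u - f s\<bar> \<le> u - s"
  shows "\<bar>f s :: real\<bar> \<le> T - s"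
  using f _ s
proof (rule limit_abs_le)
  fix u assume u: "s < u" "u < T"
  then show "\<bar>f u - f s\<bar> \<le> T - s" using lip[OF u] by linarith
qed

lemma arrive_regular:
  assumes x1: "(x \<longlongrightarrow> x1) (at_left T)" and y1: "(y \<longlongrightarrow> y1) (at_left T)" and nz: "x1 \<noteq> 0" "y1 \<noteq> 0"
  shows "\<exists>t1. (t \<longlongrightarrow> t1) (at_left T)" "\<forall>\<^sub>F s in at_left T. x s \<noteq> 0 \<and> y s \<noteq> 0"
proof -
  obtain M where M: "M \<ge> 0" "\<And>s. a < s \<Longrightarrow> s < T \<Longrightarrow> \<bar>H s\<bar> \<le> M" using bounded_H by blast
  have "\<forall>\<^sub>F s in at_left T. \<bar>x1\<bar> / 2 < \<bar>x s\<bar>" "\<forall>\<^sub>F s in at_left T. \<bar>y1\<bar> / 2 < \<bar>y s\<bar>"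
    using nz order_tendstoD(1)[OF tendsto_rabs[OF x1], of "\<bar>x1\<bar> / 2"]
      order_tendstoD(1)[OF tendsto_rabs[OF y1], of "\<bar>y1\<bar> / 2"] by simp_all
  then have ev: "\<forall>\<^sub>F s in at_left T. \<bar>x1\<bar> / 2 < \<bar>x s\<bar> \<and> \<bar>y1\<bar> / 2 < \<bar>y s\<bar> \<and> a < s"
    using eventually_at_left_field aT by (auto simp: eventually_conj_iff)
  then show "\<forall>\<^sub>F s in at_left T. x s \<noteq> 0 \<and> y s \<noteq> 0" by eventually_elim auto
  from ev obtain c where c: "c < T" "\<And>s. c < s \<Longrightarrow> s < T \<Longrightarrow> \<bar>x1\<bar> / 2 < \<bar>x s\<bar> \<and> \<bar>y1\<bar> / 2 < \<bar>y s\<bar> \<and> a < s"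
    unfolding eventually_at_left_field by blast
  show "\<exists>t1. (t \<longlongrightarrow> t1) (at_left T)"
  proof (rule t_limit[of "max a c"])
    fix s assume "max a c < s" "s < T"
    then have s: "c < s" "s < T" "a < s" by auto
    have p: "0 < \<bar>x1\<bar> / 2" "0 < \<bar>y1\<bar> / 2" using nz by auto
    have "\<bar>real m * cos (t s) / y s\<bar> \<le> real m * (1 / (\<bar>y1\<bar> / 2))"
      "\<bar>real l * sin (t s) / x s\<bar> \<le> real l * (1 / (\<bar>x1\<bar> / 2))"
      by (rule quotient_bound[OF p(2)], use c(2)[OF s(1,2)] in simp, simp)
        (rule quotient_bound[OF p(1)], use c(2)[OF s(1,2)] in simp, simp)
    moreover have "\<bar>real (l + m + 1) * H s\<bar> \<le> real (l + m + 1) * M"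
      unfolding abs_mult using M(2)[of s] s by (intro mult_mono) auto
    ultimately show "x s \<noteq> 0 \<and> y s \<noteq> 0 \<and> \<bar>turning l m (H s) (x s) (y s) (t s)\<bar>
       \<le> real m * (1 / (\<bar>y1\<bar> / 2)) + real l * (1 / (\<bar>x1\<bar> / 2)) + real (l + m + 1) * M"
      unfolding turning_def using c(2)[OF s(1,2)] p by linarith
  qed (use aT c in auto)
qed

text \<open>Convexity of \<open>x\<^sup>2\<close> near the axis \<open>x = 0\<close> prevents the zeros of \<open>x\<close> from accumulating.\<close>

lemma arrive_axis:
  assumes x1: "(x \<longlongrightarrow> 0) (at_left T)" and y1: "(y \<longlongrightarrow> y1) (at_left T)" and nz: "y1 \<noteq> 0"
  shows "\<exists>t1. (t \<longlongrightarrow> t1) (at_left T) \<and> sin t1 = 0" "\<forall>\<^sub>F s in at_left T. x s \<noteq> 0 \<and> y s \<noteq> 0"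
proof -
  obtain M where M: "M \<ge> 0" "\<And>s. a < s \<Longrightarrow> s < T \<Longrightarrow> \<bar>H s\<bar> \<le> M" using bounded_H by blast
  define N where "N = real (l + m + 1)"
  define K where "K = real m * (1 / (\<bar>y1\<bar> / 2)) + N * M + 1"
  have K: "K > 0" unfolding K_def N_def using M by (intro add_nonneg_pos) auto
  have y2: "0 < \<bar>y1\<bar> / 2" using nz by simp
  have "\<forall>\<^sub>F s in at_left T. \<bar>y1\<bar> / 2 < \<bar>y s\<bar>"
    using nz order_tendstoD(1)[OF tendsto_rabs[OF y1], of "\<bar>y1\<bar> / 2"] by simp
  \<comment> \<open>With this bound \<open>x\<close> times the nonsingular part of the turning is at
    most \<open>1 / 2\<close>.\<close>
  moreover have "\<forall>\<^sub>F s in at_left T. \<bar>x s\<bar> < 1 / (2 * K)"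
    using order_tendstoD(2)[OF tendsto_rabs[OF x1], of "1 / (2 * K)"] K by simp
  moreover have "\<forall>\<^sub>F s in at_left T. a < s" using eventually_at_left_field aT by auto
  ultimately have "\<forall>\<^sub>F s in at_left T. \<bar>y1\<bar> / 2 < \<bar>y s\<bar> \<and> \<bar>x s\<bar> < 1 / (2 * K) \<and> a < s"
    by eventually_elim auto
  then obtain c0 where c0: "c0 < T" "\<And>s. c0 < s \<Longrightarrow> s < T \<Longrightarrow> \<bar>y1\<bar> / 2 < \<bar>y s\<bar> \<and> \<bar>x s\<bar> < 1 / (2 * K) \<and> a < s"
    unfolding eventually_at_left_field by blast
  define c where "c = max a c0"
  have c: "a \<le> c" "c < T" using c0 aT by (auto simp: c_def)
  have near: "\<bar>y1\<bar> / 2 < \<bar>y s\<bar>" "\<bar>x s\<bar> < 1 / (2 * K)" "a < s" "y s \<noteq> 0" if "c < s" "s < T" for s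
    using c0(2)[of s] that y2 by (auto simp: c_def)
  have rate: "\<bar>real m * cos (t s) / y s - N * H s\<bar> \<le> K" if s: "c < s" "s < T" for s
  proof -
    have "\<bar>real m * cos (t s) / y s\<bar> \<le> real m * (1 / (\<bar>y1\<bar> / 2))"
      by (rule quotient_bound) (use near[OF s] y2 in auto)
    moreover have "\<bar>N * H s\<bar> \<le> N * M"
      unfolding abs_mult N_def using M(2)[of s] near[OF s] s by (intro mult_mono) auto
    ultimately show ?thesis unfolding K_def by linarith
  qed
  \<comment> \<open>Half the derivative of \<open>x^2\<close>; its own derivative is at least
    \<open>cos^2 + l * sin^2 - 1 / 2 \<ge> 1 / 2\<close> off the zeros of \<open>x\<close>.\<close>
  define h where "h s = x s * cos (t s)" for s
  have hincr: "h s + (u - s) / 2 \<le> h u" if su: "c < s" "s < u" "u < T" for s u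
  proof -
    have "h s - s / 2 \<le> h u - u / 2"
    proof (rule mono_except_finite[where f="\<lambda>s. h s - s / 2" and F="{s \<in> {a..u}. x s * y s = 0}"])
      show "finite {s \<in> {a..u}. x s * y s = 0}" by (rule finite_zeros[OF su(3)])
      show "continuous_on {s..u} (\<lambda>s. h s - s / 2)"
        unfolding h_def using su c by (intro continuous_intros cont) auto
      fix v assume v: "s < v" "v < u" and "v \<notin> {s \<in> {a..u}. x s * y s = 0}"
      then have xv: "x v \<noteq> 0" and v': "a < v" "v < T" "c < v" using su c by auto
      have yv: "y v \<noteq> 0" using near[of v] v' by auto
      define d where "d = cos (t v) * cos (t v) - x v * (sin (t v) * turning l m (H v) (x v) (y v) (t v)) - 1 / 2"
      have "((\<lambda>s. h s - s / 2) has_real_derivative d) (at v)"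
        unfolding h_def d_def using v' xv yv
        by (auto intro!: derivative_eq_intros dx dt simp: algebra_simps)
      moreover have "0 \<le> d"
      proof -
        have "d = (cos (t v))\<^sup>2 + real l * (sin (t v))\<^sup>2 - x v * (sin (t v) * (real m * cos (t v) / y v - N * H v)) - 1 / 2"
          unfolding d_def turning_def N_def using xv by (simp add: field_simps power2_eq_square)
        moreover have "x v * (sin (t v) * (real m * cos (t v) / y v - N * H v)) \<le> 1 / 2"
        proof -
          have "\<bar>x v * (sin (t v) * (real m * cos (t v) / y v - N * H v))\<bar> \<le> 1 / (2 * K) * (1 * K)"
            unfolding abs_mult using near[of v] rate[of v] v' K by (intro mult_mono) auto
          then have "\<bar>x v * (sin (t v) * (real m * cos (t v) / y v - N * H v))\<bar> \<le> 1 / 2" using K by simp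
          then show ?thesis by (rule order_trans[OF abs_ge_self])
        qed
        moreover have "1 * (sin (t v))\<^sup>2 \<le> real l * (sin (t v))\<^sup>2" using lm by (intro mult_right_mono) auto
        ultimately show ?thesis using sin_cos_squared_add[of "t v"] by linarith
      qed
      ultimately show "\<exists>d\<ge>0. ((\<lambda>s. h s - s / 2) has_real_derivative d) (at v)" by blast
    qed (use su in auto)
    then show ?thesis by (simp add: field_simps)
  qed
  have null_mult: "((\<lambda>s. f s * g s) \<longlongrightarrow> 0) (at_left T)" if "(f \<longlongrightarrow> 0) (at_left T)" "\<And>s. \<bar>g s\<bar> \<le> 1" for f g :: "real \<Rightarrow> real"
  proof (rule Lim_null_comparison)
    show "\<forall>\<^sub>F s in at_left T. norm (f s * g s) \<le> \<bar>f s\<bar>"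
      using that(2) by (auto simp: abs_mult intro!: always_eventually mult_left_le)
    show "((\<lambda>s. \<bar>f s\<bar>) \<longlongrightarrow> 0) (at_left T)" using tendsto_rabs[OF that(1)] by simp
  qed
  \<comment> \<open>\<open>h\<close> tends to 0 at \<open>T\<close> while increasing with slope at
    least \<open>1 / 2\<close>, so it is negative before \<open>T\<close>.\<close>
  have hneg: "h s \<le> - ((T - s) / 2)" if s: "c < s" "s < T" for s
  proof -
    have "(h \<longlongrightarrow> 0) (at_left T)" unfolding h_def[abs_def] by (rule null_mult[OF x1]) auto
    then have "((\<lambda>u. h u - (u - s) / 2) \<longlongrightarrow> 0 - (T - s) / 2) (at_left T)"
      by (intro tendsto_intros) auto
    then have "h s \<le> 0 - (T - s) / 2"
      by (rule limit_at_left_ge[OF _ s(2)]) (use hincr s in \<open>auto simp: algebra_simps\<close>)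
    then show ?thesis by simp
  qed
  \<comment> \<open>A second integration; in particular \<open>x\<close> has no zeros left in
    \<open>(c, T)\<close>.\<close>
  have xsq: "(T - s)\<^sup>2 / 2 \<le> (x s)\<^sup>2" if s: "c < s" "s < T" for s
  proof -
    define q where "q v = (x v)\<^sup>2 - (T - v)\<^sup>2 / 2" for v
    have "(q \<longlongrightarrow> 0\<^sup>2 - (T - T)\<^sup>2 / 2) (at_left T)"
      unfolding q_def[abs_def] by (intro tendsto_intros x1) auto
    then have "((\<lambda>u. - q u) \<longlongrightarrow> - (0\<^sup>2 - (T - T)\<^sup>2 / 2)) (at_left T)" by (rule tendsto_minus)
    moreover have "- q s \<le> - q u" if u: "s < u" "u < T" for u
    proof (rule DERIV_nonneg_imp_nondecreasing[of s u "\<lambda>v. - q v"])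
      fix v assume v: "s \<le> v" "v \<le> u"
      then have v': "a < v" "v < T" "c < v" using s u near[of v] by auto
      have "((\<lambda>v. - q v) has_real_derivative - (2 * h v + (T - v))) (at v)"
        unfolding q_def h_def using v' by (auto intro!: derivative_eq_intros dx)
      moreover have "0 \<le> - (2 * h v + (T - v))" using hneg[of v] v' by (simp add: field_simps)
      ultimately show "\<exists>d. ((\<lambda>v. - q v) has_real_derivative d) (at v) \<and> 0 \<le> d" by blast
    qed (use u in auto)
    ultimately have "- q s \<le> - (0\<^sup>2 - (T - T)\<^sup>2 / 2)" by (rule limit_at_left_ge[OF _ s(2)])
    then show ?thesis by (simp add: q_def)
  qed
  have xlow: "(T - s) / 2 \<le> \<bar>x s\<bar>" if s: "c < s" "s < T" for s
  proof -
    have "((T - s) / 2)\<^sup>2 = (T - s)\<^sup>2 / 4" by (simp add: power_divide)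
    then have "((T - s) / 2)\<^sup>2 \<le> (x s)\<^sup>2" using xsq[OF s] zero_le_power2[of "T - s"] by linarith
    then have "\<bar>(T - s) / 2\<bar> \<le> \<bar>x s\<bar>" by (simp only: abs_le_square_iff)
    then show ?thesis using s by simp
  qed
  have xnz: "x s \<noteq> 0" if s: "c < s" "s < T" for s using xlow[OF s] s by auto
  have xup: "\<bar>x s\<bar> \<le> T - s" if s: "c < s" "s < T" for s
    by (rule distance_to_limit[OF x1 s(2)], rule lipschitz) (use near[OF s] in auto)
  have "\<forall>\<^sub>F s in at_left T. c < s \<and> s < T"
    unfolding eventually_at_left_field using c by blast
  then show "\<forall>\<^sub>F s in at_left T. x s \<noteq> 0 \<and> y s \<noteq> 0"
    by eventually_elim (use xnz near in auto)
  \<comment> \<open>\<open>|x|^l * sin t\<close> tends to 0 at \<open>T\<close> and is integrated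
    backwards from there; comparing \<open>|x|\<close> with \<open>T - s\<close> from both sides
    costs the factor \<open>2 ^ l\<close>.\<close>
  have sinb: "\<bar>sin (t s)\<bar> \<le> K * 2 ^ l * (T - s)" if s: "c < s" "s < T" for s
  proof -
    define F where "F s = \<bar>x s\<bar> ^ l * sin (t s)" for s
    have "((\<lambda>s. \<bar>x s\<bar> ^ l) \<longlongrightarrow> \<bar>0\<bar> ^ l) (at_left T)" by (intro tendsto_intros x1)
    then have "(F \<longlongrightarrow> 0) (at_left T)"
      unfolding F_def[abs_def] using lm by (intro null_mult) (auto simp: power_0_left)
    moreover have "\<bar>F u - F s\<bar> \<le> (T - s) ^ l * K * (T - s)" if u: "s < u" "u < T" for u
    proof -
      have "\<bar>F u - F s\<bar> \<le> (T - s) ^ l * K * \<bar>u - s\<bar>"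
      proof (rule lipschitz_of_derivative_bound)
        fix v assume v: "v \<in> {s..u}"
        then have v': "c < v" "v < T" "a < v" using s u near[of v] by auto
        show "(F has_real_derivative \<bar>x v\<bar> ^ l * (cos (t v) * (real m * cos (t v) / y v - N * H v))) (at v within {s..u})"
          unfolding F_def[abs_def] N_def
          by (rule axis_rate[OF DERIV_subset[OF dx] DERIV_subset[OF dt]])
            (use v' xnz near in auto)
        have "\<bar>x v\<bar> \<le> T - s" using xup[of v] v v' by auto
        then show "\<bar>\<bar>x v\<bar> ^ l * (cos (t v) * (real m * cos (t v) / y v - N * H v))\<bar> \<le> (T - s) ^ l * K"
          unfolding abs_mult power_abs abs_abs
          using rate[OF v'(1,2)] abs_cos_le_one[of "t v"] mult_mono[of "\<bar>cos (t v)\<bar>" 1 "\<bar>real m * cos (t v) / y v - N * H v\<bar>" K]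
          by (intro mult_mono power_mono) auto
      qed (use u in auto)
      also have "\<dots> \<le> (T - s) ^ l * K * (T - s)" using u K by (intro mult_left_mono) auto
      finally show ?thesis .
    qed
    ultimately have "\<bar>F s\<bar> \<le> (T - s) ^ l * K * (T - s)" by (rule limit_abs_le[OF _ _ s(2)])
    then have "\<bar>x s\<bar> ^ l * \<bar>sin (t s)\<bar> \<le> (T - s) ^ l * K * (T - s)" by (simp add: F_def abs_mult power_abs)
    moreover have "((T - s) / 2) ^ l * \<bar>sin (t s)\<bar> \<le> \<bar>x s\<bar> ^ l * \<bar>sin (t s)\<bar>"
      using xlow[OF s] s by (intro mult_right_mono power_mono) auto
    ultimately have "(T - s) ^ l * \<bar>sin (t s)\<bar> / 2 ^ l \<le> (T - s) ^ l * K * (T - s)"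
      unfolding power_divide times_divide_eq_left by linarith
    then have "(T - s) ^ l * \<bar>sin (t s)\<bar> \<le> (T - s) ^ l * (K * 2 ^ l * (T - s))"
      by (simp add: pos_divide_le_eq mult_ac)
    moreover have "(T - s) ^ l > 0" using s by simp
    ultimately show ?thesis by (rule mult_left_le_imp_le)
  qed
  have "\<exists>v. (t \<longlongrightarrow> v) (at_left T)"
  proof (rule t_limit[OF c])
    fix s assume s: "c < s" "s < T"
    have "\<bar>sin (t s)\<bar> \<le> K * 2 ^ l * (2 * \<bar>x s\<bar>)"
    proof -
      have "K * 2 ^ l * (T - s) \<le> K * 2 ^ l * (2 * \<bar>x s\<bar>)" using xlow[OF s] K by (intro mult_left_mono) auto
      then show ?thesis using sinb[OF s] by linarith
    qed
    then have "\<bar>sin (t s)\<bar> / \<bar>x s\<bar> \<le> K * 2 ^ l * 2" using xnz[OF s] by (simp add: field_simps)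
    then have "real l * (\<bar>sin (t s)\<bar> / \<bar>x s\<bar>) \<le> real l * (K * 2 ^ l * 2)" by (intro mult_left_mono) auto
    then have "\<bar>real l * sin (t s) / x s\<bar> \<le> real l * (K * 2 ^ l * 2)" by (simp add: abs_mult)
    then show "x s \<noteq> 0 \<and> y s \<noteq> 0 \<and> \<bar>turning l m (H s) (x s) (y s) (t s)\<bar> \<le> K + real l * (K * 2 ^ l * 2)"
      unfolding turning_def N_def[symmetric] using rate[OF s] xnz[OF s] near[OF s] by linarith
  qed
  then obtain t1 where t1: "(t \<longlongrightarrow> t1) (at_left T)" by blast
  have "((\<lambda>s. sin (t s)) \<longlongrightarrow> 0) (at_left T)"
  proof (rule Lim_null_comparison)
    have "\<forall>\<^sub>F s in at_left T. c < s \<and> s < T"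
      unfolding eventually_at_left_field using c by blast
    then show "\<forall>\<^sub>F s in at_left T. norm (sin (t s)) \<le> K * 2 ^ l * (T - s)"
      by eventually_elim (use sinb in auto)
    have "((\<lambda>s. K * 2 ^ l * (T - s)) \<longlongrightarrow> K * 2 ^ l * (T - T)) (at_left T)" by (intro tendsto_intros)
    then show "((\<lambda>s. K * 2 ^ l * (T - s)) \<longlongrightarrow> 0) (at_left T)" by simp
  qed
  moreover have "((\<lambda>s. sin (t s)) \<longlongrightarrow> sin t1) (at_left T)" by (intro tendsto_intros t1)
  ultimately have "sin t1 = 0" using tendsto_unique[of "at_left T"] by (metis trivial_limit_at_left_real)
  with t1 show "\<exists>t1. (t \<longlongrightarrow> t1) (at_left T) \<and> sin t1 = 0" by blast
qed

end

section \<open>Energy of a curve that meets the origin\<close>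

lemma weight_scale: "c > 0 \<Longrightarrow> weight l m (x / c) (y / c) = weight l m x y"
  and cosp_scale: "c > 0 \<Longrightarrow> cosp (x / c) (y / c) t = cosp x y t"
proof -
  assume c: "c > 0"
  have "(x / c)\<^sup>2 + (y / c)\<^sup>2 = (x\<^sup>2 + y\<^sup>2) / c\<^sup>2" by (simp add: power_divide add_divide_distrib)
  then have r: "rad (x / c) (y / c) = rad x y / c" using c by (simp add: rad_def real_sqrt_divide)
  show "weight l m (x / c) (y / c) = weight l m x y"
    using c by (simp add: weight_def r power_divide power_add)
  have "x / c * cos t + y / c * sin t = (x * cos t + y * sin t) / c" by (simp add: add_divide_distrib)
  then show "cosp (x / c) (y / c) t = cosp x y t"
    using c by (simp add: cosp_def r)
qed

lemma tendsto_rad [tendsto_intros]: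
  "(f \<longlongrightarrow> a) F \<Longrightarrow> (g \<longlongrightarrow> b) F \<Longrightarrow> ((\<lambda>s. rad (f s) (g s)) \<longlongrightarrow> rad a b) F"
  unfolding rad_def by (intro tendsto_intros)

lemma tendsto_weight_cosp:
  fixes f g h :: "real \<Rightarrow> real"
  assumes "(f \<longlongrightarrow> a) F" "(g \<longlongrightarrow> b) F" "(h \<longlongrightarrow> c) F" "a \<noteq> 0 \<or> b \<noteq> 0"
  shows "((\<lambda>s. weight l m (f s) (g s) * cosp (f s) (g s) (h s)) \<longlongrightarrow> weight l m a b * cosp a b c) F"
  unfolding weight_def cosp_def
  by (intro tendsto_intros assms(1,2) tendsto_cos[OF assms(3)] tendsto_sin[OF assms(3)]) (use assms(4) in \<open>auto simp: rad_eq_0_iff\<close>)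

context half_open_solution
begin

text \<open>The formulas for the derivatives exclude the axes, but the quantities themselves are
  continuous across them as long as the origin is avoided.\<close>

lemma energy_cont:
  assumes "a \<le> b" "c < T" "\<And>s. b \<le> s \<Longrightarrow> s \<le> c \<Longrightarrow> rad (x s) (y s) > 0"
  shows "continuous_on {b..c} (\<lambda>s. weight l m (x s) (y s) * cosp (x s) (y s) (t s))"
    and "continuous_on {b..c} (\<lambda>s. offset l m (x s) (y s) * sinp (x s) (y s) (t s))"
proof -
  have crad: "continuous_on {b..c} (\<lambda>s. rad (x s) (y s))"
    unfolding rad_def by (intro continuous_intros cont assms)
  have nz: "x s \<noteq> 0 \<or> y s \<noteq> 0" if "s \<in> {b..c}" for s using assms(3)[of s] that by (simp add: rad_pos_iff)
  show "continuous_on {b..c} (\<lambda>s. weight l m (x s) (y s) * cosp (x s) (y s) (t s))"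
    unfolding weight_def cosp_def
    by (intro continuous_intros cont assms crad) (use nz in \<open>auto simp: rad_eq_0_iff\<close>)
  show "continuous_on {b..c} (\<lambda>s. offset l m (x s) (y s) * sinp (x s) (y s) (t s))"
    unfolding offset_def share_def sinp_def
    by (intro continuous_intros cont assms crad) (use nz in \<open>auto simp: rad_eq_0_iff\<close>)
qed

lemma rad_DERIV:
  assumes "a < s" "s < T" "rad (x s) (y s) > 0"
  shows "((\<lambda>s. rad (x s) (y s)) has_real_derivative cosp (x s) (y s) (t s)) (at s)"
  using rad_has_derivative[where x=x and y=y and t=t and s=s and A=UNIV, OF dx dy] assms by (simp add: rad_pos_iff)

text \<open>The energy falls at rate at most \<open>(l + m + 1) * M^2 * rad\<close>; the axes are
  met only finitely often, and continuity covers those points.\<close>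

lemma energy_almost_increasing:
  assumes M: "\<And>s. a < s \<Longrightarrow> s < T \<Longrightarrow> \<bar>H s\<bar> \<le> M"
    and ab: "a < b" "b \<le> c" "c < T" and r: "\<And>s. b \<le> s \<Longrightarrow> s \<le> c \<Longrightarrow> 0 < rad (x s) (y s) \<and> rad (x s) (y s) \<le> R"
  shows "weight l m (x b) (y b) * cosp (x b) (y b) (t b) \<le>
    weight l m (x c) (y c) * cosp (x c) (y c) (t c) + real (l + m + 1) * M\<^sup>2 * R * (c - b)"
proof -
  define N where "N = real (l + m + 1)"
  define E where "E s = weight l m (x s) (y s) * cosp (x s) (y s) (t s)" for s
  have "E b + N * M\<^sup>2 * R * b \<le> E c + N * M\<^sup>2 * R * c"
  proof (rule mono_except_finite[where f="\<lambda>s. E s + N * M\<^sup>2 * R * s" and F="{s \<in> {a..c}. x s * y s = 0}"])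
    show "continuous_on {b..c} (\<lambda>s. E s + N * M\<^sup>2 * R * s)"
      unfolding E_def using ab r by (intro continuous_intros energy_cont) auto
    fix s assume s: "b < s" "s < c" "s \<notin> {s \<in> {a..c}. x s * y s = 0}"
    then have nz: "x s \<noteq> 0" "y s \<noteq> 0" and as: "a < s" "s < T" using ab by auto
    define d where "d = N * weight l m (x s) (y s) *
       ((sinp (x s) (y s) (t s))\<^sup>2 / rad (x s) (y s) + H s * sinp (x s) (y s) (t s))"
    have "(E has_real_derivative d) (at s)"
      unfolding E_def d_def N_def by (rule energy_has_derivative[OF dx dy dt]) (use nz as in auto)
    then have "((\<lambda>s. E s + N * M\<^sup>2 * R * s) has_real_derivative d + N * M\<^sup>2 * R) (at s)"
      by (auto intro!: derivative_eq_intros)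
    moreover have "- (N * M\<^sup>2 * rad (x s) (y s)) \<le> d"
      unfolding d_def by (rule energy_rate_lower) (use r[of s] s M[OF as] weight_nonneg weight_le_1 in \<open>auto simp: N_def\<close>)
    moreover have "N * M\<^sup>2 * rad (x s) (y s) \<le> N * M\<^sup>2 * R"
      using r[of s] s by (intro mult_left_mono) (auto simp: N_def)
    ultimately show "\<exists>d\<ge>0. ((\<lambda>s. E s + N * M\<^sup>2 * R * s) has_real_derivative d) (at s)"
      by (intro exI[of _ "d + N * M\<^sup>2 * R"]) auto
  qed (use finite_zeros ab in auto)
  then show ?thesis by (simp add: E_def N_def algebra_simps)
qed

text \<open>Positive energy means \<open>cosp > 0\<close>, that is an increasing radius, which
  cannot tend to 0.\<close>

lemma no_return:
  assumes ab: "a \<le> b" "b < c" "c \<le> T"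
    and pos: "\<And>s. b < s \<Longrightarrow> s < c \<Longrightarrow> 0 < rad (x s) (y s)"
    and E: "\<And>s. b < s \<Longrightarrow> s < c \<Longrightarrow> 0 < weight l m (x s) (y s) * cosp (x s) (y s) (t s)"
    and lim: "((\<lambda>s. rad (x s) (y s)) \<longlongrightarrow> 0) (at_left c)"
  shows False
proof -
  define d where "d = (b + c) / 2"
  have d: "b < d" "d < c" using ab by (auto simp: d_def)
  have "rad (x d) (y d) \<le> rad (x s) (y s)" if s: "d < s" "s < c" for s
  proof (rule DERIV_nonneg_imp_nondecreasing[of d s "\<lambda>s. rad (x s) (y s)"])
    fix u assume u: "d \<le> u" "u \<le> s"
    then have u': "b < u" "u < c" "a < u" "u < T" using s d ab by auto
    have "0 \<le> cosp (x u) (y u) (t u)"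
      using E[OF u'(1,2)] weight_nonneg[of l m "x u" "y u"] by (auto simp: zero_less_mult_iff)
    then show "\<exists>D. ((\<lambda>s. rad (x s) (y s)) has_real_derivative D) (at u) \<and> 0 \<le> D"
      using rad_DERIV[OF u'(3,4) pos[OF u'(1,2)]] by blast
  qed (use s in auto)
  then have "rad (x d) (y d) \<le> 0" by (intro limit_at_left_ge[OF lim d(2)])
  with pos[OF d] show False by simp
qed

text \<open>Blow-up at the origin: \<open>x / (s - b)\<close> and \<open>y / (s - b)\<close> tend to
  \<open>cos (t b)\<close> and \<open>sin (t b)\<close>, a point of the cone with radial tangent,
  and the energy is invariant under scaling of the position.\<close>

lemma energy_after_origin:
  assumes b: "a < b" "b < T" and zero: "x b = 0" "y b = 0"
  shows "((\<lambda>s. weight l m (x s) (y s) * cosp (x s) (y s) (t s)) \<longlongrightarrow> wmax l m) (at_right b)"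
proof -
  obtain c where c: "b < c" "c < T" using dense b by blast
  have adm: "(cos (t b))\<^sup>2 = cshare l m"
    using solution_onD(4)[OF sol[OF b(2)], of b] b zero by (auto simp: admissible_def)
  have q: "((\<lambda>s. f s / (s - b)) \<longlongrightarrow> D) (at_right b)"
    if "(f has_real_derivative D) (at b)" "f b = 0" for f and D :: real
  proof -
    have "((\<lambda>s. (f s - f b) / (s - b)) \<longlongrightarrow> D) (at b)"
      using that(1) by (simp add: has_field_derivative_iff)
    then show ?thesis using that(2) by (auto intro: tendsto_mono[OF at_le])
  qed
  have "continuous_on {b..c} t" using cont(3)[of b c] b c by auto
  then have tb: "(t \<longlongrightarrow> t b) (at_right b)" using c by (simp add: continuous_on_Icc_at_rightD)
  have "cos (t b) \<noteq> 0" using adm cshare_bounds(1)[OF lm] by auto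
  then have "((\<lambda>s. weight l m (x s / (s - b)) (y s / (s - b)) * cosp (x s / (s - b)) (y s / (s - b)) (t s))
      \<longlongrightarrow> weight l m (cos (t b)) (sin (t b)) * cosp (cos (t b)) (sin (t b)) (t b)) (at_right b)"
    using b zero by (intro tendsto_weight_cosp q tb dx dy) auto
  then have "((\<lambda>s. weight l m (x s / (s - b)) (y s / (s - b)) * cosp (x s / (s - b)) (y s / (s - b)) (t s))
      \<longlongrightarrow> wmax l m) (at_right b)"
    using on_cone(2,3)[OF zero_less_one adm, unfolded mult_1] by (simp only: mult_1_right)
  moreover have "\<forall>\<^sub>F s in at_right b. weight l m (x s / (s - b)) (y s / (s - b)) * cosp (x s / (s - b)) (y s / (s - b)) (t s)
     = weight l m (x s) (y s) * cosp (x s) (y s) (t s)"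
    unfolding eventually_at_filter
    by (intro always_eventually allI impI) (simp only: weight_scale cosp_scale greaterThan_iff diff_gt_0_iff_gt)
  ultimately show ?thesis by (rule Lim_transform_eventually)
qed

text \<open>The energy leaves the origin with its maximal value and cannot lose all of it within a
  short time, so the radius keeps increasing. Until \<open>c\<close> the radius is at most
  \<open>2 * (c - b)\<close>, whence the form of the smallness condition.\<close>

lemma no_quick_return:
  assumes M: "\<And>s. a < s \<Longrightarrow> s < T \<Longrightarrow> \<bar>H s\<bar> \<le> M"
    and b: "a < b" "b < c" "c \<le> T" and zero: "x b = 0" "y b = 0"
    and pos: "\<And>s. b < s \<Longrightarrow> s < c \<Longrightarrow> 0 < rad (x s) (y s)"
    and lim: "((\<lambda>s. rad (x s) (y s)) \<longlongrightarrow> 0) (at_left c)"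
    and small: "real (l + m + 1) * M\<^sup>2 * 2 * (c - b)\<^sup>2 < wmax l m"
  shows False
proof (rule no_return[OF less_imp_le[OF b(1)] b(2,3) pos _ lim])
  define E where "E s = weight l m (x s) (y s) * cosp (x s) (y s) (t s)" for s
  define k where "k = real (l + m + 1) * M\<^sup>2 * 2 * (c - b)\<^sup>2"
  fix s assume s: "b < s" "s < c"
  have "wmax l m \<le> E s + k"
  proof (rule tendsto_upperbound)
    show "(E \<longlongrightarrow> wmax l m) (at_right b)"
      unfolding E_def using b by (intro energy_after_origin zero) auto
    show "\<forall>\<^sub>F u in at_right b. E u \<le> E s + k"
      unfolding eventually_at_right_field
    proof (intro exI[of _ s] conjI allI impI)
      fix u assume u: "u > b" "u < s"
      have "E u \<le> E s + real (l + m + 1) * M\<^sup>2 * (2 * (c - b)) * (s - u)"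
        unfolding E_def
      proof (rule energy_almost_increasing[OF M])
        fix v assume v: "u \<le> v" "v \<le> s"
        have "rad (x v) (y v) \<le> \<bar>x v\<bar> + \<bar>y v\<bar>" unfolding rad_def by (rule sqrt_sum_squares_le_sum_abs)
        also have "\<dots> \<le> (v - b) + (v - b)"
          using lipschitz[of b v] v u s b zero by (intro add_mono) auto
        also have "\<dots> \<le> 2 * (c - b)" using v s by simp
        finally show "0 < rad (x v) (y v) \<and> rad (x v) (y v) \<le> 2 * (c - b)"
          using pos[of v] v u s by auto
      qed (use u s b in auto)
      also have "real (l + m + 1) * M\<^sup>2 * (2 * (c - b)) * (s - u) \<le> real (l + m + 1) * M\<^sup>2 * (2 * (c - b)) * (c - b)"
        using u s b by (intro mult_left_mono) auto
      also have "real (l + m + 1) * M\<^sup>2 * (2 * (c - b)) * (c - b) = k"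
        unfolding k_def power2_eq_square[of "c - b"] by (simp only: mult.assoc)
      finally show "E u \<le> E s + k" by simp
    qed (use s in simp)
  qed simp
  then show "0 < weight l m (x s) (y s) * cosp (x s) (y s) (t s)"
    using small by (simp add: E_def k_def)
qed

text \<open>By \<open>no_quick_return\<close> successive visits to the origin are separated by a
  definite time. The end \<open>T\<close> counts as a visit, so none can happen shortly before
  it.\<close>

lemma origin_isolated:
  assumes x0: "(x \<longlongrightarrow> 0) (at_left T)" and y0: "(y \<longlongrightarrow> 0) (at_left T)"
  obtains c where "a \<le> c" "c < T" "\<And>s. c < s \<Longrightarrow> s < T \<Longrightarrow> 0 < rad (x s) (y s)"
proof -
  obtain M where M: "M \<ge> 0" "\<And>s. a < s \<Longrightarrow> s < T \<Longrightarrow> \<bar>H s\<bar> \<le> M" using bounded_H by blast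
  define k where "k = real (l + m + 1) * M\<^sup>2 * 2"
  have k: "k \<ge> 0" by (simp add: k_def)
  have w: "wmax l m > 0" by (rule wmax_pos[OF lm])
  \<comment> \<open>\<open>\<delta> \<le> 1\<close> lets \<open>(k + 1) * \<delta>\<close> bound
    \<open>k * \<delta>^2\<close>, and \<open>k + 1\<close> avoids a division by 0.\<close>
  define \<delta> where "\<delta> = min 1 (wmax l m / (k + 1)) / 2"
  have \<delta>: "\<delta> > 0" "k * \<delta>\<^sup>2 < wmax l m"
  proof -
    show d0: "\<delta> > 0" using k w by (simp add: \<delta>_def)
    have "\<delta> \<le> 1" by (simp add: \<delta>_def)
    then have "\<delta>\<^sup>2 \<le> \<delta>" using d0 mult_left_le[of \<delta> \<delta>] by (simp add: power2_eq_square)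
    then have "k * \<delta>\<^sup>2 \<le> (k + 1) * \<delta>" using k d0 by (intro mult_mono) auto
    also have "\<dots> \<le> (k + 1) * (wmax l m / (k + 1) / 2)" using k unfolding \<delta>_def by (intro mult_left_mono divide_right_mono) auto
    also have "\<dots> = wmax l m / 2" using k by (simp add: field_simps)
    also have "\<dots> < wmax l m" using w by simp
    finally show "k * \<delta>\<^sup>2 < wmax l m" .
  qed
  have r0: "((\<lambda>s. rad (x s) (y s)) \<longlongrightarrow> 0) (at_left T)" using tendsto_rad[OF x0 y0] by (simp add: rad_def)
  define c where "c = max a (T - \<delta>)"
  have c: "a \<le> c" "c < T" "T - c \<le> \<delta>" using aT \<delta> by (auto simp: c_def)
  show thesis
  proof (rule that[OF c(1,2)])
    fix b assume b: "c < b" "b < T"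
    show "0 < rad (x b) (y b)"
    proof (rule ccontr)
      assume "\<not> 0 < rad (x b) (y b)"
      then have zero: "x b = 0" "y b = 0" by (auto simp: rad_pos_iff)
      have small: "real (l + m + 1) * M\<^sup>2 * 2 * (e - b)\<^sup>2 < wmax l m" if "b < e" "e \<le> T" for e
      proof -
        have "(e - b)\<^sup>2 \<le> \<delta>\<^sup>2" using that b c by (intro power_mono) auto
        then have "k * (e - b)\<^sup>2 \<le> k * \<delta>\<^sup>2" using k by (intro mult_left_mono)
        then show ?thesis using \<delta>(2) unfolding k_def by linarith
      qed
      have ab: "a < b" using b c by simp
      show False
      \<comment> \<open>The next visit after \<open>b\<close> is either \<open>T\<close> itself or
        the minimum of finitely many zeros.\<close>
      proof (cases "\<exists>e. b < e \<and> e < T \<and> x e = 0 \<and> y e = 0")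
        case False
        then show False
          using no_quick_return[OF M(2) ab b(2) order_refl zero _ r0 small[OF b(2) order_refl]]
          by (auto simp: rad_pos_iff)
      next
        case True
        then obtain e where e: "b < e" "e < T" "x e = 0" "y e = 0" by blast
        define Z where "Z = {s \<in> {a..e}. x s = 0 \<and> y s = 0 \<and> b < s}"
        have "finite Z" by (rule finite_subset[OF _ finite_zeros[OF e(2)]]) (auto simp: Z_def)
        moreover have "e \<in> Z" using e ab by (auto simp: Z_def)
        ultimately have f: "Min Z \<in> Z" "\<And>s. s \<in> Z \<Longrightarrow> Min Z \<le> s" by (auto intro: Min_in)
        define f where "f = Min Z"
        have f': "b < f" "f < T" "x f = 0" "y f = 0" using f(1) e by (auto simp: f_def Z_def)
        have p: "0 < rad (x s) (y s)" if "b < s" "s < f" for s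
          using f(2)[of s] that ab f(1) unfolding rad_pos_iff by (force simp: f_def Z_def)
        have "(x \<longlongrightarrow> x f) (at_left f)" "(y \<longlongrightarrow> y f) (at_left f)"
          using dx[of f] dy[of f] ab f' by (auto dest!: DERIV_isCont simp: isCont_def intro: tendsto_mono[OF at_le])
        then have "((\<lambda>s. rad (x s) (y s)) \<longlongrightarrow> 0) (at_left f)"
          using tendsto_rad[of x "x f" "at_left f" y "y f"] f' by (simp add: rad_def)
        then show False
          using no_quick_return[OF M(2) ab f'(1) less_imp_le[OF f'(2)] zero p _ small[OF f'(1) less_imp_le[OF f'(2)]]]
          by blast
      qed
    qed
  qed
qed

end

text \<open>The absolute value appears because the hypothesis does not tell the outgoing ray from
  the incoming one. As \<open>(share - cshare)^2 \<le> 1\<close>, the sum controls this square even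
  without its factor \<open>cosp^2\<close>.\<close>

lemma weight_cosp_tendsto_of_near_cone:
  assumes nz: "\<And>n. x n \<noteq> 0 \<or> y n \<noteq> 0"
    and lim: "(\<lambda>n::nat. (sinp (x n) (y n) (t n))\<^sup>2 + (share (x n) (y n) - cshare l m)\<^sup>2 * (cosp (x n) (y n) (t n))\<^sup>2) \<longlonglongrightarrow> 0"
  shows "(\<lambda>n. \<bar>weight l m (x n) (y n) * cosp (x n) (y n) (t n)\<bar>) \<longlonglongrightarrow> wmax l m"
proof -
  define S C d where "S n = sinp (x n) (y n) (t n)" and "C n = cosp (x n) (y n) (t n)"
    and "d n = share (x n) (y n) - cshare l m" for n
  define v where "v n = (S n)\<^sup>2 + (d n)\<^sup>2 * (C n)\<^sup>2" for n
  have v: "v \<longlonglongrightarrow> 0" using lim by (simp add: v_def[abs_def] S_def C_def d_def)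
  have CS: "(C n)\<^sup>2 + (S n)\<^sup>2 = 1" for n using polar_back(3)[OF nz] by (simp add: C_def S_def)
  have S2: "(\<lambda>n. (S n)\<^sup>2) \<longlonglongrightarrow> 0"
    by (rule Lim_null_comparison[OF _ v]) (auto simp: v_def intro!: always_eventually)
  have "(\<lambda>n. 1 - (S n)\<^sup>2) \<longlonglongrightarrow> 1 - 0" by (intro tendsto_intros S2)
  moreover have "1 - (S n)\<^sup>2 = (C n)\<^sup>2" for n using CS[of n] by simp
  ultimately have C2: "(\<lambda>n. (C n)\<^sup>2) \<longlonglongrightarrow> 1" by simp
  have "norm ((d n)\<^sup>2) \<le> v n" for n
  proof -
    have "0 \<le> cshare l m \<and> cshare l m \<le> 1" by (auto simp: cshare_def divide_le_eq_1)
    then have "\<bar>d n\<bar> \<le> 1" using share_bounds[of "x n" "y n"] by (auto simp: d_def)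
    then have "(d n)\<^sup>2 \<le> 1" by (simp add: abs_square_le_1)
    then have "(d n)\<^sup>2 * (S n)\<^sup>2 \<le> 1 * (S n)\<^sup>2" by (intro mult_right_mono) auto
    moreover have "(d n)\<^sup>2 * (C n)\<^sup>2 + (d n)\<^sup>2 * (S n)\<^sup>2 = (d n)\<^sup>2" using CS[of n] by (simp flip: distrib_left)
    ultimately show ?thesis by (simp add: v_def)
  qed
  then have "(\<lambda>n. (d n)\<^sup>2) \<longlonglongrightarrow> 0"
    by (intro Lim_null_comparison[OF _ v] always_eventually) auto
  then have "d \<longlonglongrightarrow> 0" by (simp add: tendsto_null_power)
  from tendsto_add[OF this tendsto_const[of "cshare l m"]]
  have a: "(\<lambda>n. share (x n) (y n)) \<longlonglongrightarrow> cshare l m" by (simp add: d_def)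
  have "(\<lambda>n. share (x n) (y n) ^ l * (1 - share (x n) (y n)) ^ m * (C n)\<^sup>2)
     \<longlonglongrightarrow> cshare l m ^ l * (1 - cshare l m) ^ m * 1"
    by (intro tendsto_intros a C2)
  then have "(\<lambda>n. sqrt ((weight l m (x n) (y n))\<^sup>2 * (C n)\<^sup>2)) \<longlonglongrightarrow> sqrt (cshare l m ^ l * (1 - cshare l m) ^ m * 1)"
    unfolding weight_sq[OF nz] by (rule tendsto_real_sqrt)
  then show ?thesis by (simp add: wmax_def C_def real_sqrt_mult abs_mult)
qed

section \<open>Arrival at the origin along the cone\<close>

context half_open_solution
begin

lemma distance_to_origin:
  assumes x0: "(x \<longlongrightarrow> 0) (at_left T)" and y0: "(y \<longlongrightarrow> 0) (at_left T)" and s: "a < s" "s < T"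
  shows "\<bar>x s\<bar> \<le> T - s" "\<bar>y s\<bar> \<le> T - s" "rad (x s) (y s) \<le> 2 * (T - s)"
proof -
  show x: "\<bar>x s\<bar> \<le> T - s" and y: "\<bar>y s\<bar> \<le> T - s"
    by (rule distance_to_limit[OF x0 s(2)] distance_to_limit[OF y0 s(2)], rule lipschitz, use s in auto)+
  have "rad (x s) (y s) \<le> \<bar>x s\<bar> + \<bar>y s\<bar>" unfolding rad_def by (rule sqrt_sum_squares_le_sum_abs)
  then show "rad (x s) (y s) \<le> 2 * (T - s)" using x y by argo
qed

text \<open>The energy corrected by a small multiple of \<open>offset * sinp\<close> grows at least like
  \<open>- ln (T - s)\<close> as long as the curve stays away from the cone, although it is bounded.\<close>

lemma near_cone_times:
  assumes x0: "(x \<longlongrightarrow> 0) (at_left T)" and y0: "(y \<longlongrightarrow> 0) (at_left T)"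
    and c: "a \<le> c" "c < T" and pos: "\<And>s. c < s \<Longrightarrow> s < T \<Longrightarrow> 0 < rad (x s) (y s)" and \<eta>: "\<eta> > 0"
  shows "\<exists>s. c < s \<and> s < T \<and>
    (sinp (x s) (y s) (t s))\<^sup>2 + (share (x s) (y s) - cshare l m)\<^sup>2 * (cosp (x s) (y s) (t s))\<^sup>2 < \<eta>"
proof (rule ccontr)
  assume "\<not> ?thesis"
  then have far: "\<eta> \<le> (sinp (x s) (y s) (t s))\<^sup>2 + (share (x s) (y s) - cshare l m)\<^sup>2 * (cosp (x s) (y s) (t s))\<^sup>2"
    if "c < s" "s < T" for s using that by force
  obtain M where M: "M \<ge> 0" "\<And>s. a < s \<Longrightarrow> s < T \<Longrightarrow> \<bar>H s\<bar> \<le> M" using bounded_H by blast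
  define N where "N = real (l + m + 1)"
  have N: "N > 0" by (simp add: N_def)
  obtain mu cc where mu: "mu > 0" and cc: "cc > 0"
    and coer0: "\<And>a w S C K. \<lbrakk>0 \<le> a; a \<le> 1; 0 \<le> w; w\<^sup>2 = a ^ l * (1 - a) ^ m; S\<^sup>2 + C\<^sup>2 = 1;
        K\<^sup>2 = a * (1 - a) * (a - cshare l m)\<^sup>2\<rbrakk> \<Longrightarrow>
      cc * (S\<^sup>2 + (a - cshare l m)\<^sup>2 * C\<^sup>2) \<le> real (l + m + 1) / 2 * w * S\<^sup>2 +
        mu * (S\<^sup>2 * (cshare l m * (1 - a) + (1 - cshare l m) * a - 4 * a * (1 - a))
          + real (l + m) * (a - cshare l m)\<^sup>2 * C\<^sup>2 - real (l + m + 1) * K * S * C)"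
    by (rule coercive[OF lm], rule that, assumption, assumption, assumption)
  note coer = coer0[folded N_def]
  \<comment> \<open>Absorbs the two curvature errors: that of the energy, with
    \<open>rad \<le> 2 * (T - a)\<close>, and that of the corrector.\<close>
  define D where "D = N * M\<^sup>2 * (2 * (T - a)) + mu * (N * M)"
  \<comment> \<open>The 2 comes from \<open>rad \<le> 2 * (T - s)\<close>: the coercive term is at
    least \<open>cc * \<eta> / rad \<ge> k / (T - s)\<close>.\<close>
  define k where "k = cc * \<eta> / 2"
  have k: "k > 0" using cc \<eta> by (simp add: k_def)
  define E where "E s = weight l m (x s) (y s) * cosp (x s) (y s) (t s)" for s
  define Z where "Z s = offset l m (x s) (y s) * sinp (x s) (y s) (t s)" for s
  \<comment> \<open>Away from the cone this function is nondecreasing, although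
    \<open>k * ln (T - s)\<close> tends to minus infinity and all other terms are bounded.\<close>
  define f where "f s = E s + mu * Z s + k * ln (T - s) + D * s" for s
  have incr: "f s0 \<le> f u" if su: "c < s0" "s0 \<le> u" "u < T" for s0 u
  proof (rule mono_except_finite[where f=f and a=s0 and b=u and F="{s \<in> {a..u}. x s * y s = 0}"])
    show "continuous_on {s0..u} f"
      unfolding f_def E_def Z_def using su c pos by (intro continuous_intros energy_cont) auto
    fix s assume s: "s0 < s" "s < u" "s \<notin> {s \<in> {a..u}. x s * y s = 0}"
    then have nz: "x s \<noteq> 0" "y s \<noteq> 0" and as: "a < s" "s < T" "c < s" using su c by auto
    define r S C A K w where "r = rad (x s) (y s)" and "S = sinp (x s) (y s) (t s)" and "C = cosp (x s) (y s) (t s)"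
      and "A = share (x s) (y s)" and "K = offset l m (x s) (y s)" and "w = weight l m (x s) (y s)"
    have r: "r > 0" "r \<le> 2 * (T - s)" using pos as distance_to_origin(3)[OF x0 y0 as(1,2)] by (auto simp: r_def)
    have Hs: "\<bar>H s\<bar> \<le> M" using M as by auto
    define Q where "Q = S\<^sup>2 * (cshare l m * (1 - A) + (1 - cshare l m) * A - 4 * A * (1 - A))
          + real (l + m) * (A - cshare l m)\<^sup>2 * C\<^sup>2 - N * K * S * C"
    define dE where "dE = N * w * (S\<^sup>2 / r + H s * S)"
    have "(E has_real_derivative dE) (at s)"
      unfolding E_def dE_def N_def w_def S_def r_def by (rule energy_has_derivative[OF dx dy dt]) (use nz as in auto)
    moreover have "(Z has_real_derivative Q / r - N * K * C * H s) (at s)"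
      unfolding Z_def Q_def N_def r_def
      by (rule corrector_has_derivative[where s=s and x=x and y=y and t=t, OF dx dy dt])
        (use nz as lm in \<open>auto simp: A_def C_def S_def K_def\<close>)
    ultimately have "(f has_real_derivative dE + mu * (Q / r - N * K * C * H s) - k / (T - s) + D) (at s)"
      unfolding f_def using as by (auto intro!: derivative_eq_intros simp: field_simps)
    moreover have "0 \<le> dE + mu * (Q / r - N * K * C * H s) - k / (T - s) + D"
    proof -
      have 1: "N / 2 * w * S\<^sup>2 / r - N * M\<^sup>2 * r \<le> dE"
        unfolding dE_def by (rule energy_rate_lower) (use r Hs N weight_nonneg weight_le_1 in \<open>auto simp: w_def\<close>)
      have "S\<^sup>2 + C\<^sup>2 = 1" using polar_back(3)[OF disjI1[OF nz(1)], of "y s" "t s"] by (simp add: S_def C_def)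
      then have "cc * (S\<^sup>2 + (A - cshare l m)\<^sup>2 * C\<^sup>2) \<le> N / 2 * w * S\<^sup>2 + mu * Q"
        unfolding Q_def
        by (intro coer) (use share_bounds weight_nonneg weight_sq[OF disjI1[OF nz(1)]] offset_sq[OF disjI1[OF nz(1)]]
          in \<open>auto simp: A_def w_def K_def\<close>)
      moreover have "cc * \<eta> \<le> cc * (S\<^sup>2 + (A - cshare l m)\<^sup>2 * C\<^sup>2)"
        using far[OF as(3,2)] cc by (intro mult_left_mono) (auto simp: S_def A_def C_def)
      ultimately have "cc * \<eta> / r \<le> (N / 2 * w * S\<^sup>2 + mu * Q) / r" using r by (intro divide_right_mono) auto
      moreover have "k / (T - s) \<le> cc * \<eta> / r"
      proof -
        have "cc * \<eta> / (2 * (T - s)) \<le> cc * \<eta> / r" using r cc \<eta> as by (intro divide_left_mono) auto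
        then show ?thesis by (simp add: k_def)
      qed
      ultimately have 2: "k / (T - s) \<le> N / 2 * w * S\<^sup>2 / r + mu * (Q / r)" by (simp add: add_divide_distrib)
      have "\<bar>N * K * C * H s\<bar> \<le> N * 1 * 1 * M"
        unfolding abs_mult using N Hs abs_offset_le_1 abs_cosp_le_1 by (intro mult_mono) (auto simp: K_def C_def)
      then have "N * K * C * H s \<le> N * M" by simp
      then have 3: "mu * (N * K * C * H s) \<le> mu * (N * M)" using mu by (intro mult_left_mono) auto
      have 4: "N * M\<^sup>2 * r \<le> N * M\<^sup>2 * (2 * (T - a))" using r as N by (intro mult_left_mono) auto
      show ?thesis using 1 2 3 4 unfolding D_def right_diff_distrib by linarith
    qed
    ultimately show "\<exists>d\<ge>0. (f has_real_derivative d) (at s)" by blast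
  qed (use finite_zeros su in auto)
  have b1: "\<bar>E s\<bar> \<le> 1" for s
    unfolding E_def abs_mult using weight_le_1 weight_nonneg abs_cosp_le_1 by (intro mult_le_one) auto
  have b2: "\<bar>Z s\<bar> \<le> 1" for s
    unfolding Z_def abs_mult using abs_offset_le_1 abs_sinp_le_1 by (intro mult_le_one) auto
  have b3: "\<bar>mu * Z s\<bar> \<le> mu" for s using b2[of s] mu by (simp add: abs_mult)
  have D: "D \<ge> 0" unfolding D_def using N mu M aT by (intro add_nonneg_nonneg mult_nonneg_nonneg) auto
  define s0 where "s0 = (c + T) / 2"
  have s0: "c < s0" "s0 < T" using c by (auto simp: s0_def)
  \<comment> \<open>\<open>B\<close> bounds the increase of the other terms from \<open>s0\<close>
    to any later time; \<open>u\<close> is so close to \<open>T\<close> that the logarithmic term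
    drops by \<open>k * q = B + 1\<close>.\<close>
  define B where "B = 2 + 2 * mu + D * (T - s0)"
  have B: "B \<ge> 0" using D mu s0 by (simp add: B_def)
  define q where "q = (B + 1) / k"
  have q: "q > 0" using B k by (simp add: q_def)
  define u where "u = T - (T - s0) * exp (- q)"
  have u: "s0 \<le> u" "u < T" "ln (T - u) = ln (T - s0) - q"
  proof -
    have "(T - s0) * exp (- q) \<le> (T - s0) * 1" using q s0 by (intro mult_left_mono) auto
    then show "s0 \<le> u" by (simp add: u_def)
    show "u < T" using s0 by (simp add: u_def)
    show "ln (T - u) = ln (T - s0) - q" using s0 by (simp add: u_def ln_mult)
  qed
  have "E s0 + mu * Z s0 + k * ln (T - s0) + D * s0 \<le> E u + mu * Z u + (k * ln (T - s0) - k * q) + D * u"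
    using incr[OF s0(1) u(1,2)] by (simp add: f_def u(3) right_diff_distrib)
  moreover have "D * u - D * s0 \<le> D * (T - s0)" using D u by (simp flip: right_diff_distrib add: mult_left_mono)
  ultimately have "k * q \<le> B"
    using b1[of s0] b1[of u] b3[of s0] b3[of u] unfolding B_def abs_le_iff by linarith
  then show False using k by (simp add: q_def)
qed

text \<open>Otherwise the energy stays above \<open>- wmax + \<gamma>\<close> from \<open>s\<close>
  on, with \<open>\<gamma> > 0\<close>. At times close to \<open>T\<close> where the curve is near
  the cone it must then be close to \<open>wmax\<close> instead, so it remains positive and
  \<open>no_return\<close> applies.\<close>

lemma energy_before_origin:
  assumes x0: "(x \<longlongrightarrow> 0) (at_left T)" and y0: "(y \<longlongrightarrow> 0) (at_left T)"
    and c: "a \<le> c" "c < T" and pos: "\<And>s. c < s \<Longrightarrow> s < T \<Longrightarrow> 0 < rad (x s) (y s)"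
    and M: "\<And>s. a < s \<Longrightarrow> s < T \<Longrightarrow> \<bar>H s\<bar> \<le> M" and s: "c < s" "s < T"
  shows "weight l m (x s) (y s) * cosp (x s) (y s) (t s) \<le> - wmax l m + real (l + m + 1) * M\<^sup>2 * 2 * (T - s)\<^sup>2"
proof (rule ccontr)
  define K where "K = real (l + m + 1) * M\<^sup>2 * 2"
  define E where "E s = weight l m (x s) (y s) * cosp (x s) (y s) (t s)" for s
  define w0 where "w0 = wmax l m"
  have w0: "w0 > 0" using wmax_pos[OF lm] by (simp add: w0_def)
  have K: "K \<ge> 0" by (simp add: K_def)
  assume "\<not> ?thesis"
  then have neg: "- w0 + K * (T - s)\<^sup>2 < E s" by (simp add: K_def E_def w0_def)
  have almost: "E b - K * (T - b)\<^sup>2 \<le> E u" if b: "c < b" "b \<le> u" "u < T" for b u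
  proof -
    have "E b \<le> E u + real (l + m + 1) * M\<^sup>2 * (2 * (T - b)) * (u - b)"
      unfolding E_def
    proof (rule energy_almost_increasing[OF M])
      fix v assume v: "b \<le> v" "v \<le> u"
      then have "rad (x v) (y v) \<le> 2 * (T - v)" using b c by (intro distance_to_origin x0 y0) auto
      then show "0 < rad (x v) (y v) \<and> rad (x v) (y v) \<le> 2 * (T - b)" using v b pos[of v] by auto
    qed (use b c in auto)
    also have "real (l + m + 1) * M\<^sup>2 * (2 * (T - b)) * (u - b) \<le> real (l + m + 1) * M\<^sup>2 * (2 * (T - b)) * (T - b)"
      using b by (intro mult_left_mono) auto
    also have "real (l + m + 1) * M\<^sup>2 * (2 * (T - b)) * (T - b) = K * (T - b)\<^sup>2"
      unfolding K_def power2_eq_square[of "T - b"] by (simp only: mult.assoc)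
    finally show ?thesis by simp
  qed
  define \<gamma> where "\<gamma> = E s - K * (T - s)\<^sup>2 + w0"
  have \<gamma>: "\<gamma> > 0" using neg by (simp add: \<gamma>_def)
  have low: "- w0 + \<gamma> \<le> E u" if "s \<le> u" "u < T" for u using almost[OF s(1) that] by (simp add: \<gamma>_def)
  \<comment> \<open>Forces the times \<open>p n\<close> to converge to \<open>T\<close>.\<close>
  define c' where "c' n = max s (T - inverse (real (Suc n)))" for n :: nat
  have c': "a \<le> c' n" "c' n < T" "c \<le> c' n" for n using s c by (auto simp: c'_def)
  have "\<exists>u. c' n < u \<and> u < T \<and>
    (sinp (x u) (y u) (t u))\<^sup>2 + (share (x u) (y u) - cshare l m)\<^sup>2 * (cosp (x u) (y u) (t u))\<^sup>2 < inverse (real (Suc n))" for n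
    using c'[of n] pos by (intro near_cone_times x0 y0) auto
  then obtain p where p: "\<And>n. c' n < p n" "\<And>n. p n < T" and pc:
    "\<And>n. (sinp (x (p n)) (y (p n)) (t (p n)))\<^sup>2 + (share (x (p n)) (y (p n)) - cshare l m)\<^sup>2 * (cosp (x (p n)) (y (p n)) (t (p n)))\<^sup>2
       < inverse (real (Suc n))"
    by metis
  have ps: "s < p n" "c < p n" "T - inverse (real (Suc n)) < p n" for n using p(1)[of n] s by (auto simp: c'_def)
  have "(\<lambda>n. (sinp (x (p n)) (y (p n)) (t (p n)))\<^sup>2 + (share (x (p n)) (y (p n)) - cshare l m)\<^sup>2 * (cosp (x (p n)) (y (p n)) (t (p n)))\<^sup>2)
     \<longlonglongrightarrow> 0"
    by (rule Lim_null_comparison[OF _ LIMSEQ_inverse_real_of_nat])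
      (use pc in \<open>auto intro!: always_eventually less_imp_le\<close>)
  then have "(\<lambda>n. \<bar>E (p n)\<bar>) \<longlonglongrightarrow> w0"
    unfolding E_def w0_def using pos[OF ps(2) p(2)]
    by (intro weight_cosp_tendsto_of_near_cone) (auto simp: rad_pos_iff)
  then have ev1: "\<forall>\<^sub>F n in sequentially. max (w0 - \<gamma>) (w0 / 2) < \<bar>E (p n)\<bar>"
    using w0 \<gamma> by (intro order_tendstoD(1)) auto
  have "(\<lambda>n. K * (inverse (real (Suc n)))\<^sup>2) \<longlonglongrightarrow> K * 0\<^sup>2"
    by (intro tendsto_intros LIMSEQ_inverse_real_of_nat)
  then have ev2: "\<forall>\<^sub>F n in sequentially. K * (inverse (real (Suc n)))\<^sup>2 < w0 / 2"
    using w0 by (intro order_tendstoD(2)) auto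
  obtain n where n: "max (w0 - \<gamma>) (w0 / 2) < \<bar>E (p n)\<bar>" "K * (inverse (real (Suc n)))\<^sup>2 < w0 / 2"
    using eventually_happens[OF eventually_conj[OF ev1 ev2]] by auto
  \<comment> \<open>\<open>|E| > w0 - \<gamma>\<close> together with
    \<open>E \<ge> - w0 + \<gamma>\<close> excludes a negative sign.\<close>
  have En: "w0 / 2 < E (p n)" using n(1) low[of "p n"] ps[of n] p[of n] by (auto simp: abs_if split: if_splits)
  have "K * (T - p n)\<^sup>2 \<le> K * (inverse (real (Suc n)))\<^sup>2"
    using K ps(3)[of n] p(2)[of n] by (intro mult_left_mono power_mono) auto
  then have pos': "0 < E u" if "p n \<le> u" "u < T" for u
    using almost[OF ps(2) that] En n(2) by linarith
  show False
  proof (rule no_return[of "p n" T])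
    show "((\<lambda>s. rad (x s) (y s)) \<longlongrightarrow> 0) (at_left T)" using tendsto_rad[OF x0 y0] by (simp add: rad_def)
    show "a \<le> p n" using ps(2)[of n] c by simp
    show "0 < rad (x u) (y u)" if "p n < u" "u < T" for u using pos[of u] ps(2)[of n] that by simp
    show "0 < weight l m (x u) (y u) * cosp (x u) (y u) (t u)" if "p n < u" "u < T" for u
      using pos'[of u] that by (simp add: E_def)
  qed (use p in auto)
qed

text \<open>The energy is within a quadratic error in \<open>T - s\<close> of its minimum, so the
  deviation from the cone is of first order in \<open>T - s\<close>. It compensates the singularity
  of the turning once \<open>rad\<close> is known to be at least \<open>(T - s) / 2\<close>.\<close>

lemma arrive_origin:
  assumes x0: "(x \<longlongrightarrow> 0) (at_left T)" and y0: "(y \<longlongrightarrow> 0) (at_left T)"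
  shows "\<exists>t1. (t \<longlongrightarrow> t1) (at_left T) \<and> (cos t1)\<^sup>2 = cshare l m" "\<forall>\<^sub>F s in at_left T. x s \<noteq> 0 \<and> y s \<noteq> 0"
proof -
  obtain M where M: "M \<ge> 0" "\<And>s. a < s \<Longrightarrow> s < T \<Longrightarrow> \<bar>H s\<bar> \<le> M" using bounded_H by blast
  obtain c0 where c0: "a \<le> c0" "c0 < T" and pos: "\<And>s. c0 < s \<Longrightarrow> s < T \<Longrightarrow> 0 < rad (x s) (y s)"
    using origin_isolated[OF x0 y0] by blast
  define N where "N = real (l + m + 1)"
  define w0 where "w0 = wmax l m"
  have w0: "w0 > 0" using wmax_pos[OF lm] by (simp add: w0_def)
  have N: "N > 0" by (simp add: N_def)
  \<comment> \<open>Chosen so that the energy error is at most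
    \<open>w0 * (k * (T - s))^2\<close>.\<close>
  define k where "k = sqrt (N * M\<^sup>2 * 2 / w0) + 1"
  have k: "k > 0" using N w0 by (simp add: k_def add_nonneg_pos)
  have kw: "N * M\<^sup>2 * 2 \<le> w0 * k\<^sup>2"
  proof -
    have "(sqrt (N * M\<^sup>2 * 2 / w0))\<^sup>2 \<le> k\<^sup>2" unfolding k_def using N w0 by (intro power_mono) auto
    then have "w0 * (N * M\<^sup>2 * 2 / w0) \<le> w0 * k\<^sup>2" using N w0 by (intro mult_left_mono) auto
    then show ?thesis using w0 by simp
  qed
  define c where "c = max c0 (T - 1 / (2 * k))"
  have c: "a \<le> c" "c < T" "c0 \<le> c" using c0 k by (auto simp: c_def)
  define C where "C s = cosp (x s) (y s) (t s)" for s
  define w where "w s = weight l m (x s) (y s)" for s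
  have \<eta>: "0 \<le> k * (T - s)" "(k * (T - s))\<^sup>2 \<le> 1 / 2" if s: "c < s" "s < T" for s
  proof -
    show 1: "0 \<le> k * (T - s)" using k s by simp
    have "T - s \<le> 1 / (2 * k)" using s by (auto simp: c_def)
    then have "k * (T - s) \<le> k * (1 / (2 * k))" using k by (intro mult_left_mono) auto
    then have "k * (T - s) \<le> 1 / 2" using k by simp
    then have "(k * (T - s))\<^sup>2 \<le> (1 / 2)\<^sup>2" using 1 by (intro power_mono)
    then show "(k * (T - s))\<^sup>2 \<le> 1 / 2" by (simp add: power_divide)
  qed
  have E: "wmax l m * (1 - (k * (T - s))\<^sup>2) \<le> w s * \<bar>C s\<bar>" "C s < 0" if s: "c < s" "s < T" for s
  proof -
    have "w s * C s \<le> - w0 + N * M\<^sup>2 * 2 * (T - s)\<^sup>2"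
      using energy_before_origin[OF x0 y0 c0(1,2) pos M(2), of s] s c by (simp add: w_def C_def w0_def N_def)
    also have "N * M\<^sup>2 * 2 * (T - s)\<^sup>2 \<le> w0 * k\<^sup>2 * (T - s)\<^sup>2" using kw by (intro mult_right_mono) auto
    also have "- w0 + w0 * k\<^sup>2 * (T - s)\<^sup>2 = - (w0 * (1 - (k * (T - s))\<^sup>2))" by algebra
    finally have le: "w s * C s \<le> - (w0 * (1 - (k * (T - s))\<^sup>2))" by simp
    have "w0 * (1 / 2) \<le> w0 * (1 - (k * (T - s))\<^sup>2)" using \<eta>[OF s] w0 by (intro mult_left_mono) auto
    then have "w s * C s < 0" using le w0 by linarith
    then show C: "C s < 0" using weight_nonneg[of l m "x s" "y s"] by (auto simp: w_def mult_less_0_iff)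
    show "wmax l m * (1 - (k * (T - s))\<^sup>2) \<le> w s * \<bar>C s\<bar>" using le C by (simp add: w0_def)
  qed
  have or: "x s \<noteq> 0 \<or> y s \<noteq> 0" if s: "c < s" "s < T" for s using pos[of s] s c by (simp add: rad_pos_iff)
  note nc = near_cone[OF lm or E(1)[unfolded w_def C_def] \<eta>]
  have nz: "x s \<noteq> 0" "y s \<noteq> 0" if s: "c < s" "s < T" for s
  proof -
    have "0 < weight l m (x s) (y s)" using nc(4)[OF s s s s] w0 by (simp add: w0_def)
    also have "\<dots> \<le> \<bar>x s\<bar> / rad (x s) (y s) * (\<bar>y s\<bar> / rad (x s) (y s))" by (rule weight_le_abs[OF lm or[OF s]])
    finally show "x s \<noteq> 0" "y s \<noteq> 0" by auto
  qed
  have ev: "\<forall>\<^sub>F s in at_left T. c < s \<and> s < T"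
    unfolding eventually_at_left_field using c by blast
  then show "\<forall>\<^sub>F s in at_left T. x s \<noteq> 0 \<and> y s \<noteq> 0" by eventually_elim (use nz in auto)
  \<comment> \<open>\<open>cosp \<le> - 1 / 2\<close>: the curve moves inwards with radial speed at
    least \<open>1 / 2\<close> and reaches radius 0 at \<open>T\<close>.\<close>
  have r: "(T - s) / 2 \<le> rad (x s) (y s)" if s: "c < s" "s < T" for s
  proof -
    have r0: "((\<lambda>s. rad (x s) (y s)) \<longlongrightarrow> 0) (at_left T)" using tendsto_rad[OF x0 y0] by (simp add: rad_def)
    have "((\<lambda>u. rad (x s) (y s) - (u - s) / 2 - rad (x u) (y u)) \<longlongrightarrow> rad (x s) (y s) - (T - s) / 2 - 0) (at_left T)"
      by (intro tendsto_intros r0) auto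
    then have "0 \<le> rad (x s) (y s) - (T - s) / 2 - 0"
    proof (rule limit_at_left_ge[OF _ s(2)])
      fix u assume u: "s < u" "u < T"
      show "0 \<le> rad (x s) (y s) - (u - s) / 2 - rad (x u) (y u)"
      proof -
        have "(\<lambda>v. - rad (x v) (y v) - v / 2) s \<le> (\<lambda>v. - rad (x v) (y v) - v / 2) u"
        proof (rule DERIV_nonneg_imp_nondecreasing[of s u])
          fix v assume v: "s \<le> v" "v \<le> u"
          then have v': "c < v" "v < T" "a < v" "c0 < v" using s u c by auto
          have "((\<lambda>v. - rad (x v) (y v) - v / 2) has_real_derivative - C v - 1 / 2) (at v)"
            unfolding C_def using v' by (auto intro!: derivative_eq_intros rad_DERIV pos)
          moreover have "0 \<le> - C v - 1 / 2" using nc(3)[OF v'(1,2) v'(1,2) v'(1,2) v'(1,2)] E(2)[OF v'(1,2)] by (simp add: C_def)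
          ultimately show "\<exists>d. ((\<lambda>v. - rad (x v) (y v) - v / 2) has_real_derivative d) (at v) \<and> 0 \<le> d" by blast
        qed (use u in auto)
        then show ?thesis by (simp add: field_simps)
      qed
    qed
    then show ?thesis by simp
  qed
  have "\<exists>t1. (t \<longlongrightarrow> t1) (at_left T)"
  proof (rule t_limit[OF c(1,2)])
    fix s assume s: "c < s" "s < T"
    have r0: "rad (x s) (y s) > 0" using r[OF s] s by argo
    have "\<bar>turning l m (H s) (x s) (y s) (t s)\<bar> \<le> coneK l m * (k * (T - s)) / rad (x s) (y s) + N * \<bar>H s\<bar>"
      unfolding N_def by (rule turning_near_cone[OF lm nz[OF s] E(1)[OF s, unfolded w_def C_def] \<eta>[OF s]])
    also have "\<dots> \<le> coneK l m * (k * 2) + N * M"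
    proof (intro add_mono mult_left_mono)
      have "coneK l m * (k * (T - s)) \<le> coneK l m * (k * (2 * rad (x s) (y s)))"
        using r[OF s] k coneK_nonneg[OF lm] by (intro mult_left_mono) auto
      then show "coneK l m * (k * (T - s)) / rad (x s) (y s) \<le> coneK l m * (k * 2)"
        using r0 by (simp add: pos_divide_le_eq mult_ac)
      show "\<bar>H s\<bar> \<le> M" using M(2)[of s] s c by simp
    qed (use N in auto)
    finally show "x s \<noteq> 0 \<and> y s \<noteq> 0 \<and> \<bar>turning l m (H s) (x s) (y s) (t s)\<bar> \<le> coneK l m * (k * 2) + N * M"
      using nz[OF s] by simp
  qed
  then obtain t1 where t1: "(t \<longlongrightarrow> t1) (at_left T)" by blast
  have "((\<lambda>s. (cos (t s))\<^sup>2 - cshare l m) \<longlongrightarrow> 0) (at_left T)"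
  proof (rule Lim_null_comparison)
    \<comment> \<open>11 is \<open>4 * 2 + 3\<close>: four times the bound for \<open>sinp\<close>
      plus the bound for \<open>share - cshare\<close>.\<close>
    show "\<forall>\<^sub>F s in at_left T. norm ((cos (t s))\<^sup>2 - cshare l m) \<le> 11 * (k * (T - s))"
      using ev
    proof eventually_elim
      case (elim s)
      then have s: "c < s" "s < T" by auto
      show ?case using cos_sq_near_share[OF or[OF s], of "t s"] nc(1,2)[OF s s s s] by simp
    qed
    have "((\<lambda>s. 11 * (k * (T - s))) \<longlongrightarrow> 11 * (k * (T - T))) (at_left T)" by (intro tendsto_intros)
    then show "((\<lambda>s. 11 * (k * (T - s))) \<longlongrightarrow> 0) (at_left T)" by simp
  qed
  moreover have "((\<lambda>s. (cos (t s))\<^sup>2 - cshare l m) \<longlongrightarrow> (cos t1)\<^sup>2 - cshare l m) (at_left T)" by (intro tendsto_intros t1)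
  ultimately have "(cos t1)\<^sup>2 - cshare l m = 0"
    using tendsto_unique[of "at_left T"] by (metis trivial_limit_at_left_real)
  with t1 show "\<exists>t1. (t \<longlongrightarrow> t1) (at_left T) \<and> (cos t1)\<^sup>2 = cshare l m" by auto
qed

end

section \<open>Closing a half-open solution\<close>

context half_open_solution
begin

lemma arrive:
  obtains x1 y1 t1 where "(x \<longlongrightarrow> x1) (at_left T)" "(y \<longlongrightarrow> y1) (at_left T)" "(t \<longlongrightarrow> t1) (at_left T)"
    "admissible l m x1 y1 t1" "\<forall>\<^sub>F s in at_left T. x s \<noteq> 0 \<and> y s \<noteq> 0"
proof -
  obtain x1 where x1: "(x \<longlongrightarrow> x1) (at_left T)" using x_limit by blast
  obtain y1 where y1: "(y \<longlongrightarrow> y1) (at_left T)" using y_limit by blast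
  interpret swapped: half_open_solution m l "\<lambda>s. - H s" a T y x "\<lambda>s. pi / 2 - t s" by (rule swap)
  have "\<exists>t1. (t \<longlongrightarrow> t1) (at_left T) \<and> admissible l m x1 y1 t1 \<and> (\<forall>\<^sub>F s in at_left T. x s \<noteq> 0 \<and> y s \<noteq> 0)"
  proof (cases "x1 = 0"; cases "y1 = 0")
    assume z: "x1 \<noteq> 0" "y1 \<noteq> 0"
    then show ?thesis using arrive_regular[OF x1 y1] by (auto simp: admissible_def)
  next
    assume z: "x1 = 0" "y1 \<noteq> 0"
    then show ?thesis using arrive_axis[OF _ y1] x1 by (auto simp: admissible_def)
  next
    assume z: "x1 = 0" "y1 = 0"
    then show ?thesis using arrive_origin x1 y1 by (auto simp: admissible_def)
  next
    assume z: "x1 \<noteq> 0" "y1 = 0"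
    obtain t1 where t1: "((\<lambda>s. pi / 2 - t s) \<longlongrightarrow> t1) (at_left T)" "sin t1 = 0"
      and ev: "\<forall>\<^sub>F s in at_left T. y s \<noteq> 0 \<and> x s \<noteq> 0"
      using swapped.arrive_axis[OF _ x1] y1 z by auto
    have "((\<lambda>s. pi / 2 - (pi / 2 - t s)) \<longlongrightarrow> pi / 2 - t1) (at_left T)" by (intro tendsto_intros t1)
    moreover have "cos (pi / 2 - t1) = 0" using t1(2) by (simp add: cos_diff)
    ultimately show ?thesis using z ev
      by (intro exI[of _ "pi / 2 - t1"]) (auto simp: admissible_def elim: eventually_mono)
  qed
  then show thesis using that x1 y1 by blast
qed

text \<open>The limits of the derivatives are the derivatives at \<open>T\<close>, and since
  \<open>x * y\<close> has no zeros shortly before \<open>T\<close>, the finite set of zeros gains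
  at most the point \<open>T\<close>.\<close>

lemma close_up:
  "\<exists>x' y' t'. solution_on l m H a T x' y' t' \<and> (\<forall>s<T. x' s = x s \<and> y' s = y s \<and> t' s = t s)"
proof -
  obtain x1 y1 t1 where lim: "(x \<longlongrightarrow> x1) (at_left T)" "(y \<longlongrightarrow> y1) (at_left T)" "(t \<longlongrightarrow> t1) (at_left T)"
    and adm: "admissible l m x1 y1 t1" and ev: "\<forall>\<^sub>F s in at_left T. x s \<noteq> 0 \<and> y s \<noteq> 0"
    by (rule arrive)
  define x' where "x' s = (if s < T then x s else x1)" for s
  define y' where "y' s = (if s < T then y s else y1)" for s
  define t' where "t' s = (if s < T then t s else t1)" for s
  have agree: "x' s = x s" "y' s = y s" "t' s = t s" if "s < T" for s
    using that by (simp_all add: x'_def y'_def t'_def)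
  have at_T: "x' T = x1" "y' T = y1" "t' T = t1" by (simp_all add: x'_def y'_def t'_def)
  have lim_cong: "(f' \<longlongrightarrow> v) (at_left T)" if "(f \<longlongrightarrow> v) (at_left T)" "\<And>s. s < T \<Longrightarrow> f' s = f s" for f f' and v :: real
    by (rule Lim_transform_eventually[OF that(1)]) (simp add: eventually_at_filter that(2))
  have der_cong: "(f' has_real_derivative d) (at s)"
    if "(f has_real_derivative d) (at s)" "\<And>s. s < T \<Longrightarrow> f' s = f s" "s < T" for f f' d s
    by (rule has_field_derivative_transform_within_open[OF that(1), of "{..<T}"]) (use that in auto)
  have sol': "solution_on l m H a b x' y' t'" if "b < T" for b
    by (rule solution_on_cong[OF sol[OF that]]) (use that agree in auto)
  have nhd: "at s within {a..T} = at s within {a..b}" if "s < b" "b < T" for s b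
    using that by (intro at_within_nhd[where S="{..<b}"]) auto
  have last: "(f' has_real_derivative d (t' T)) (at T within {a..T})"
    if f: "(f \<longlongrightarrow> f' T) (at_left T)" "\<And>s. s < T \<Longrightarrow> f' s = f s" "\<And>v. isCont d v"
      "\<And>s. a < s \<Longrightarrow> s < T \<Longrightarrow> (f has_real_derivative d (t s)) (at s)" for f f' d
  proof (rule has_real_derivative_left_endpoint[OF aT])
    show "(f' \<longlongrightarrow> f' T) (at_left T)" using f(1,2) by (rule lim_cong)
    show "(f' has_real_derivative d (t s)) (at s)" if s: "a < s" "s < T" for s
      using f(4)[OF s] f(2) s(2) by (rule der_cong)
    show "((\<lambda>s. d (t s)) \<longlongrightarrow> d (t' T)) (at_left T)"
      unfolding at_T using f(3) lim(3) by (rule isCont_tendsto_compose)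
  qed (rule aT)
  obtain c where c: "c < T" "\<And>s. c < s \<Longrightarrow> s < T \<Longrightarrow> x s \<noteq> 0 \<and> y s \<noteq> 0"
    using ev unfolding eventually_at_left_field by blast
  have "solution_on l m H a T x' y' t'"
    unfolding solution_on_def
  proof (intro conjI ballI impI)
    fix s assume s: "s \<in> {a..T}"
    consider (before) b where "s < b" "b < T" | (last) "s = T"
      using s dense[of s T] by fastforce
    note cs = this
    show "(x' has_real_derivative cos (t' s)) (at s within {a..T})"
      using cs
    proof cases
      case before
      then show ?thesis using solution_onD(1)[OF sol'[OF before(2)], of s] s nhd by simp
    next
      case sT: last
      show ?thesis unfolding sT
        by (rule last) (use lim(1) at_T agree(1) dx in auto)
    qed
    show "(y' has_real_derivative sin (t' s)) (at s within {a..T})"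
      using cs
    proof cases
      case before
      then show ?thesis using solution_onD(2)[OF sol'[OF before(2)], of s] s nhd by simp
    next
      case sT: last
      show ?thesis unfolding sT
        by (rule last) (use lim(2) at_T agree(2) dy in auto)
    qed
    show "(t' has_real_derivative turning l m (H s) (x' s) (y' s) (t' s)) (at s within {a..T})"
      if nz: "x' s \<noteq> 0" "y' s \<noteq> 0"
      using cs
    proof cases
      case before
      then show ?thesis using solution_onD(3)[OF sol'[OF before(2)], of s] s nhd nz by simp
    next
      case sT: last
      have nz1: "x1 \<noteq> 0" "y1 \<noteq> 0" using nz sT at_T by auto
      have HT: "(H \<longlongrightarrow> H T) (at_left T)"
        using H by (auto simp: continuous_on_def intro: tendsto_within_subset)
      show ?thesis unfolding sT
      proof (rule has_real_derivative_left_endpoint[where c="max a c"])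
        show "(t' \<longlongrightarrow> t' T) (at_left T)" unfolding at_T using lim(3) agree(3) by (rule lim_cong)
        show "(t' has_real_derivative turning l m (H s) (x s) (y s) (t s)) (at s)" if "max a c < s" "s < T" for s
          by (rule der_cong[OF dt agree(3)]) (use that c(2)[of s] in auto)
        show "((\<lambda>s. turning l m (H s) (x s) (y s) (t s)) \<longlongrightarrow> turning l m (H T) (x' T) (y' T) (t' T)) (at_left T)"
          unfolding at_T turning_def by (intro tendsto_intros lim nz1 HT)
      qed (use aT c in auto)
    qed
    show "admissible l m (x' s) (y' s) (t' s)"
      using cs
    proof cases
      case before
      then show ?thesis using solution_onD(4)[OF sol'[OF before(2)], of s] s by simp
    next
      case last
      then show ?thesis using adm by (simp add: at_T)
    qed
  next
    have "{s \<in> {a..T}. x' s * y' s = 0} \<subseteq> {s \<in> {a..c}. x s * y s = 0} \<union> {T}"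
    proof
      fix s assume "s \<in> {s \<in> {a..T}. x' s * y' s = 0}"
      then have s: "a \<le> s" "s \<le> T" "x' s * y' s = 0" by auto
      show "s \<in> {s \<in> {a..c}. x s * y s = 0} \<union> {T}"
      proof (cases "s < T")
        case True
        then have "x s * y s = 0" using s agree[OF True] by simp
        moreover from this have "\<not> c < s" using c(2)[of s] True by auto
        ultimately show ?thesis using s by simp
      qed (use s in simp)
    qed
    then show "finite {s \<in> {a..T}. x' s * y' s = 0}"
      by (rule finite_subset) (use finite_zeros[OF c(1)] in simp)
    show "continuous_on {a..T} t'"
      unfolding continuous_on_def
    proof
      fix s assume s: "s \<in> {a..T}"
      consider (before) b where "s < b" "b < T" | (last) "s = T"
        using s dense[of s T] by fastforce
      then show "(t' \<longlongrightarrow> t' s) (at s within {a..T})"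
      proof cases
        case before
        then have "continuous_on {a..b} t'" using sol' by (simp add: solution_on_def)
        then show ?thesis using s before unfolding nhd[OF before] by (auto simp: continuous_on_def)
      next
        case last
        have "(t' \<longlongrightarrow> t' T) (at_left T)" unfolding at_T using lim(3) agree(3) by (rule lim_cong)
        then show ?thesis unfolding last using aT by (simp add: at_within_Icc_at_left)
      qed
    qed
  qed
  then show ?thesis using agree by blast
qed

end

section \<open>Continuation to the whole line\<close>

text \<open>Without uniqueness one chooses the extensions greedily: each step covers at least half of
  the range (or a unit length) that could be reached at all.\<close>

lemma unbounded_extension:
  fixes P :: "real \<Rightarrow> (real \<Rightarrow> 'a) \<Rightarrow> bool"
  assumes start: "P b0 f0" "a < b0"
    and ext: "\<And>b f. a < b \<Longrightarrow> P b f \<Longrightarrow> \<exists>c>b. \<exists>g. P c g \<and> (\<forall>s\<in>{a..b}. g s = f s)"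
    and close: "\<And>T f. a < T \<Longrightarrow> (\<And>b. a < b \<Longrightarrow> b < T \<Longrightarrow> P b f) \<Longrightarrow>
      \<exists>g. P T g \<and> (\<forall>s. a \<le> s \<longrightarrow> s < T \<longrightarrow> g s = f s)"
    and mono: "\<And>b c f. P b f \<Longrightarrow> a < c \<Longrightarrow> c \<le> b \<Longrightarrow> P c f"
    and cong: "\<And>b f g. P b f \<Longrightarrow> (\<And>s. s \<in> {a..b} \<Longrightarrow> g s = f s) \<Longrightarrow> P b g"
  shows "\<exists>f. (\<forall>b>a. P b f) \<and> f a = f0 a"
proof -
  \<comment> \<open>\<open>q\<close> extends \<open>p\<close> and is nearly optimal: it gains a unit
    length, or at least half of what any extension of \<open>p\<close> could gain.\<close>
  define R where "R p q \<longleftrightarrow> fst p < fst q \<and> (\<forall>s\<in>{a..fst p}. snd q s = snd p s) \<and>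
      (fst p + 1 \<le> fst q \<or>
       (\<forall>c g. P c g \<longrightarrow> (\<forall>s\<in>{a..fst p}. g s = snd p s) \<longrightarrow> c - fst p \<le> 2 * (fst q - fst p)))"
    for p q :: "real \<times> (real \<Rightarrow> 'a)"
  define V where "V n p \<longleftrightarrow> a < fst p \<and> P (fst p) (snd p) \<and> (n = 0 \<longrightarrow> p = (b0, f0))"
    for n :: nat and p :: "real \<times> (real \<Rightarrow> 'a)"
  have step: "\<exists>q. V (Suc n) q \<and> R p q" if V: "V n p" for p n
  proof -
    obtain b f where p: "p = (b, f)" by (cases p)
    have b: "a < b" "P b f" using V by (auto simp: V_def p)
    define S where "S = {c. b < c \<and> (\<exists>g. P c g \<and> (\<forall>s\<in>{a..b}. g s = f s))}"
    have "\<exists>c\<in>S. b + 1 \<le> c \<or> (\<forall>c' g. P c' g \<longrightarrow> (\<forall>s\<in>{a..b}. g s = f s) \<longrightarrow> c' - b \<le> 2 * (c - b))"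
    proof (cases "\<exists>c\<in>S. b + 1 \<le> c")
      case True then show ?thesis by blast
    next
      case False
      then have bdd: "bdd_above S" by (intro bdd_aboveI[of _ "b + 1"]) force
      obtain c0 where c0: "c0 \<in> S" using ext[OF b] by (auto simp: S_def)
      then have "b < Sup S" using cSup_upper[OF c0 bdd] by (auto simp: S_def)
      \<comment> \<open>Beyond the midpoint between \<open>b\<close> and the supremum, which yields
        the factor 2 in \<open>R\<close>.\<close>
      then obtain c where c: "c \<in> S" "(b + Sup S) / 2 < c"
        using less_cSupE[of "(b + Sup S) / 2" S] c0 by force
      have "c' - b \<le> 2 * (c - b)" if c': "P c' g" "\<forall>s\<in>{a..b}. g s = f s" for c' g
      proof (cases "b < c'")
        case True
        then have "c' \<in> S" using c' by (auto simp: S_def)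
        then have "c' \<le> Sup S" by (rule cSup_upper[OF _ bdd])
        then show ?thesis using c by argo
      next
        case False
        then show ?thesis using c by (auto simp: S_def)
      qed
      then show ?thesis using c by blast
    qed
    then obtain c g where "b < c" "P c g" "\<forall>s\<in>{a..b}. g s = f s"
      "b + 1 \<le> c \<or> (\<forall>c' g. P c' g \<longrightarrow> (\<forall>s\<in>{a..b}. g s = f s) \<longrightarrow> c' - b \<le> 2 * (c - b))"
      by (auto simp: S_def)
    then have "V (Suc n) (c, g) \<and> R p (c, g)" using b by (auto simp: V_def R_def p)
    then show ?thesis by blast
  qed
  have "\<exists>p. V 0 p" using start by (auto simp: V_def)
  then obtain p where "\<And>n. V n (p n)" "\<And>n. R (p n) (p (Suc n))"
    using dependent_nat_choice[of V "\<lambda>_. R"] step by blast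
  define B where "B n = fst (p n)" for n
  define F where "F n = snd (p n)" for n
  have B: "a < B n" "P (B n) (F n)" "B n < B (Suc n)" for n
    using \<open>V n (p n)\<close> \<open>R (p n) (p (Suc n))\<close> by (auto simp: V_def R_def B_def F_def)
  have F0: "F 0 = f0" using \<open>V 0 (p 0)\<close> by (simp add: V_def F_def)
  have FS: "F (Suc n) s = F n s" if "s \<in> {a..B n}" for n s
    using \<open>R (p n) (p (Suc n))\<close> that by (auto simp: R_def B_def F_def)
  have far: "B n + 1 \<le> B (Suc n) \<or> c - B n \<le> 2 * (B (Suc n) - B n)"
    if "P c g" "\<And>s. s \<in> {a..B n} \<Longrightarrow> g s = F n s" for n c g
    using \<open>R (p n) (p (Suc n))\<close> that by (auto simp: R_def B_def F_def)
  have Bmono: "B n \<le> B k" if "n \<le> k" for n k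
    using that by (induction rule: dec_induct) (use B(3) in \<open>auto intro: order_trans less_imp_le\<close>)
  have Fmono: "F k s = F n s" if "n \<le> k" "s \<in> {a..B n}" for n k s
    using that
  proof (induction rule: dec_induct)
    case (step k)
    then show ?case using FS[of s k] Bmono[of n k] by auto
  qed simp
  \<comment> \<open>The common extension of all \<open>F n\<close>; these agree wherever their
    intervals overlap.\<close>
  define G where "G s = F (LEAST n. s \<le> B n) s" for s
  have GF: "G s = F n s" if "s \<in> {a..B n}" for n s
  proof -
    have "(LEAST n. s \<le> B n) \<le> n" "s \<le> B (LEAST n. s \<le> B n)"
      using that by (auto intro: Least_le LeastI)
    then show ?thesis using that by (auto simp: G_def intro!: Fmono[symmetric])
  qed
  have PG: "P (B n) G" for n using B(2) by (rule cong) (rule GF)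
  have "\<exists>n. b \<le> B n" for b
  proof (rule ccontr)
    assume "\<not> ?thesis"
    then have bd: "B n < b" for n by (simp add: not_le)
    then have bdd: "bdd_above (range B)" by (intro bdd_aboveI[of _ b]) (auto intro: less_imp_le)
    define \<beta> where "\<beta> = Sup (range B)"
    have up: "B n \<le> \<beta>" for n unfolding \<beta>_def using bdd by (intro cSup_upper) auto
    have up': "B n < \<beta>" for n using B(3)[of n] up[of "Suc n"] by simp
    have a\<beta>: "a < \<beta>" using B(1)[of 0] up'[of 0] by simp
    have "P c G" if ac: "a < c" "c < \<beta>" for c
    proof -
      obtain n where "c < B n"
        using less_cSup_iff[OF _ bdd, of c] ac(2) unfolding \<beta>_def by auto
      then show ?thesis using mono[OF PG] ac by (auto intro: less_imp_le)
    qed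
    then obtain g where g: "P \<beta> g" "\<And>s. a \<le> s \<Longrightarrow> s < \<beta> \<Longrightarrow> g s = G s" using close[OF a\<beta>] by blast
    obtain \<gamma> h where h: "\<beta> < \<gamma>" "P \<gamma> h" "\<And>s. s \<in> {a..\<beta>} \<Longrightarrow> h s = g s" using ext[OF a\<beta> g(1)] by blast
    \<comment> \<open>A finite limit \<open>\<beta>\<close> could be passed, up to
      \<open>\<gamma>\<close>. This extension was open to every step, so each must have gained at
      least \<open>\<epsilon>\<close>, contradicting boundedness.\<close>
    define \<epsilon> where "\<epsilon> = min 1 ((\<gamma> - \<beta>) / 2)"
    have \<epsilon>: "\<epsilon> > 0" using h(1) by (simp add: \<epsilon>_def)
    have inc: "B n + \<epsilon> \<le> B (Suc n)" for n
    proof -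
      have "h s = F n s" if "s \<in> {a..B n}" for s
        using that up'[of n] h(3)[of s] g(2)[of s] GF[OF that] by auto
      from far[OF h(2) this] have "B n + 1 \<le> B (Suc n) \<or> \<gamma> - B n \<le> 2 * (B (Suc n) - B n)" .
      moreover have "\<epsilon> \<le> 1" "\<epsilon> \<le> (\<gamma> - \<beta>) / 2"
        unfolding \<epsilon>_def by (rule min.cobounded1, rule min.cobounded2)
      ultimately show ?thesis using up'[of n] by argo
    qed
    have lin: "B 0 + real n * \<epsilon> \<le> B n" for n
    proof (induction n)
      case (Suc n)
      then show ?case using inc[of n] by (simp add: algebra_simps)
    qed simp
    obtain n where "b - B 0 < real n * \<epsilon>" using reals_Archimedean3[OF \<epsilon>] by blast
    then show False using lin[of n] bd[of n] by simp
  qed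
  then have "P b G" if "a < b" for b using mono[OF PG] that by blast
  moreover have "G a = f0 a" using GF[of a 0] B(1)[of 0] F0 by simp
  ultimately show ?thesis by blast
qed

section \<open>Forward and two-sided solutions\<close>

lemma forward_solution:
  assumes lm: "l \<ge> 1" "m \<ge> 1" and H: "continuous_on UNIV H" and adm: "admissible l m x0 y0 t0"
  shows "\<exists>x y t. (\<forall>b>a. solution_on l m H a b x y t) \<and> x a = x0 \<and> y a = y0 \<and> t a = t0"
proof -
  define P where "P b f \<longleftrightarrow> solution_on l m H a b (\<lambda>s. fst (f s)) (\<lambda>s. fst (snd (f s))) (\<lambda>s. snd (snd (f s)))"
    for b and f :: "real \<Rightarrow> real \<times> real \<times> real"
  obtain b0 x y t where b0: "a < b0" and s0: "solution_on l m H a b0 x y t" and i: "x a = x0" "y a = y0" "t a = t0"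
    using depart[OF H lm adm, of a] by blast
  have "\<exists>f. (\<forall>b>a. P b f) \<and> f a = (\<lambda>s. (x s, y s, t s)) a"
  proof (rule unbounded_extension[where a=a and ?b0.0=b0 and ?f0.0="\<lambda>s. (x s, y s, t s)"])
    show "P b0 (\<lambda>s. (x s, y s, t s))" using s0 by (simp add: P_def)
    show "P c f" if "P b f" "a < c" "c \<le> b" for b c f
      using that(1) unfolding P_def by (rule solution_on_subset) (use that in auto)
    show "P b g" if "P b f" "\<And>s. s \<in> {a..b} \<Longrightarrow> g s = f s" for b f g
      using that(1) unfolding P_def by (rule solution_on_cong) (use that(2) in auto)
  next
    fix b f assume b: "a < b" and Pb: "P b f"
    have "admissible l m (fst (f b)) (fst (snd (f b))) (snd (snd (f b)))"
      using solution_onD(4)[OF Pb[unfolded P_def], of b] b by simp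
    then obtain c x y t where c: "b < c" and s: "solution_on l m H b c x y t"
      and i: "x b = fst (f b)" "y b = fst (snd (f b))" "t b = snd (snd (f b))"
      using depart[OF H lm, of _ _ _ b] by blast
    define g where "g s = (if s \<le> b then f s else (x s, y s, t s))" for s
    have gb: "g s = (x s, y s, t s)" if "s \<in> {b..c}" for s
      using that i by (cases "s = b") (auto simp: g_def)
    have "P c g" unfolding P_def
    proof (rule solution_on_glue)
      show "solution_on l m H a b (\<lambda>s. fst (g s)) (\<lambda>s. fst (snd (g s))) (\<lambda>s. snd (snd (g s)))"
        by (rule solution_on_cong[OF Pb[unfolded P_def]]) (auto simp: g_def)
      show "solution_on l m H b c (\<lambda>s. fst (g s)) (\<lambda>s. fst (snd (g s))) (\<lambda>s. snd (snd (g s)))"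
        by (rule solution_on_cong[OF s]) (simp_all add: gb)
    qed (use b c in auto)
    then show "\<exists>c>b. \<exists>g. P c g \<and> (\<forall>s\<in>{a..b}. g s = f s)"
      using c by (intro exI[of _ c] conjI exI[of _ g]) (auto simp: g_def)
  next
    fix T f assume T: "a < T" and PT: "\<And>b. a < b \<Longrightarrow> b < T \<Longrightarrow> P b f"
    have "solution_on l m H a b (\<lambda>s. fst (f s)) (\<lambda>s. fst (snd (f s))) (\<lambda>s. snd (snd (f s)))" if "b < T" for b
    proof (rule solution_on_subset)
      \<comment> \<open>The locale asks for every \<open>b < T\<close>, including
        \<open>b \<le> a\<close>; such intervals are obtained by restriction from one that extends
        beyond \<open>a\<close>.\<close>
      have m: "a < max b ((a + T) / 2)" "max b ((a + T) / 2) < T"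
        using T that by (auto simp: less_max_iff_disj)
      show "solution_on l m H a (max b ((a + T) / 2)) (\<lambda>s. fst (f s)) (\<lambda>s. fst (snd (f s))) (\<lambda>s. snd (snd (f s)))"
        using PT[OF m] unfolding P_def .
    qed auto
    then interpret half_open_solution l m H a T "\<lambda>s. fst (f s)" "\<lambda>s. fst (snd (f s))" "\<lambda>s. snd (snd (f s))"
      using lm H T by unfold_locales auto
    obtain x' y' t' where "solution_on l m H a T x' y' t'"
      and e: "\<And>s. s < T \<Longrightarrow> x' s = fst (f s) \<and> y' s = fst (snd (f s)) \<and> t' s = snd (snd (f s))"
      using close_up by blast
    then show "\<exists>g. P T g \<and> (\<forall>s. a \<le> s \<longrightarrow> s < T \<longrightarrow> g s = f s)"
      by (intro exI[of _ "\<lambda>s. (x' s, y' s, t' s)"]) (auto simp: P_def prod_eq_iff)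
  qed fact
  then obtain f where f: "\<And>b. a < b \<Longrightarrow> P b f" "f a = (x0, y0, t0)" using i by auto
  show ?thesis
    by (intro exI[of _ "\<lambda>s. fst (f s)"] exI[of _ "\<lambda>s. fst (snd (f s))"] exI[of _ "\<lambda>s. snd (snd (f s))"])
      (use f in \<open>auto simp: P_def\<close>)
qed

text \<open>Traversing the curve backwards turns the tangent by \<open>pi\<close> and changes the
  sign of the mean curvature, hence the function \<open>- H (- s)\<close>.\<close>

lemma solution_on_reverse:
  assumes sol: "solution_on l m (\<lambda>s. - H (- s)) a b x y t"
  shows "solution_on l m H (- b) (- a) (\<lambda>s. x (- s)) (\<lambda>s. y (- s)) (\<lambda>s. t (- s) + pi)"
proof -
  have rev: "((\<lambda>s. f (- s)) has_real_derivative - D) (at s within {- b..- a})"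
    if "(f has_real_derivative D) (at (- s) within {a..b})" for f D s
  proof -
    have "((f \<circ> (\<lambda>s. - s)) has_real_derivative D * - 1) (at s within {- b..- a})"
    proof (rule DERIV_image_chain)
      have "(\<lambda>s. - s) ` {- b..- a} = {a..b}" by simp
      then show "(f has_real_derivative D) (at (- s) within (\<lambda>s. - s) ` {- b..- a})" using that by simp
    qed (auto intro!: derivative_eq_intros)
    then show ?thesis by (simp add: o_def)
  qed
  have turn: "- turning l m (- h) x y t = turning l m h x y (t + pi)" for h x y t
    by (simp add: turning_def algebra_simps)
  have fin: "finite {s \<in> {a..b}. x s * y s = 0}" and ct: "continuous_on {a..b} t"
    using sol unfolding solution_on_def by blast+
  have "{s \<in> {- b..- a}. x (- s) * y (- s) = 0} \<subseteq> uminus ` {s \<in> {a..b}. x s * y s = 0}"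
  proof
    fix s assume "s \<in> {s \<in> {- b..- a}. x (- s) * y (- s) = 0}"
    then show "s \<in> uminus ` {s \<in> {a..b}. x s * y s = 0}" by (intro image_eqI[of _ _ "- s"]) auto
  qed
  then have "finite {s \<in> {- b..- a}. x (- s) * y (- s) = 0}" by (rule finite_subset) (use fin in simp)
  moreover have "continuous_on {- b..- a} (\<lambda>s. t (- s) + pi)"
    by (intro continuous_intros continuous_on_compose2[OF ct]) auto
  moreover have "((\<lambda>s. x (- s)) has_real_derivative cos (t (- s) + pi)) (at s within {- b..- a})"
      "((\<lambda>s. y (- s)) has_real_derivative sin (t (- s) + pi)) (at s within {- b..- a})"
      "x (- s) \<noteq> 0 \<Longrightarrow> y (- s) \<noteq> 0 \<Longrightarrow> ((\<lambda>s. t (- s) + pi) has_real_derivative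
         turning l m (H s) (x (- s)) (y (- s)) (t (- s) + pi)) (at s within {- b..- a})"
      "admissible l m (x (- s)) (y (- s)) (t (- s) + pi)"
    if s: "s \<in> {- b..- a}" for s
  proof -
    have s': "- s \<in> {a..b}" using s by auto
    note D = solution_onD[OF sol s']
    show "((\<lambda>s. x (- s)) has_real_derivative cos (t (- s) + pi)) (at s within {- b..- a})"
      "((\<lambda>s. y (- s)) has_real_derivative sin (t (- s) + pi)) (at s within {- b..- a})"
      using rev[OF D(1)] rev[OF D(2)] by simp_all
    show "admissible l m (x (- s)) (y (- s)) (t (- s) + pi)" using D(4) by (simp add: admissible_def)
    show "((\<lambda>s. t (- s) + pi) has_real_derivative
         turning l m (H s) (x (- s)) (y (- s)) (t (- s) + pi)) (at s within {- b..- a})"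
      if nz: "x (- s) \<noteq> 0" "y (- s) \<noteq> 0"
      using DERIV_add[OF rev[OF D(3)[OF nz]] DERIV_const[of pi]] turn[of "H s"] by simp
  qed
  ultimately show ?thesis unfolding solution_on_def by blast
qed

text \<open>The backward half is a forward solution of the reversed problem. It starts with angle
  \<open>t0 - pi\<close>, so that after reversal the angles themselves, and not only the directions,
  agree at \<open>s0\<close>.\<close>

lemma two_sided_solution:
  assumes lm: "l \<ge> 1" "m \<ge> 1" and H: "continuous_on UNIV H" and adm: "admissible l m x0 y0 t0"
  shows "\<exists>x y t. (\<forall>a b. solution_on l m H a b x y t) \<and> x s0 = x0 \<and> y s0 = y0 \<and> t s0 = t0"
proof -
  obtain xf yf tf where f: "\<And>b. s0 < b \<Longrightarrow> solution_on l m H s0 b xf yf tf" "xf s0 = x0" "yf s0 = y0" "tf s0 = t0"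
    using forward_solution[OF lm H adm, of s0] by blast
  have H': "continuous_on UNIV (\<lambda>s. - H (- s))"
    by (rule continuous_on_minus[OF continuous_on_compose2[OF H continuous_on_minus[OF continuous_on_id]]]) simp
  have "admissible l m x0 y0 (t0 - pi)" using adm by (simp add: admissible_def)
  then obtain xr yr tr where r: "\<And>b. - s0 < b \<Longrightarrow> solution_on l m (\<lambda>s. - H (- s)) (- s0) b xr yr tr"
      "xr (- s0) = x0" "yr (- s0) = y0" "tr (- s0) = t0 - pi"
    using forward_solution[OF lm H', of x0 y0 "t0 - pi" "- s0"] by blast
  define x y t where "x s = (if s \<le> s0 then xr (- s) else xf s)" and "y s = (if s \<le> s0 then yr (- s) else yf s)"
    and "t s = (if s \<le> s0 then tr (- s) + pi else tf s)" for s
  have "solution_on l m H a b x y t" for a b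
  proof -
    define k where "k = 1 + \<bar>a - s0\<bar> + \<bar>b - s0\<bar>"
    have k: "k > 0" "s0 - k \<le> a" "b \<le> s0 + k" by (auto simp: k_def)
    have "solution_on l m H (s0 - k) (s0 + k) x y t"
    proof (rule solution_on_glue)
      have rev: "solution_on l m H (- (k - s0)) (- (- s0)) (\<lambda>s. xr (- s)) (\<lambda>s. yr (- s)) (\<lambda>s. tr (- s) + pi)"
        by (rule solution_on_reverse[where H=H, OF r(1)]) (use k in simp)
      have "solution_on l m H (- (k - s0)) (- (- s0)) x y t"
        by (rule solution_on_cong[OF rev]) (simp_all add: x_def y_def t_def)
      then show "solution_on l m H (s0 - k) s0 x y t" by simp
      show "solution_on l m H s0 (s0 + k) x y t"
      proof (rule solution_on_cong[OF f(1)])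
        fix s assume "s \<in> {s0..s0 + k}"
        then show "x s = xf s" "y s = yf s" "t s = tf s"
          by (cases "s = s0"; simp add: x_def y_def t_def f(2-4) r(2-4))+
      qed (use k in simp)
    qed (use k in auto)
    then show ?thesis by (rule solution_on_subset) (use k in auto)
  qed
  moreover have "x s0 = x0" "y s0 = y0" "t s0 = t0" by (simp_all add: x_def y_def t_def r(2-4))
  ultimately show ?thesis by blast
qed

section \<open>From the lifted angle to the curvature equation\<close>

theorem theorem4p1:
  fixes l m n :: nat and H :: "real \<Rightarrow> real" and s0 c d c' d' :: real
  assumes "l \<ge> 1" and "m \<ge> 1" and "n = l + m + 2"
    and "continuous_on UNIV H"
    and "c > 0" and "d > 0" and "c'\<^sup>2 + d'\<^sup>2 = 1"
  shows "\<exists>x y. global_solution_curve l m n H x y \<and>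
           x s0 = c \<and> y s0 = d \<and> deriv x s0 = c' \<and> deriv y s0 = d'"
proof -
  obtain t0 where t0: "c' = cos t0" "d' = sin t0"
    using sincos_total_2pi[OF assms(7)] by metis
  have "admissible l m c d t0" using assms(5,6) by (simp add: admissible_def)
  then obtain x y t where sol: "\<And>a b. solution_on l m H a b x y t" and i: "x s0 = c" "y s0 = d" "t s0 = t0"
    using two_sided_solution[OF assms(1,2,4)] by blast
  \<comment> \<open>\<open>s\<close> is interior to \<open>[s - 1, s + 1]\<close>, so the
    derivatives relative to intervals are two-sided.\<close>
  have at: "at s within {s - 1..s + 1} = at s" for s :: real by (simp add: at_within_Icc_at)
  have Dx: "(x has_real_derivative cos (t s)) (at s)" and Dy: "(y has_real_derivative sin (t s)) (at s)"
    and Dt: "x s \<noteq> 0 \<Longrightarrow> y s \<noteq> 0 \<Longrightarrow> (t has_real_derivative turning l m (H s) (x s) (y s) (t s)) (at s)" for s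
    using solution_onD[OF sol[of "s - 1" "s + 1"], of s] by (simp_all add: at)
  have ct: "continuous_on A t" for A
  proof -
    have "isCont t s" for s
      using sol[of "s - 1" "s + 1"] continuous_on_interior[of "{s - 1..s + 1}" t s]
      by (auto simp: solution_on_def)
    then show ?thesis by (simp add: continuous_at_imp_continuous_on)
  qed
  have cx: "continuous_on A x" and cy: "continuous_on A y" for A
    by (rule DERIV_continuous_on[OF has_field_derivative_at_within[OF Dx]])
      (rule DERIV_continuous_on[OF has_field_derivative_at_within[OF Dy]])
  have dx: "deriv x = (\<lambda>s. cos (t s))" and dy: "deriv y = (\<lambda>s. sin (t s))"
    using Dx Dy by (auto intro!: ext DERIV_imp_deriv)
  define \<kappa> where "\<kappa> s = turning l m (H s) (x s) (y s) (t s)" for s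
  have DDx: "((\<lambda>s. cos (t s)) has_real_derivative - sin (t s) * \<kappa> s) (at s)"
    and DDy: "((\<lambda>s. sin (t s)) has_real_derivative cos (t s) * \<kappa> s) (at s)" if "x s * y s \<noteq> 0" for s
    using Dt[of s] that unfolding \<kappa>_def by (auto intro!: derivative_eq_intros)
  \<comment> \<open>Continuity of the turning off the axes is what makes the curve
    \<open>C^2\<close> there.\<close>
  have c\<kappa>: "continuous_on {s. x s * y s \<noteq> 0} \<kappa>"
    unfolding \<kappa>_def turning_def
    by (intro continuous_intros ct cx cy continuous_on_subset[OF assms(4)]) auto
  have C1x: "x C1_differentiable_on UNIV"
    unfolding C1_differentiable_on_def has_real_derivative_iff_has_vector_derivative[symmetric]
    by (intro exI[of _ "\<lambda>s. cos (t s)"] conjI ballI Dx continuous_intros ct)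
  have C1y: "y C1_differentiable_on UNIV"
    unfolding C1_differentiable_on_def has_real_derivative_iff_has_vector_derivative[symmetric]
    by (intro exI[of _ "\<lambda>s. sin (t s)"] conjI ballI Dy continuous_intros ct)
  have "deriv x C1_differentiable_on {s. x s * y s \<noteq> 0}"
    unfolding dx C1_differentiable_on_def has_real_derivative_iff_has_vector_derivative[symmetric]
    by (intro exI[of _ "\<lambda>s. - sin (t s) * \<kappa> s"] conjI ballI DDx continuous_intros ct c\<kappa>) auto
  moreover have "deriv y C1_differentiable_on {s. x s * y s \<noteq> 0}"
    unfolding dy C1_differentiable_on_def has_real_derivative_iff_has_vector_derivative[symmetric]
    by (intro exI[of _ "\<lambda>s. cos (t s) * \<kappa> s"] conjI ballI DDy continuous_intros ct c\<kappa>) auto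
  moreover have "mean_curvature_equation_at l m n H x y s" if nz: "x s * y s \<noteq> 0" for s
  proof -
    have "deriv (deriv x) s = - sin (t s) * \<kappa> s" "deriv (deriv y) s = cos (t s) * \<kappa> s"
      unfolding dx dy using DDx[OF nz] DDy[OF nz] by (auto intro: DERIV_imp_deriv)
    \<comment> \<open>Unit speed reduces the bracket \<open>x'' y' - x' y''\<close> to
      \<open>- \<kappa>\<close>; the equation is then the definition of \<open>turning\<close> with
      \<open>n - 1 = l + m + 1\<close>.\<close>
    moreover have "- sin (t s) * \<kappa> s * sin (t s) - cos (t s) * (cos (t s) * \<kappa> s) = - \<kappa> s"
    proof -
      have "- sin (t s) * \<kappa> s * sin (t s) - cos (t s) * (cos (t s) * \<kappa> s) =
          - (\<kappa> s * ((sin (t s))\<^sup>2 + (cos (t s))\<^sup>2))" by algebra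
      then show ?thesis unfolding sin_cos_squared_add by simp
    qed
    ultimately have "deriv (deriv x) s * deriv y s - deriv x s * deriv (deriv y) s = - \<kappa> s"
      unfolding dx dy by simp
    then show ?thesis
      unfolding mean_curvature_equation_at_def using assms(3)
      by (simp add: dx dy \<kappa>_def turning_def algebra_simps)
  qed
  ultimately have "global_solution_curve l m n H x y"
    unfolding global_solution_curve_def C2_differentiable_on_def
    using C1x C1y by (auto simp: dx dy intro: C1_differentiable_on_subset)
  then show ?thesis by (intro exI[of _ x] exI[of _ y]) (simp add: i t0 dx dy)
qed

end
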